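(* There is a universal constant $C>0$ such that the following holds. Let $T$ be a polytree on $[d]$, let $c\in(0,1)$, $\delta\in(0,1)$, and let $P=\mathcal{N}(0,\Sigma)$ ($\Sigma$ positive definite) be a Gaussian distribution that is Markov to $T$ and $c$-strong tree-faithful to $T$. If $n\ge \frac{C}{c^2}\big(\log d+\log(1/\delta)\big)$, then running the PC-Tree algorithm on $n$ i.i.d. samples from $P$ (with the sample-correlation CI tester at threshold $c/2$) returns $(\widehat T,S)$ with $\Pr(\widehat T=\mathrm{sk}(T))\ge 1-\delta$ and $\Pr(\textsc{Orient}(\widehat T,S)=\overline T)\ge1-\delta$.
   Context: A polytree is a DAG whose skeleton $\mathrm{sk}(T)$ (underlying undirected graph) is a tree. $P$ is Markov to a DAG $T$ if its density factorizes as $\prod_k P(x_k\mid x_{\mathrm{pa}_T(k)})$. A v-structure is a triple $j\to\ell\leftarrow k$ with $j,k$ nonadjacent. $\overline T$ is the CPDAG (Markov equivalence class representative) of $T$, i.e. the partially directed graph with skeleton $\mathrm{sk}(T)$ whose directed edges are those oriented the same way in every DAG Markov equivalent to $T$. For $j\neq k$ and $\ell\in[d]\setminus\{j,k\}$, $\rho(X_j,X_k\mid X_\ell)$ is the partial correlation of $X_j,X_k$ given $X_\ell$, and $\rho(X_j,X_k\mid X_\emptyset)$ the ordinary correlation. $P$ is $c$-strong tree-faithful to $T$ if (1) for every edge $j-k$ of $T$ and every $\ell\in([d]\cup\{\emptyset\})\setminus\{j,k\}$, $|\rho(X_j,X_k\mid X_\ell)|\ge c$; and (2) for every v-structure $k\to\ell\leftarrow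 j$ in $T$, $|\rho(X_k,X_j\mid X_\ell)|\ge c$. Sample CI tester: with $\widehat\Sigma=\frac1n\sum_iX^{(i)}X^{(i)\top}$ and $S\in\{\emptyset,\{\ell\}\}$, $\widehat\rho_{jk\mid S}=\frac{\widehat\Sigma_{jk}-\widehat\Sigma_{jS}\widehat\Sigma_{SS}^{-1}\widehat\Sigma_{Sk}}{\sqrt{(\widehat\Sigma_{jj}-\widehat\Sigma_{jS}\widehat\Sigma_{SS}^{-1}\widehat\Sigma_{Sj})(\widehat\Sigma_{kk}-\widehat\Sigma_{kS}\widehat\Sigma_{SS}^{-1}\widehat\Sigma_{Sk})}}$; the test of $H_0:X_j\perp X_k\mid X_S$ rejects $H_0$ if $|\widehat\rho_{jk\mid S}|\ge c/2$ and accepts otherwise. PC-Tree: start with $\widehat E=\emptyset$; for each pair $j<k$, for every $\ell\in([d]\cup\{\emptyset\})\setminus\{j,k\}$ test $H_0:X_j\perp X_k\mid X_\ell$; if all tests reject, add $j-k$ to $\widehat E$; otherwise set $S(j,k)=\{\ell: \text{test accepts}\}$. Output $\widehat T=([d],\widehat E)$ and $S$. $\textsc{Orient}(\widehat T,S)$: for every pair of nonadjacent $j,k$ with a common neighbour $\ell$ in $\widehat T$, if $\ell\notin S(j,k)$ orient $j\to\ell\leftarrow k$; then repeatedly apply the rules R1: orient $k-\ell$ as $k\to\ell$ if there is $j\to k$ with $j,\ell$ nonadjacent; R2: orient $j-k$ as $j\to k$ if there is a chain $j\to\ell\to k$; R3: orient $j-k$ as $j\to k$ if there are chains $j-\ell\to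 k$ and $j-i\to k$ with $\ell,i$ nonadjacent; R4: orient $j-k$ as $j\to k$ if there are chains $j-\ell\to i$ and $\ell-i\to k$ with $\ell,i$ nonadjacent; return the resulting partially directed graph. *)

theory Defs
  imports "HOL-Probability.Probability" "HOL-Combinatorics.Permutations"
begin

(* Vertices are {..<d} (standing for [d]). A directed graph on {..<d} is a relation
   E :: (nat * nat) set, (j,k) \<in> E meaning j \<rightarrow> k.
   Vectors in R^d are functions nat \<Rightarrow> real; R^d carries the measure
   PiM {..<d} (\<lambda>_. lborel) (Lebesgue measure on R^d). *)

section \<open>Graphs\<close>

definition dag :: "nat \<Rightarrow> (nat \<times> nat) set \<Rightarrow> bool" where
  "dag d E \<longleftrightarrow> E \<subseteq> {..<d} \<times> {..<d} \<and> acyclic E"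

definition skel :: "(nat \<times> nat) set \<Rightarrow> (nat \<times> nat) set" where
  "skel E = E \<union> E\<inverse>"

definition parents :: "(nat \<times> nat) set \<Rightarrow> nat \<Rightarrow> nat set" where
  "parents E k = {j. (j, k) \<in> E}"

(* an undirected cycle (length >= 3, distinct vertices) in a symmetric relation U *)
definition has_undirected_cycle :: "(nat \<times> nat) set \<Rightarrow> bool" where
  "has_undirected_cycle U \<longleftrightarrow> (\<exists>cyc. length cyc \<ge> 3 \<and> distinct cyc \<and>
      (\<forall>i < length cyc. (cyc ! i, cyc ! ((i + 1) mod length cyc)) \<in> U))"

(* the undirected graph U on {..<d} is a tree: nonempty, connected, no cycles *)
definition is_tree :: "nat \<Rightarrow> (nat \<times> nat) set \<Rightarrow> bool" where
  "is_tree d U \<longleftrightarrow> 0 < d \<and> (\<forall>a<d. \<forall>b<d. (a, b) \<in> U\<^sup>*) \<and> \<not> has_undirected_cycle U"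

definition polytree :: "nat \<Rightarrow> (nat \<times> nat) set \<Rightarrow> bool" where
  "polytree d E \<longleftrightarrow> dag d E \<and> is_tree d (skel E)"

section \<open>Densities, Markov property, Markov equivalence, CPDAG\<close>

abbreviation Rd :: "nat \<Rightarrow> (nat \<Rightarrow> real) measure" where
  "Rd d \<equiv> PiM {..<d} (\<lambda>_. lborel)"

(* the density f on R^d factorizes as prod_k p(x_k | x_pa(k)), where each factor g k is a
   conditional density (Markov kernel) of x_k given x_pa(k) *)
definition markov_density :: "nat \<Rightarrow> (nat \<times> nat) set \<Rightarrow> ((nat \<Rightarrow> real) \<Rightarrow> real) \<Rightarrow> bool" where
  "markov_density d E f \<longleftrightarrow> (\<exists>g :: nat \<Rightarrow> (nat \<Rightarrow> real) \<Rightarrow> real.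
     (\<forall>k<d. g k \<in> borel_measurable (Rd d)) \<and>
     (\<forall>k<d. \<forall>x. 0 \<le> g k x) \<and>
     (\<forall>k<d. \<forall>x y. (\<forall>i \<in> insert k (parents E k). x i = y i) \<longrightarrow> g k x = g k y) \<and>
     (\<forall>k<d. \<forall>x. (\<integral>\<^sup>+ t. ennreal (g k (x(k := t))) \<partial>lborel) = 1) \<and>
     (AE x in Rd d. f x = (\<Prod>k<d. g k x)))"

(* Markov equivalence of DAGs: same set of (density) distributions Markov to them *)
definition markov_equiv :: "nat \<Rightarrow> (nat \<times> nat) set \<Rightarrow> (nat \<times> nat) set \<Rightarrow> bool" where
  "markov_equiv d E E' \<longleftrightarrow> dag d E \<and> dag d E' \<and>
     (\<forall>f. markov_density d E f \<longleftrightarrow> markov_density d E' f)"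

(* Partially directed graphs are represented as relations G: an undirected edge a - b is
   {(a,b),(b,a)} \<subseteq> G, a directed edge a \<rightarrow> b is (a,b) \<in> G, (b,a) \<notin> G. *)

(* CPDAG: skeleton sk(T); a \<rightarrow> b directed iff oriented so in every DAG Markov
   equivalent to T *)
definition cpdag :: "nat \<Rightarrow> (nat \<times> nat) set \<Rightarrow> (nat \<times> nat) set" where
  "cpdag d T = {(a, b). (a, b) \<in> skel T \<and>
      \<not> (\<forall>E'. markov_equiv d T E' \<longrightarrow> (b, a) \<in> E')}"

section \<open>Gaussian distributions and partial correlations\<close>

definition pos_def :: "nat \<Rightarrow> (nat \<Rightarrow> nat \<Rightarrow> real) \<Rightarrow> bool" where
  "pos_def d \<Sigma> \<longleftrightarrow> (\<forall>i<d. \<forall>j<d. \<Sigma> i j = \<Sigma> j i) \<and>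
     (\<forall>x :: nat \<Rightarrow> real. (\<exists>i<d. x i \<noteq> 0) \<longrightarrow> (\<Sum>i<d. \<Sum>j<d. x i * \<Sigma> i j * x j) > 0)"

definition mdet :: "nat \<Rightarrow> (nat \<Rightarrow> nat \<Rightarrow> real) \<Rightarrow> real" where
  "mdet d A = (\<Sum>p \<in> {p. p permutes {..<d}}. of_int (sign p) * (\<Prod>i<d. A i (p i)))"

definition minv :: "nat \<Rightarrow> (nat \<Rightarrow> nat \<Rightarrow> real) \<Rightarrow> (nat \<Rightarrow> nat \<Rightarrow> real)" where
  "minv d A = (THE K. (\<forall>i<d. \<forall>j<d. (\<Sum>k<d. A i k * K k j) = (if i = j then 1 else 0)) \<and>
                       (\<forall>i j. (d \<le> i \<or> d \<le> j) \<longrightarrow> K i j = 0))"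

(* density of N(0, \<Sigma>) on R^d *)
definition gauss_dens :: "nat \<Rightarrow> (nat \<Rightarrow> nat \<Rightarrow> real) \<Rightarrow> (nat \<Rightarrow> real) \<Rightarrow> real" where
  "gauss_dens d \<Sigma> x = exp (- (1/2) * (\<Sum>i<d. \<Sum>j<d. x i * minv d \<Sigma> i j * x j))
                         / sqrt ((2 * pi) ^ d * mdet d \<Sigma>)"

definition gauss :: "nat \<Rightarrow> (nat \<Rightarrow> nat \<Rightarrow> real) \<Rightarrow> (nat \<Rightarrow> real) measure" where
  "gauss d \<Sigma> = density (Rd d) (\<lambda>x. ennreal (gauss_dens d \<Sigma> x))"

(* partial correlation of j,k given X_s computed from a covariance matrix A;
   s = None means the empty conditioning set, s = Some l means {l} *)
definition pcorr :: "(nat \<Rightarrow> nat \<Rightarrow> real) \<Rightarrow> nat \<Rightarrow> nat \<Rightarrow> nat option \<Rightarrow> real" where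
  "pcorr A j k s = (case s of
      None \<Rightarrow> A j k / sqrt (A j j * A k k)
    | Some l \<Rightarrow> (A j k - A j l * A l k / A l l) /
                 sqrt ((A j j - A j l * A l j / A l l) * (A k k - A k l * A l k / A l l)))"

(* ([d] \<union> {\<emptyset>}) \<setminus> {j,k} *)
definition cond_sets :: "nat \<Rightarrow> nat \<Rightarrow> nat \<Rightarrow> nat option set" where
  "cond_sets d j k = insert None (Some ` ({..<d} - {j, k}))"

definition strong_tree_faithful ::
  "nat \<Rightarrow> (nat \<times> nat) set \<Rightarrow> (nat \<Rightarrow> nat \<Rightarrow> real) \<Rightarrow> real \<Rightarrow> bool" where
  "strong_tree_faithful d T \<Sigma> c \<longleftrightarrow>
     (\<forall>(j, k) \<in> skel T. \<forall>s \<in> cond_sets d j k. \<bar>pcorr \<Sigma> j k s\<bar> \<ge> c) \<and>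
     (\<forall>k l j. (k, l) \<in> T \<and> (j, l) \<in> T \<and> k \<noteq> j \<and> (k, j) \<notin> skel T
          \<longrightarrow> \<bar>pcorr \<Sigma> k j (Some l)\<bar> \<ge> c)"

section \<open>PC-Tree and Orient\<close>

(* sample covariance from samples X 0, ..., X (n-1) *)
definition samp_cov :: "nat \<Rightarrow> (nat \<Rightarrow> nat \<Rightarrow> real) \<Rightarrow> nat \<Rightarrow> nat \<Rightarrow> real" where
  "samp_cov n X j k = (1 / real n) * (\<Sum>i<n. X i j * X i k)"

(* the test of H0: X_j indep X_k | X_s rejects iff |rho_hat| \<ge> c/2 *)
definition ci_reject :: "real \<Rightarrow> (nat \<Rightarrow> nat \<Rightarrow> real) \<Rightarrow> nat \<Rightarrow> nat \<Rightarrow> nat option \<Rightarrow> bool" where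
  "ci_reject c Sh j k s \<longleftrightarrow> \<bar>pcorr Sh j k s\<bar> \<ge> c / 2"

(* edge set of T-hat (as a symmetric relation) *)
definition pc_edges :: "nat \<Rightarrow> real \<Rightarrow> (nat \<Rightarrow> nat \<Rightarrow> real) \<Rightarrow> (nat \<times> nat) set" where
  "pc_edges d c Sh = {(j, k). j < d \<and> k < d \<and> j \<noteq> k \<and>
                        (\<forall>s \<in> cond_sets d j k. ci_reject c Sh j k s)}"

(* separating sets S(j,k) = accepted conditioning sets (used for non-adjacent pairs) *)
definition sepset :: "nat \<Rightarrow> real \<Rightarrow> (nat \<Rightarrow> nat \<Rightarrow> real) \<Rightarrow> nat \<Rightarrow> nat \<Rightarrow> nat option set" where
  "sepset d c Sh j k = {s \<in> cond_sets d j k. \<not> ci_reject c Sh j k s}"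

definition adj :: "(nat \<times> nat) set \<Rightarrow> nat \<Rightarrow> nat \<Rightarrow> bool" where
  "adj G a b \<longleftrightarrow> (a, b) \<in> G \<or> (b, a) \<in> G"

definition und :: "(nat \<times> nat) set \<Rightarrow> nat \<Rightarrow> nat \<Rightarrow> bool" where
  "und G a b \<longleftrightarrow> (a, b) \<in> G \<and> (b, a) \<in> G"

definition dir :: "(nat \<times> nat) set \<Rightarrow> nat \<Rightarrow> nat \<Rightarrow> bool" where
  "dir G a b \<longleftrightarrow> (a, b) \<in> G \<and> (b, a) \<notin> G"

(* v-structure step: for nonadjacent j,k with common neighbour l and l \<notin> S(j,k),
   orient j \<rightarrow> l \<leftarrow> k (i.e. remove the reverse pairs (l,j), (l,k)) *)
definition orient_v :: "(nat \<times> nat) set \<Rightarrow> (nat \<Rightarrow> nat \<Rightarrow> nat option set) \<Rightarrow> (nat \<times> nat) set" where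
  "orient_v Th S = Th - {(l, j). \<exists>k. j \<noteq> k \<and> \<not> adj Th j k \<and> adj Th j l \<and> adj Th k l \<and>
                                     Some l \<notin> S j k}"

(* Meek rules: may orient the undirected edge a - b as a \<rightarrow> b in G *)
definition meek_rule :: "(nat \<times> nat) set \<Rightarrow> nat \<Rightarrow> nat \<Rightarrow> bool" where
  "meek_rule G a b \<longleftrightarrow> und G a b \<and>
     ((\<exists>j. dir G j a \<and> \<not> adj G j b \<and> j \<noteq> b) \<or>                                      \<comment> \<open>R1\<close>
      (\<exists>l. dir G a l \<and> dir G l b) \<or>                                                 \<comment> \<open>R2\<close>
      (\<exists>l i. und G a l \<and> dir G l b \<and> und G a i \<and> dir G i b \<and> l \<noteq> i \<and> \<not> adj G l i) \<or> \<comment> \<open>R3\<close>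
      (\<exists>l i. und G a l \<and> dir G l i \<and> dir G i b \<and> adj G a i \<and> l \<noteq> b \<and> \<not> adj G l b))  \<comment> \<open>R4\<close>"

definition meek_step :: "(nat \<times> nat) set \<Rightarrow> (nat \<times> nat) set \<Rightarrow> bool" where
  "meek_step G G' \<longleftrightarrow> (\<exists>a b. meek_rule G a b \<and> G' = G - {(b, a)})"

(* all possible outputs of Orient (rules applied repeatedly, in any order, until none applies) *)
definition orient_results :: "(nat \<times> nat) set \<Rightarrow> (nat \<Rightarrow> nat \<Rightarrow> nat option set) \<Rightarrow> (nat \<times> nat) set set" where
  "orient_results Th S = {G. meek_step\<^sup>*\<^sup>* (orient_v Th S) G \<and> \<not> (\<exists>G'. meek_step G G')}"

(* the law of n i.i.d. samples X 0, ..., X (n-1) from P *)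
definition iid :: "nat \<Rightarrow> (nat \<Rightarrow> real) measure \<Rightarrow> (nat \<Rightarrow> nat \<Rightarrow> real) measure" where
  "iid n P = PiM {..<n} (\<lambda>_. P)"

end

theory Submission
  imports Defs
begin

text \<open>
  Completing squares one coordinate at a time integrates Gaussian densities without determinants. If a
  Gaussian density factorizes along a DAG, integrating out all proper descendants of a vertex \<open>k\<close> leaves a
  density in which \<open>k\<close> is a sink; its mixed second differences show that the precision matrix of this
  margin vanishes between \<open>k\<close> and its nonparents. Hence \<open>k\<close> is a linear regression on its parents, as far
  as covariances with nondescendants are concerned. In a polytree, vertices without common ancestor
  are thus uncorrelated, and every nonadjacent pair has vanishing correlation or vanishing partial
  correlation given a single vertex.

  The same regression property, applied to models with a single nontrivial structural equation, shows
  that Markov equivalent DAGs have the same skeleton and colliders. Conversely, reversing an edge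
  between a source and a vertex with no other parent preserves the Markov property, and this suffices
  to reverse every edge that the Meek rules leave undirected in a polytree.

  Finally, polarization reduces every sample covariance to quadratic forms whose moment generating
  function is explicit. Chernoff bounds for the regression residuals normalized to unit variance make
  all tests decide correctly at rate \<open>exp (- n c\<^sup>2 / 25600)\<close>, and there are \<open>O(d\<^sup>3)\<close> tests.
\<close>

section \<open>Quadratic forms and precision matrices\<close>

text \<open>The determinant in \<open>gauss_dens\<close> is never evaluated. The normalizing
  constant stays unknown, and what must be known about it comes from the Markov factorization: a
  product of conditional densities over a DAG has total mass 1. That factorization holds only almost
  everywhere, whereas a mixed second difference needs four points at which it holds at once; Fubini
  arguments on null sets supply them. Conditional independence never appears as a notion. The tests
  of PC-Tree depend on covariances alone, and a partial correlation given one variable vanishes as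
  soon as \<open>S a b * S l l = S a l * S l b\<close>. Markov equivalence, in contrast, quantifies
  over all densities: telling two DAGs apart takes an explicit distribution that is Markov to only
  one of them, and proving two of them equivalent takes explicit kernels for an arbitrary
  density.\<close>

definition bil :: "nat set \<Rightarrow> (nat \<Rightarrow> nat \<Rightarrow> real) \<Rightarrow> (nat \<Rightarrow> real) \<Rightarrow> (nat \<Rightarrow> real) \<Rightarrow> real" where
  "bil A K x y = (\<Sum>i\<in>A. \<Sum>j\<in>A. x i * K i j * y j)"

definition pd_on :: "nat set \<Rightarrow> (nat \<Rightarrow> nat \<Rightarrow> real) \<Rightarrow> bool" where
  "pd_on A S \<longleftrightarrow> (\<forall>i\<in>A. \<forall>j\<in>A. S i j = S j i) \<and> (\<forall>x. (\<exists>i\<in>A. x i \<noteq> 0) \<longrightarrow> 0 < bil A S x x)"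

text \<open>A relation instead of a function: entries outside \<open>A\<close> stay free, so that
  index sets can grow and shrink by one vertex without truncating matrices.
  \<open>precision_minv\<close> makes the link to \<open>minv\<close>.\<close>

definition precision :: "nat set \<Rightarrow> (nat \<Rightarrow> nat \<Rightarrow> real) \<Rightarrow> (nat \<Rightarrow> nat \<Rightarrow> real) \<Rightarrow> bool" where
  "precision A S K \<longleftrightarrow> (\<forall>i\<in>A. \<forall>j\<in>A. K i j = K j i) \<and>
     (\<forall>i\<in>A. \<forall>j\<in>A. (\<Sum>k\<in>A. S i k * K k j) = (if i = j then 1 else 0))"

lemma pos_def_iff_pd_on: "pos_def d S \<longleftrightarrow> pd_on {..<d} S"
  by (auto simp: pos_def_def pd_on_def bil_def)

lemma pd_on_sym: "pd_on A S \<Longrightarrow> i \<in> A \<Longrightarrow> j \<in> A \<Longrightarrow> S i j = S j i"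
  by (auto simp: pd_on_def)

lemma pd_on_pos: "pd_on A S \<Longrightarrow> i \<in> A \<Longrightarrow> x i \<noteq> 0 \<Longrightarrow> 0 < bil A S x x"
  by (auto simp: pd_on_def)

lemma bil_restrict:
  assumes "finite B" "A \<subseteq> B"
  shows "bil B S (\<lambda>i. if i \<in> A then x i else 0) (\<lambda>i. if i \<in> A then y i else 0) = bil A S x y"
proof -
  have "bil B S (\<lambda>i. if i \<in> A then x i else 0) (\<lambda>i. if i \<in> A then y i else 0)
      = (\<Sum>i\<in>B. if i \<in> A then (\<Sum>j\<in>B. if j \<in> A then x i * S i j * y j else 0) else 0)"
    unfolding bil_def by (intro sum.cong) (auto intro!: sum.cong)
  also have "\<dots> = bil A S x y"
    using assms by (simp add: bil_def sum.If_cases Int_absorb1)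
  finally show ?thesis .
qed

lemma pd_on_subset:
  assumes "pd_on B S" "finite B" "A \<subseteq> B"
  shows "pd_on A S"
  unfolding pd_on_def
proof (intro conjI ballI allI impI)
  fix i j assume "i \<in> A" "j \<in> A"
  then show "S i j = S j i" using assms pd_on_sym by blast
next
  fix x :: "nat \<Rightarrow> real" assume "\<exists>i\<in>A. x i \<noteq> 0"
  then obtain i where i: "i \<in> A" "x i \<noteq> 0" by blast
  have "0 < bil B S (\<lambda>i. if i \<in> A then x i else 0) (\<lambda>i. if i \<in> A then x i else 0)"
    using assms i by (intro pd_on_pos[of _ _ i]) auto
  then show "0 < bil A S x x" using bil_restrict[OF assms(2,3)] by simp
qed

lemma bil_nonneg: "pd_on A S \<Longrightarrow> 0 \<le> bil A S x x"
  by (cases "\<exists>i\<in>A. x i \<noteq> 0") (auto simp: bil_def dest: pd_on_pos less_imp_le)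

lemma bil_add_left: "bil A S (\<lambda>i. x i + y i) z = bil A S x z + bil A S y z"
  by (simp add: bil_def algebra_simps sum.distrib)

lemma bil_add_right: "bil A S z (\<lambda>i. x i + y i) = bil A S z x + bil A S z y"
  by (simp add: bil_def algebra_simps sum.distrib)

lemma bil_scale_left: "bil A S (\<lambda>i. c * x i) z = c * bil A S x z"
  by (simp add: bil_def sum_distrib_left mult.assoc)

lemma bil_scale_right: "bil A S z (\<lambda>i. c * x i) = c * bil A S z x"
  by (simp add: bil_def sum_distrib_left mult.assoc mult.left_commute)

lemma bil_diff_left: "bil A S (\<lambda>i. x i - y i) z = bil A S x z - bil A S y z"
  using bil_add_left[of A S x "\<lambda>i. - 1 * y i" z] unfolding bil_scale_left by simp

lemma bil_diff_right: "bil A S z (\<lambda>i. x i - y i) = bil A S z x - bil A S z y"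
  using bil_add_right[of A S z x "\<lambda>i. - 1 * y i"] unfolding bil_scale_right by simp

lemma bil_commute:
  assumes "\<And>i j. i \<in> A \<Longrightarrow> j \<in> A \<Longrightarrow> S i j = S j i"
  shows "bil A S x y = bil A S y x"
  unfolding bil_def by (subst sum.swap) (auto intro!: sum.cong simp: assms)

lemma bil_unit:
  assumes "finite A" "i \<in> A" "j \<in> A"
  shows "bil A S (\<lambda>k. of_bool (k = i)) (\<lambda>k. of_bool (k = j)) = S i j"
proof -
  have "bil A S (\<lambda>k. of_bool (k = i)) (\<lambda>k. of_bool (k = j))
      = (\<Sum>k\<in>A. if k = i then (\<Sum>l\<in>A. if l = j then S k l else 0) else 0)"
    unfolding bil_def by (intro sum.cong) (auto intro!: sum.cong)
  then show ?thesis using assms by simp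
qed

lemma bil_insert:
  assumes "finite A" "v \<notin> A"
  shows "bil (insert v A) S x y = bil A S x y + x v * (\<Sum>j\<in>A. S v j * y j)
     + y v * (\<Sum>i\<in>A. x i * S i v) + x v * S v v * y v"
  using assms by (simp add: bil_def sum.distrib sum_distrib_left mult.assoc mult.commute mult.left_commute)

text \<open>The difference of two candidate columns is annihilated by \<open>S\<close> on
  \<open>A\<close>, so the positive definite form vanishes at it.\<close>

lemma precision_unique:
  assumes "finite A" "pd_on A S"
    and K: "\<And>i j. i \<in> A \<Longrightarrow> j \<in> A \<Longrightarrow> (\<Sum>k\<in>A. S i k * K k j) = (if i = j then 1 else 0)"
    and K': "\<And>i j. i \<in> A \<Longrightarrow> j \<in> A \<Longrightarrow> (\<Sum>k\<in>A. S i k * K' k j) = (if i = j then 1 else 0)"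
    and "i \<in> A" "j \<in> A"
  shows "K i j = K' i j"
proof (rule ccontr)
  assume ne: "K i j \<noteq> K' i j"
  define x where "x k = K k j - K' k j" for k
  have "0 < bil A S x x" using ne assms by (intro pd_on_pos[of _ _ i]) (auto simp: x_def)
  moreover have "bil A S x x = (\<Sum>k\<in>A. x k * (\<Sum>l\<in>A. S k l * x l))"
    by (simp add: bil_def sum_distrib_left mult.assoc)
  moreover have "(\<Sum>l\<in>A. S k l * x l) = 0" if "k \<in> A" for k
    using K[OF that \<open>j \<in> A\<close>] K'[OF that \<open>j \<in> A\<close>] by (simp add: x_def algebra_simps sum_subtractf)
  ultimately show False by simp
qed

lemma bil_cong:
  assumes "\<And>i j. i \<in> A \<Longrightarrow> j \<in> A \<Longrightarrow> K i j = K' i j"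
    "\<And>i. i \<in> A \<Longrightarrow> x i = x' i" "\<And>i. i \<in> A \<Longrightarrow> y i = y' i"
  shows "bil A K x y = bil A K' x' y'"
  using assms by (simp add: bil_def)

text \<open>Here \<open>\<beta>\<close> are the coefficients of the regression of variable \<open>v\<close> on the variables in \<open>A\<close>
  and \<open>D\<close> is the residual variance.\<close>

lemma precision_insert:
  assumes fin: "finite A" and v: "v \<notin> A" and pd: "pd_on (insert v A) S" and K: "precision A S K"
  obtains K' \<beta> D where "precision (insert v A) S K'" "0 < D"
    "\<And>x. bil (insert v A) K' x x = bil A K x x + (x v - (\<Sum>i\<in>A. \<beta> i * x i))\<^sup>2 / D"
    "\<And>a. bil (insert v A) S a a = bil A S (\<lambda>i. a i + a v * \<beta> i) (\<lambda>i. a i + a v * \<beta> i) + (a v)\<^sup>2 * D"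
    "\<And>i. \<beta> i = (\<Sum>j\<in>A. K i j * S j v)" "D = S v v - (\<Sum>i\<in>A. \<beta> i * S i v)"
proof -
  define \<beta> where "\<beta> i = (\<Sum>j\<in>A. K i j * S j v)" for i
  define D where "D = S v v - (\<Sum>i\<in>A. \<beta> i * S i v)"
  \<comment> \<open>The bordered inverse, with \<open>D\<close> as Schur complement: as a quadratic
    form it is \<open>K\<close> plus the squared residual of \<open>v\<close> divided by
    \<open>D\<close>.\<close>
  define K' where "K' i j = (if i = v \<and> j = v then 1 / D else if i = v then - \<beta> j / D
     else if j = v then - \<beta> i / D else K i j + \<beta> i * \<beta> j / D)" for i j
  have symS: "S i j = S j i" if "i \<in> insert v A" "j \<in> insert v A" for i j
    using pd that by (rule pd_on_sym)
  have symK: "K i j = K j i" if "i \<in> A" "j \<in> A" for i j using K that by (auto simp: precision_def)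
  have Sb: "(\<Sum>i\<in>A. S j i * \<beta> i) = S j v" if "j \<in> A" for j
  proof -
    have "(\<Sum>i\<in>A. S j i * \<beta> i) = (\<Sum>i\<in>A. \<Sum>k\<in>A. S j i * K i k * S k v)"
      by (simp add: \<beta>_def sum_distrib_left mult.assoc)
    also have "\<dots> = (\<Sum>k\<in>A. (\<Sum>i\<in>A. S j i * K i k) * S k v)"
      by (subst sum.swap) (simp add: sum_distrib_right)
    also have "\<dots> = (\<Sum>k\<in>A. if k = j then S k v else 0)"
      using K that by (intro sum.cong) (auto simp: precision_def)
    finally show ?thesis using fin that by simp
  qed
  have Sb': "(\<Sum>i\<in>A. \<beta> i * S i j) = S v j" if "j \<in> A" for j
  proof -
    have "(\<Sum>i\<in>A. \<beta> i * S i j) = (\<Sum>i\<in>A. S j i * \<beta> i)"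
      using that by (intro sum.cong) (auto simp: symS mult.commute)
    then show ?thesis using Sb[OF that] symS[of j v] that by simp
  qed
  have var: "bil (insert v A) S a a
    = bil A S (\<lambda>i. a i + a v * \<beta> i) (\<lambda>i. a i + a v * \<beta> i) + (a v)\<^sup>2 * D" for a
  proof -
    have e1: "bil A S a \<beta> = (\<Sum>i\<in>A. a i * S i v)"
    proof -
      have "bil A S a \<beta> = (\<Sum>i\<in>A. a i * (\<Sum>j\<in>A. S i j * \<beta> j))"
        by (simp add: bil_def sum_distrib_left mult.assoc)
      then show ?thesis by (simp add: Sb)
    qed
    have e2: "bil A S \<beta> a = (\<Sum>i\<in>A. a i * S i v)"
      using e1 bil_commute[of A S \<beta> a] symS by auto
    have e3: "bil A S \<beta> \<beta> = (\<Sum>i\<in>A. \<beta> i * S i v)"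
    proof -
      have "bil A S \<beta> \<beta> = (\<Sum>i\<in>A. \<beta> i * (\<Sum>j\<in>A. S i j * \<beta> j))"
        by (simp add: bil_def sum_distrib_left mult.assoc)
      then show ?thesis by (simp add: Sb)
    qed
    have e4: "(\<Sum>j\<in>A. S v j * a j) = (\<Sum>i\<in>A. a i * S i v)"
      by (intro sum.cong) (auto simp: symS mult.commute)
    show ?thesis
      unfolding bil_insert[OF fin v] bil_add_left bil_add_right bil_scale_left bil_scale_right
        e1 e2 e3 e4 D_def
      by (simp add: algebra_simps power2_eq_square)
  qed
  have D: "0 < D"
  proof -
    \<comment> \<open>These are the coefficients of the residual of \<open>v\<close>;
      \<open>var\<close> identifies its variance as \<open>D\<close>.\<close>
    have "0 < bil (insert v A) S (\<lambda>i. if i = v then 1 else - \<beta> i) (\<lambda>i. if i = v then 1 else - \<beta> i)"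
      using pd by (intro pd_on_pos[of _ _ v]) auto
    moreover have "bil A S (\<lambda>i. (if i = v then 1 else - \<beta> i) + \<beta> i)
       (\<lambda>i. (if i = v then 1 else - \<beta> i) + \<beta> i) = bil A S (\<lambda>i. 0) (\<lambda>i. 0)"
      using v by (intro bil_cong) auto
    ultimately show ?thesis unfolding var by (simp add: bil_def)
  qed
  have quad: "bil (insert v A) K' x x = bil A K x x + (x v - (\<Sum>i\<in>A. \<beta> i * x i))\<^sup>2 / D" for x
  proof -
    let ?m = "\<Sum>i\<in>A. \<beta> i * x i"
    have e1: "bil A K' x x = bil A K x x + ?m * ?m / D"
    proof -
      have "bil A K' x x = (\<Sum>i\<in>A. \<Sum>j\<in>A. x i * K i j * x j + (\<beta> i * x i) * (\<beta> j * x j) / D)"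
        unfolding bil_def using v
        by (intro sum.cong refl) (auto simp: K'_def algebra_simps)
      then show ?thesis
        by (simp add: bil_def sum.distrib sum_product sum_divide_distrib)
    qed
    have e2: "(\<Sum>j\<in>A. K' v j * x j) = - ?m / D"
    proof -
      have "(\<Sum>j\<in>A. K' v j * x j) = (\<Sum>j\<in>A. - (\<beta> j * x j) / D)"
        using v by (intro sum.cong) (auto simp: K'_def)
      then show ?thesis by (simp add: sum_divide_distrib sum_negf)
    qed
    have e3: "(\<Sum>j\<in>A. x j * K' j v) = - ?m / D"
    proof -
      have "(\<Sum>j\<in>A. x j * K' j v) = (\<Sum>j\<in>A. - (\<beta> j * x j) / D)"
        using v by (intro sum.cong) (auto simp: K'_def)
      then show ?thesis by (simp add: sum_divide_distrib sum_negf)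
    qed
    have e4: "K' v v = 1 / D" by (simp add: K'_def)
    show ?thesis
      unfolding bil_insert[OF fin v] e1 e2 e3 e4 using D
      by (simp add: field_simps power2_eq_square)
  qed
  have inv: "(\<Sum>k\<in>insert v A. S i k * K' k j) = (if i = j then 1 else 0)"
    if i: "i \<in> insert v A" and j: "j \<in> insert v A" for i j
  proof -
    have split: "(\<Sum>k\<in>insert v A. S i k * K' k j) = S i v * K' v j + (\<Sum>k\<in>A. S i k * K' k j)"
      using fin v by simp
    have bS: "(\<Sum>k\<in>A. S i k * \<beta> k) = (if i = v then S v v - D else S i v)"
    proof (cases "i = v")
      case True
      have "(\<Sum>k\<in>A. S v k * \<beta> k) = (\<Sum>k\<in>A. \<beta> k * S k v)"
        by (intro sum.cong) (auto simp: symS mult.commute)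
      then show ?thesis using True by (simp add: D_def)
    qed (use i Sb in auto)
    show ?thesis
    proof (cases "j = v")
      case True
      have "(\<Sum>k\<in>A. S i k * K' k j) = (\<Sum>k\<in>A. - (S i k * \<beta> k) / D)"
        using v True by (intro sum.cong) (auto simp: K'_def)
      also have "\<dots> = - (\<Sum>k\<in>A. S i k * \<beta> k) / D" by (simp add: sum_divide_distrib sum_negf)
      finally show ?thesis unfolding split bS using True D by (simp add: K'_def field_simps)
    next
      case False
      then have jA: "j \<in> A" using j by simp
      have SK: "(\<Sum>k\<in>A. S i k * K k j) = (if i = v then \<beta> j else if i = j then 1 else 0)"
      proof (cases "i = v")
        case True
        have "(\<Sum>k\<in>A. S v k * K k j) = (\<Sum>k\<in>A. K j k * S k v)"
          using jA by (intro sum.cong) (auto simp: symS symK mult.commute)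
        then show ?thesis using True by (simp add: \<beta>_def)
      qed (use i jA K in \<open>auto simp: precision_def\<close>)
      have "(\<Sum>k\<in>A. S i k * K' k j) = (\<Sum>k\<in>A. S i k * K k j + (S i k * \<beta> k) * \<beta> j / D)"
        using v False by (intro sum.cong) (auto simp: K'_def algebra_simps)
      also have "\<dots> = (\<Sum>k\<in>A. S i k * K k j) + (\<Sum>k\<in>A. S i k * \<beta> k) * \<beta> j / D"
        by (simp add: sum.distrib sum_divide_distrib sum_distrib_right)
      finally show ?thesis unfolding split bS SK using False jA v D
        by (auto simp: K'_def field_simps)
    qed
  qed
  have "precision (insert v A) S K'"
    unfolding precision_def using inv symK by (auto simp: K'_def)
  then show thesis using D quad var \<beta>_def D_def by (rule that)
qed

lemma precision_exists: "finite A \<Longrightarrow> pd_on A S \<Longrightarrow> \<exists>K. precision A S K"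
proof (induction A rule: finite_induct)
  case empty
  then show ?case by (auto simp: precision_def)
next
  case (insert v A)
  then obtain K where "precision A S K" using pd_on_subset[of "insert v A" S A] by auto
  then show ?case using insert precision_insert by metis
qed

text \<open>Precision matrices being unique on their index set, the one built in
  \<open>precision_insert\<close> must be \<open>K'\<close>. The decomposition can then be used to
  remove a variable from a given precision matrix.\<close>

lemma precision_elim:
  assumes fin: "finite A" and v: "v \<notin> A" and pd: "pd_on (insert v A) S"
    and K': "precision (insert v A) S K'"
  obtains K \<beta> D where "precision A S K" "0 < D"
    "\<And>x. bil (insert v A) K' x x = bil A K x x + (x v - (\<Sum>i\<in>A. \<beta> i * x i))\<^sup>2 / D"
    "\<And>a. bil (insert v A) S a a = bil A S (\<lambda>i. a i + a v * \<beta> i) (\<lambda>i. a i + a v * \<beta> i) + (a v)\<^sup>2 * D"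
proof -
  obtain K where K: "precision A S K" using precision_exists pd_on_subset[OF pd, of A] fin by blast
  obtain K'' \<beta> D where *: "precision (insert v A) S K''" "0 < D"
    "\<And>x. bil (insert v A) K'' x x = bil A K x x + (x v - (\<Sum>i\<in>A. \<beta> i * x i))\<^sup>2 / D"
    "\<And>a. bil (insert v A) S a a = bil A S (\<lambda>i. a i + a v * \<beta> i) (\<lambda>i. a i + a v * \<beta> i) + (a v)\<^sup>2 * D"
    by (rule precision_insert[OF fin v pd K], rule that)
  have "K'' i j = K' i j" if "i \<in> insert v A" "j \<in> insert v A" for i j
    by (rule precision_unique[OF _ pd _ _ that]) (use fin *(1) K' in \<open>unfold precision_def, blast+\<close>)
  then have eq: "bil (insert v A) K' x x = bil (insert v A) K'' x x" for x by (intro bil_cong) auto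
  show thesis by (rule that[OF K *(2) _ *(4)]) (simp only: eq *(3))
qed

lemma precision_minv:
  assumes "pos_def d S"
  shows "precision {..<d} S (minv d S)"
proof -
  have pd: "pd_on {..<d} S" using assms by (simp add: pos_def_iff_pd_on)
  obtain K where K: "precision {..<d} S K" using precision_exists[OF _ pd] by auto
  \<comment> \<open>\<open>minv\<close> is a definite description that also demands zeros outside
    the range, hence the truncation.\<close>
  define K0 where "K0 i j = (if d \<le> i \<or> d \<le> j then 0 else K i j)" for i j
  have K0: "(\<forall>i<d. \<forall>j<d. (\<Sum>k<d. S i k * K0 k j) = (if i = j then 1 else 0)) \<and>
     (\<forall>i j. (d \<le> i \<or> d \<le> j) \<longrightarrow> K0 i j = 0)"
    using K by (auto simp: K0_def precision_def)
  have "minv d S = K0" unfolding minv_def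
  proof (rule the_equality)
    fix L assume L: "(\<forall>i<d. \<forall>j<d. (\<Sum>k<d. S i k * L k j) = (if i = j then 1 else 0)) \<and>
       (\<forall>i j. (d \<le> i \<or> d \<le> j) \<longrightarrow> L i j = 0)"
    show "L = K0"
    proof (intro ext)
      fix i j
      show "L i j = K0 i j"
      proof (cases "d \<le> i \<or> d \<le> j")
        case True
        then show ?thesis using L K0 by metis
      next
        case False
        then have ij: "i \<in> {..<d}" "j \<in> {..<d}" by auto
        show ?thesis
          by (rule precision_unique[OF _ pd _ _ ij]) (use L K0 in \<open>simp_all\<close>)
      qed
    qed
  qed (rule K0)
  then show ?thesis using K by (auto simp: precision_def K0_def)
qed

section \<open>Gaussian integrals on finite products\<close>

abbreviation lb :: "nat set \<Rightarrow> (nat \<Rightarrow> real) measure" where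
  "lb A \<equiv> PiM A (\<lambda>_. lborel)"

interpretation lb: product_sigma_finite "\<lambda>_::nat. lborel :: real measure" ..

lemma nn_integral_exp_square:
  assumes "0 < (p::real)"
  shows "(\<integral>\<^sup>+ t. ennreal (exp (- p * (t - m)\<^sup>2)) \<partial>lborel) = ennreal (sqrt (pi / p))"
proof -
  define \<sigma> where "\<sigma> = 1 / sqrt (2 * p)"
  have \<sigma>: "0 < \<sigma>" "\<sigma>\<^sup>2 = 1 / (2 * p)" using assms by (auto simp: \<sigma>_def power_divide)
  interpret prob_space "density lborel (normal_density m \<sigma>)"
    using \<sigma>(1) by (rule prob_space_normal_density)
  have "(\<integral>\<^sup>+ t. ennreal (normal_density m \<sigma> t) \<partial>lborel) = 1"
    using emeasure_space_1 by (simp add: emeasure_density)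
  moreover have "exp (- p * (t - m)\<^sup>2) = sqrt (pi / p) * normal_density m \<sigma> t" for t
    unfolding normal_density_def \<sigma>(2) using assms by (simp add: field_simps)
  ultimately show ?thesis
    using assms by (simp add: ennreal_mult nn_integral_cmult)
qed

lemma nn_integral_gauss_coord:
  assumes D: "0 < (D::real)" and q: "q = 1 + 2 * s * e\<^sup>2 * D" "0 < q"
  shows "(\<integral>\<^sup>+ t. ennreal (exp (- ((t - m)\<^sup>2 / D) / 2 - s * (e * t + w)\<^sup>2)) \<partial>lborel)
     = ennreal (sqrt (2 * pi * D / q) * exp (- (s / q) * (e * m + w)\<^sup>2))"
proof -
  have "- ((t - m)\<^sup>2 / D) / 2 - s * (e * t + w)\<^sup>2
    = - (s / q) * (e * m + w)\<^sup>2 + - (q / (2 * D)) * (t - (m - 2 * D * s * e * w) / q)\<^sup>2" for t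
  proof -
    have poly: "q * (t - m)\<^sup>2 + 2 * D * q * s * (e * t + w)\<^sup>2
        = (q * t - (m - 2 * D * s * e * w))\<^sup>2 + 2 * D * s * (e * m + w)\<^sup>2"
      by (simp add: q(1) algebra_simps power2_eq_square)
    have sq: "(t - (m - 2 * D * s * e * w) / q)\<^sup>2 = (q * t - (m - 2 * D * s * e * w))\<^sup>2 / q\<^sup>2"
    proof -
      have "t - (m - 2 * D * s * e * w) / q = (q * t - (m - 2 * D * s * e * w)) / q"
        using q(2) by (simp add: diff_divide_distrib)
      then show ?thesis by (simp only: power_divide)
    qed
    have alg: "- (P / D) / 2 - s * W = - (s / q) * U + - (q / (2 * D)) * (R / q\<^sup>2)"
      if "q * P + 2 * D * q * s * W = R + 2 * D * s * U" for P W R U :: real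
    proof -
      have "(P / D) / 2 + s * W = (q * P + 2 * D * q * s * W) / (2 * D * q)"
        using D q(2) by (simp add: field_simps)
      also have "\<dots> = (s / q) * U + (q / (2 * D)) * (R / q\<^sup>2)"
        unfolding that using D q(2) by (simp add: field_simps power2_eq_square)
      finally show ?thesis by simp
    qed
    show ?thesis unfolding sq by (rule alg[OF poly])
  qed
  then have "(\<integral>\<^sup>+ t. ennreal (exp (- ((t - m)\<^sup>2 / D) / 2 - s * (e * t + w)\<^sup>2)) \<partial>lborel)
     = (\<integral>\<^sup>+ t. ennreal (exp (- (s / q) * (e * m + w)\<^sup>2)) *
          ennreal (exp (- (q / (2 * D)) * (t - (m - 2 * D * s * e * w) / q)\<^sup>2)) \<partial>lborel)"
    by (simp only: exp_add ennreal_mult exp_ge_zero)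
  also have "\<dots> = ennreal (exp (- (s / q) * (e * m + w)\<^sup>2)) * ennreal (sqrt (pi / (q / (2 * D))))"
    using D q(2) nn_integral_exp_square[of "q / (2 * D)"] by (subst nn_integral_cmult) simp_all
  finally show ?thesis
    using D q(2) by (subst ennreal_mult) (auto simp: mult.commute mult.left_commute)
qed

lemma measurable_bil [measurable]:
  assumes "A \<subseteq> V"
  shows "(\<lambda>x. bil A K x x) \<in> borel_measurable (lb V)"
  using assms unfolding bil_def by (intro borel_measurable_sum borel_measurable_times) auto

lemma measurable_linear [measurable]:
  assumes "A \<subseteq> V"
  shows "(\<lambda>x. \<Sum>i\<in>A. a i * x i) \<in> borel_measurable (lb V)"
  using assms by (intro borel_measurable_sum borel_measurable_times) auto

lemmas [measurable] = measurable_bil[OF order_refl] measurable_linear[OF order_refl]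

text \<open>\<open>Z\<close> depends neither on \<open>s\<close> nor on \<open>a\<close>. Dividing
  by the case \<open>s = 0\<close> thus yields the Laplace transform of the square of a linear form,
  a scaled chi-square law, without knowing \<open>Z\<close>.\<close>

lemma gaussian_nn_integral:
  assumes "finite A" "pd_on A S" "precision A S K"
  shows "\<exists>Z>0. \<forall>s a. 0 < 1 + 2 * s * bil A S a a \<longrightarrow>
     (\<integral>\<^sup>+ x. ennreal (exp (- bil A K x x / 2 - s * (\<Sum>i\<in>A. a i * x i)\<^sup>2)) \<partial>lb A)
       = ennreal (Z / sqrt (1 + 2 * s * bil A S a a))"
  using assms
proof (induction A arbitrary: K rule: finite_induct)
  case empty
  have "(\<integral>\<^sup>+ x. ennreal (exp (- bil {} K x x / 2 - s * (\<Sum>i\<in>{}. a i * x i)\<^sup>2)) \<partial>lb {}) = 1" for s a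
    by (simp add: bil_def space_PiM_empty)
  then show ?case by (intro exI[of _ 1]) (simp add: bil_def)
next
  case (insert v A)
  obtain K0 \<beta> D where K0: "precision A S K0" and D: "0 < D" and
    quad: "\<And>x. bil (insert v A) K x x = bil A K0 x x + (x v - (\<Sum>i\<in>A. \<beta> i * x i))\<^sup>2 / D" and
    var: "\<And>a. bil (insert v A) S a a
       = bil A S (\<lambda>i. a i + a v * \<beta> i) (\<lambda>i. a i + a v * \<beta> i) + (a v)\<^sup>2 * D"
    by (rule precision_elim[OF insert(1,2,4,5)], rule that)
  have pdA: "pd_on A S" using pd_on_subset[OF insert(4)] insert(1) by blast
  obtain Z where Z: "0 < Z" and ZI: "\<And>s a. 0 < 1 + 2 * s * bil A S a a \<Longrightarrow>
     (\<integral>\<^sup>+ x. ennreal (exp (- bil A K0 x x / 2 - s * (\<Sum>i\<in>A. a i * x i)\<^sup>2)) \<partial>lb A)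
       = ennreal (Z / sqrt (1 + 2 * s * bil A S a a))"
    using insert.IH[OF pdA K0] by blast
  have "(\<integral>\<^sup>+ x. ennreal (exp (- bil (insert v A) K x x / 2 - s * (\<Sum>i\<in>insert v A. a i * x i)\<^sup>2)) \<partial>lb (insert v A))
       = ennreal (Z * sqrt (2 * pi * D) / sqrt (1 + 2 * s * bil (insert v A) S a a))"
    if pos: "0 < 1 + 2 * s * bil (insert v A) S a a" for s a
  proof -
    \<comment> \<open>Once \<open>x v\<close> is replaced by its regression on \<open>A\<close>, the
      linear form \<open>a\<close> becomes \<open>a'\<close>. The identity \<open>tot\<close> then
      splits the variance into an explained and a residual part.\<close>
    define a' where "a' i = a i + a v * \<beta> i" for i
    define q where "q = 1 + 2 * s * (a v)\<^sup>2 * D"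
    have tot: "1 + 2 * s * bil (insert v A) S a a = q + 2 * s * bil A S a' a'"
      unfolding var a'_def q_def by (simp add: algebra_simps)
    have B: "0 \<le> bil A S a' a'" by (rule bil_nonneg[OF pdA])
    \<comment> \<open>For negative \<open>s\<close> the explained part can only lower the total, so
      positivity of the total passes to \<open>q\<close>.\<close>
    have q: "0 < q"
    proof (cases "0 \<le> s")
      case True
      then show ?thesis using D by (simp add: q_def add_pos_nonneg)
    next
      case False
      then have "s * bil A S a' a' \<le> 0" using B by (simp add: mult_nonpos_nonneg)
      then show ?thesis using pos unfolding tot by linarith
    qed
    have step: "(\<integral>\<^sup>+ t. ennreal (exp (- bil (insert v A) K (x(v := t)) (x(v := t)) / 2
          - s * (\<Sum>i\<in>insert v A. a i * (x(v := t)) i)\<^sup>2)) \<partial>lborel)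
        = ennreal (sqrt (2 * pi * D / q)) *
          ennreal (exp (- bil A K0 x x / 2 - (s / q) * (\<Sum>i\<in>A. a' i * x i)\<^sup>2))" for x
    proof -
      let ?m = "\<Sum>i\<in>A. \<beta> i * x i" and ?w = "\<Sum>i\<in>A. a i * x i"
      have e1: "bil A K0 (x(v := t)) (x(v := t)) = bil A K0 x x" for t
        using insert(2) by (intro bil_cong) auto
      have e2: "(\<Sum>i\<in>A. \<beta> i * (x(v := t)) i) = ?m" for t using insert(2) by (intro sum.cong) auto
      have e3: "(\<Sum>i\<in>A. a i * (x(v := t)) i) = ?w" for t using insert(2) by (intro sum.cong) auto
      have e4: "(\<Sum>i\<in>insert v A. a i * (x(v := t)) i) = a v * t + ?w" for t
        using e3 insert(1,2) by simp
      have e5: "a v * ?m + ?w = (\<Sum>i\<in>A. a' i * x i)"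
        by (simp add: a'_def algebra_simps sum.distrib sum_distrib_left)
      have "(\<integral>\<^sup>+ t. ennreal (exp (- bil (insert v A) K (x(v := t)) (x(v := t)) / 2
          - s * (\<Sum>i\<in>insert v A. a i * (x(v := t)) i)\<^sup>2)) \<partial>lborel)
        = (\<integral>\<^sup>+ t. ennreal (exp (- bil A K0 x x / 2)) *
             ennreal (exp (- ((t - ?m)\<^sup>2 / D) / 2 - s * (a v * t + ?w)\<^sup>2)) \<partial>lborel)"
        unfolding quad e1 e2 e4
        by (intro nn_integral_cong) (simp add: ennreal_mult[symmetric] exp_add[symmetric] add_divide_distrib)
      also have "\<dots> = ennreal (exp (- bil A K0 x x / 2)) *
          ennreal (sqrt (2 * pi * D / q) * exp (- (s / q) * (a v * ?m + ?w)\<^sup>2))"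
        unfolding nn_integral_gauss_coord[OF D q_def q, symmetric] by (rule nn_integral_cmult) measurable
      also have "\<dots> = ennreal (sqrt (2 * pi * D / q)) *
          ennreal (exp (- bil A K0 x x / 2 - (s / q) * (\<Sum>i\<in>A. a' i * x i)\<^sup>2))"
        unfolding e5 ennreal_mult''[OF exp_ge_zero, symmetric] ennreal_mult'[OF exp_ge_zero, symmetric]
        by (simp only: minus_mult_left diff_conv_add_uminus exp_add mult_ac)
      finally show ?thesis .
    qed
    have pos': "0 < 1 + 2 * (s / q) * bil A S a' a'"
    proof -
      have "1 + 2 * (s / q) * bil A S a' a' = (q + 2 * s * bil A S a' a') / q"
        using q by (simp add: field_simps)
      then show ?thesis using pos q unfolding tot by simp
    qed
    have "(\<integral>\<^sup>+ x. ennreal (exp (- bil (insert v A) K x x / 2 - s * (\<Sum>i\<in>insert v A. a i * x i)\<^sup>2)) \<partial>lb (insert v A))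
       = (\<integral>\<^sup>+ x. ennreal (sqrt (2 * pi * D / q)) *
          ennreal (exp (- bil A K0 x x / 2 - (s / q) * (\<Sum>i\<in>A. a' i * x i)\<^sup>2)) \<partial>lb A)"
      by (subst lb.product_nn_integral_insert[OF insert(1,2)])
        (measurable, simp only: step)
    also have "\<dots> = ennreal (sqrt (2 * pi * D / q)) * ennreal (Z / sqrt (1 + 2 * (s / q) * bil A S a' a'))"
      unfolding ZI[OF pos', symmetric] by (rule nn_integral_cmult) measurable
    also have "\<dots> = ennreal (Z * sqrt (2 * pi * D) / sqrt (q * (1 + 2 * (s / q) * bil A S a' a')))"
      using D q Z pos' by (simp add: ennreal_mult[symmetric] real_sqrt_divide real_sqrt_mult mult.commute)
    also have "q * (1 + 2 * (s / q) * bil A S a' a') = 1 + 2 * s * bil (insert v A) S a a"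
      unfolding tot using q by (simp add: field_simps)
    finally show ?thesis .
  qed
  then show ?case using Z D by (intro exI[of _ "Z * sqrt (2 * pi * D)"]) auto
qed

section \<open>Null sets of product measures along single coordinates\<close>

lemma measurable_upd [measurable (raw)]:
  assumes "v \<in> V" "f \<in> M \<rightarrow>\<^sub>M lb V" "g \<in> borel_measurable M"
  shows "(\<lambda>z. (f z)(v := g z)) \<in> M \<rightarrow>\<^sub>M lb V"
  using assms by (intro measurable_fun_upd[where J=V]) auto

lemma nn_integral_lb_remove:
  assumes "finite V" "v \<in> V" "f \<in> borel_measurable (lb V)"
  shows "(\<integral>\<^sup>+ x. f x \<partial>lb V) = (\<integral>\<^sup>+ x. (\<integral>\<^sup>+ t. f (x(v := t)) \<partial>lborel) \<partial>lb (V - {v}))"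
  using lb.product_nn_integral_insert[of "V - {v}" v f] assms by (simp add: insert_absorb)

lemma upd_space_lb: "v \<in> V \<Longrightarrow> x \<in> space (lb (V - {v})) \<Longrightarrow> x(v := t) \<in> space (lb V)"
  by (auto simp: space_PiM PiE_def extensional_def)

lemma upd_space_lb': "v \<in> V \<Longrightarrow> x \<in> space (lb V) \<Longrightarrow> x(v := t) \<in> space (lb V)"
  by (auto simp: space_PiM PiE_def extensional_def)

text \<open>By Fubini a null set meets almost every line parallel to axis \<open>v\<close> in a null
  set. The line is indexed by a point \<open>x\<close> of the full space, redundant coordinate
  included, so that the lemma can be iterated over several coordinates.\<close>

lemma AE_lb_upd:
  assumes fin: "finite V" and v: "v \<in> V" and "AE x in lb V. P x"
  shows "AE x in lb V. AE t in lborel. P (x(v := t))"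
proof -
  obtain N where N: "{x \<in> space (lb V). \<not> P x} \<subseteq> N" "N \<in> sets (lb V)" "emeasure (lb V) N = 0"
    using assms(3) by (rule AE_E)
  note N(2)[measurable] and v[measurable]
  have "0 = (\<integral>\<^sup>+ x. indicator N x \<partial>lb V)" using N by simp
  also have "\<dots> = (\<integral>\<^sup>+ x. (\<integral>\<^sup>+ t. indicator N (x(v := t)) \<partial>lborel) \<partial>lb (V - {v}))"
    using fin v by (intro nn_integral_lb_remove) auto
  finally have 0: "(\<integral>\<^sup>+ x. (\<integral>\<^sup>+ t. indicator N (x(v := t)) \<partial>lborel) \<partial>lb (V - {v})) = 0" by simp
  have upd: "(\<lambda>(x, t). x(v := t)) \<in> lb (V - {v}) \<Otimes>\<^sub>M lborel \<rightarrow>\<^sub>M lb V"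
    using measurable_add_dim[of v "V - {v}" "\<lambda>_. lborel :: real measure"] v by (simp add: insert_absorb)
  have "(\<lambda>(x, t). indicator N (x(v := t)) :: ennreal) \<in> borel_measurable (lb (V - {v}) \<Otimes>\<^sub>M lborel)"
    using measurable_compose[OF upd borel_measurable_indicator[OF N(2)]] by (simp add: split_beta')
  then have m: "(\<lambda>x. \<integral>\<^sup>+ t. indicator N (x(v := t)) \<partial>lborel) \<in> borel_measurable (lb (V - {v}))"
    by (rule lborel.borel_measurable_nn_integral)
  have AE0: "AE x in lb (V - {v}). (\<integral>\<^sup>+ t. indicator N (x(v := t)) \<partial>lborel) = 0"
    using 0 m by (simp add: nn_integral_0_iff_AE)
  \<comment> \<open>The integrand ignores coordinate \<open>v\<close>; where it is 0, integrating it
    over the line of infinite length still gives 0.\<close>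
  have "(\<integral>\<^sup>+ x. (\<integral>\<^sup>+ t. indicator N (x(v := t)) \<partial>lborel) \<partial>lb V)
      = (\<integral>\<^sup>+ x. (\<integral>\<^sup>+ (s::real). (\<integral>\<^sup>+ t. indicator N (x(v := t)) \<partial>lborel) \<partial>lborel) \<partial>lb (V - {v}))"
    using fin v by (subst nn_integral_lb_remove[where v=v]) auto
  also have "\<dots> = (\<integral>\<^sup>+ x. 0 \<partial>lb (V - {v}))"
    using AE0 by (intro nn_integral_cong_AE) auto
  finally have 0: "(\<integral>\<^sup>+ x. (\<integral>\<^sup>+ t. indicator N (x(v := t)) \<partial>lborel) \<partial>lb V) = 0" by simp
  have "(\<lambda>x. \<integral>\<^sup>+ t. indicator N (x(v := t)) \<partial>lborel) \<in> borel_measurable (lb V)" by measurable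
  with 0 have "AE x in lb V. (\<integral>\<^sup>+ t. indicator N (x(v := t)) \<partial>lborel) = 0"
    by (simp add: nn_integral_0_iff_AE)
  then show ?thesis
  proof (rule AE_mp[OF _ AE_I2[OF impI]])
    fix x assume x: "x \<in> space (lb V)" and z: "(\<integral>\<^sup>+ t. indicator N (x(v := t)) \<partial>lborel) = 0"
    have "(\<lambda>t. indicator N (x(v := t)) :: ennreal) \<in> borel_measurable lborel"
      using x v by (intro measurable_compose[OF _ borel_measurable_indicator[OF N(2)]]) auto
    then have "AE t in lborel. (indicator N (x(v := t)) :: ennreal) = 0"
      using z by (simp add: nn_integral_0_iff_AE)
    then show "AE t in lborel. P (x(v := t))"
      using N(1) upd_space_lb'[OF v x] by (auto elim!: eventually_mono split: split_indicator_asm)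
  qed
qed

lemma AE_lb_updI:
  assumes fin: "finite V" and v: "v \<in> V" and [measurable]: "Measurable.pred (lb V) P"
    and "\<And>x. x \<in> space (lb V) \<Longrightarrow> AE t in lborel. P (x(v := t))"
  shows "AE x in lb V. P x"
proof -
  have "(\<integral>\<^sup>+ x. indicator {x \<in> space (lb V). \<not> P x} x \<partial>lb V)
    = (\<integral>\<^sup>+ x. (\<integral>\<^sup>+ t. indicator {x \<in> space (lb V). \<not> P x} (x(v := t)) \<partial>lborel) \<partial>lb (V - {v}))"
    using fin v by (intro nn_integral_lb_remove) auto
  also have "\<dots> = (\<integral>\<^sup>+ x. 0 \<partial>lb (V - {v}))"
  proof (intro nn_integral_cong)
    fix x assume x: "x \<in> space (lb (V - {v}))"
    have "AE t in lborel. P ((x(v := 0))(v := t))" by (intro assms(4) upd_space_lb v x)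
    then have "AE t in lborel. (indicator {x \<in> space (lb V). \<not> P x} (x(v := t)) :: ennreal) = 0"
      by eventually_elim simp
    then show "(\<integral>\<^sup>+ t. indicator {x \<in> space (lb V). \<not> P x} (x(v := t)) \<partial>lborel) = 0"
      by (subst nn_integral_cong_AE[where v="\<lambda>_. 0"]) auto
  qed
  finally have "emeasure (lb V) {x \<in> space (lb V). \<not> P x} = 0" by simp
  then show ?thesis by (intro AE_I[of _ _ "{x \<in> space (lb V). \<not> P x}"]) auto
qed

lemma AE_lborel_ex:
  assumes "AE t in lborel. P t"
  shows "\<exists>t. t \<noteq> (a::real) \<and> P t"
proof (rule ccontr)
  assume none: "\<not> ?thesis"
  have "AE t in lborel. t \<noteq> a" by (rule AE_lborel_singleton)
  with assms have "AE t in lborel. t \<noteq> a \<and> P t" by eventually_elim simp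
  then have "AE t in lborel :: real measure. False" by (rule eventually_mono) (use none in blast)
  then have "emeasure lborel (UNIV :: real set) = 0"
    using AE_iff_measurable[of UNIV "lborel :: real measure" "\<lambda>_. False"] by simp
  then show False by simp
qed

lemma AE_lb_ex:
  assumes "finite V" "AE x in lb V. P x"
  shows "\<exists>x. P x"
proof (rule ccontr)
  assume "\<not> ?thesis"
  then have "AE x in lb V. False" using assms by simp
  then have "emeasure (lb V) (space (lb V)) = 0"
    using AE_iff_measurable[of "space (lb V)" "lb V" "\<lambda>_. False"] by simp
  moreover have "emeasure (lb V) (PiE V (\<lambda>_. {0..1})) = 1"
    using assms(1) by (simp add: lb.emeasure_PiM)
  moreover have "emeasure (lb V) (PiE V (\<lambda>_. {0..1})) \<le> emeasure (lb V) (space (lb V))"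
    using assms(1) by (intro emeasure_mono) (auto simp: space_PiM)
  ultimately show False by simp
qed

section \<open>The local Markov property of covariances\<close>

definition markov_kernels :: "nat \<Rightarrow> (nat \<times> nat) set \<Rightarrow> (nat \<Rightarrow> (nat \<Rightarrow> real) \<Rightarrow> real) \<Rightarrow> bool" where
  "markov_kernels d E g \<longleftrightarrow> (\<forall>k<d. g k \<in> borel_measurable (Rd d) \<and> (\<forall>x. 0 \<le> g k x) \<and>
     (\<forall>x y. (\<forall>i \<in> insert k (parents E k). x i = y i) \<longrightarrow> g k x = g k y) \<and>
     (\<forall>x. (\<integral>\<^sup>+ t. ennreal (g k (x(k := t))) \<partial>lborel) = 1))"

lemma markov_density_iff:
  "markov_density d E f \<longleftrightarrow> (\<exists>g. markov_kernels d E g \<and> (AE x in Rd d. f x = (\<Prod>k<d. g k x)))"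
  unfolding markov_density_def markov_kernels_def by (rule ex_cong1) blast

lemma dag_parents_subset: "dag d E \<Longrightarrow> parents E k \<subseteq> {..<d}"
  by (auto simp: dag_def parents_def)

lemma dag_not_parent_self: "dag d E \<Longrightarrow> k \<notin> parents E k"
  by (auto simp: dag_def parents_def acyclic_def)

lemma dag_wf:
  assumes "dag d E" shows "wf E"
proof -
  have "finite E" using assms finite_subset[of E "{..<d} \<times> {..<d}"] by (auto simp: dag_def)
  then show ?thesis using assms by (simp add: dag_def finite_acyclic_wf)
qed

lemma kernel_upd:
  assumes "markov_kernels d E g" "k < d" "v \<noteq> k" "v \<notin> parents E k"
  shows "g k (x(v := t)) = g k x"
proof -
  have "\<forall>i\<in>insert k (parents E k). (x(v := t)) i = x i" using assms by auto
  then show ?thesis using assms(1,2) unfolding markov_kernels_def by blast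
qed

lemma prod_kernel_upd:
  assumes "markov_kernels d E g" "B \<subseteq> {..<d}" "v \<notin> B" "\<And>k. k \<in> B \<Longrightarrow> v \<notin> parents E k"
  shows "(\<Prod>k\<in>B. g k (x(v := t))) = (\<Prod>k\<in>B. g k x)"
  using assms by (intro prod.cong) (auto intro!: kernel_upd)

text \<open>Every ancestral set arises from the full vertex set by removing sinks one at a time.\<close>

lemma ancestral_induct [consumes 3, case_names full remove]:
  assumes dag: "dag d E" and "B \<subseteq> {..<d}" "\<forall>k\<in>B. parents E k \<subseteq> B"
    and full: "P {..<d}"
    and remove: "\<And>v B. v < d \<Longrightarrow> v \<notin> B \<Longrightarrow> B \<subseteq> {..<d} \<Longrightarrow>
      (\<And>k. k \<in> insert v B \<Longrightarrow> parents E k \<subseteq> B) \<Longrightarrow> P (insert v B) \<Longrightarrow> P B"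
  shows "P B"
  using assms(2,3)
proof (induction "card ({..<d} - B)" arbitrary: B rule: less_induct)
  case less
  show ?case
  proof (cases "B = {..<d}")
    case False
    then obtain v0 where "v0 \<in> {..<d} - B" using less(2) by blast
    then obtain v where v: "v \<in> {..<d} - B" and vmin: "\<And>u. (u, v) \<in> E \<Longrightarrow> u \<notin> {..<d} - B"
      using wfE_min[OF dag_wf[OF dag], of v0 "{..<d} - B"] by metis
    have pv: "parents E v \<subseteq> B" using vmin dag_parents_subset[OF dag, of v] by (auto simp: parents_def)
    have "card ({..<d} - insert v B) < card ({..<d} - B)" using v by (intro psubset_card_mono) auto
    then have "P (insert v B)"
      using less(1)[of "insert v B"] less(2,3) pv v by auto
    then show ?thesis using remove[of v B] less(2,3) pv v by auto
  qed (simp add: full)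
qed

text \<open>A kernel is normalized only in its own variable, so it can be integrated away only while
  no remaining kernel depends on that variable. Sinks are therefore treated one at a time.\<close>

lemma nn_integral_markov_kernels:
  assumes dag: "dag d E" and g: "markov_kernels d E g"
  shows "(\<integral>\<^sup>+ x. ennreal (\<Prod>k<d. g k x) \<partial>Rd d) = 1"
proof -
  \<comment> \<open>Integrating a coordinate out would change the product space. Instead the kernel
    of a removed vertex is replaced by a standard normal density, which leaves the integral
    unchanged; at the end only independent normal densities remain.\<close>
  define h where "h B x = (\<Prod>k<d. ennreal (if k \<in> B then g k x else std_normal_density (x k)))" for B x
  have gm: "g k \<in> borel_measurable (Rd d)" if "k < d" for k
    using g that by (simp add: markov_kernels_def)
  have hm: "h B \<in> borel_measurable (Rd d)" for B
    unfolding h_def using gm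
    by (intro borel_measurable_prod_ennreal measurable_compose[OF _ measurable_ennreal]) auto
  have "(\<integral>\<^sup>+ x. h B x \<partial>Rd d) = (\<integral>\<^sup>+ x. h {..<d} x \<partial>Rd d)"
    if "B \<subseteq> {..<d}" "\<forall>k\<in>B. parents E k \<subseteq> B" for B
    using dag that
  proof (induction rule: ancestral_induct)
    case (remove v B)
    let ?R = "\<lambda>x. \<Prod>k\<in>{..<d} - {v}. ennreal (if k \<in> B then g k x else std_normal_density (x k))"
    have v: "v \<in> {..<d}" using remove by simp
    have upd: "g k (x(v := t)) = g k x" if "k \<in> B" for k x t
      using remove(3) remove(4)[of k] remove(2) that by (intro kernel_upd[OF g]) auto
    have split: "h A (x(v := t)) = ennreal (if v \<in> A then g v (x(v := t)) else std_normal_density t) * ?R x"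
      if "A = B \<or> A = insert v B" for A x t
    proof -
      have "(\<Prod>k\<in>{..<d} - {v}. ennreal (if k \<in> A then g k (x(v := t)) else std_normal_density ((x(v := t)) k))) = ?R x"
        using that upd by (intro prod.cong) auto
      then show ?thesis unfolding h_def by (subst prod.remove[OF _ v]) auto
    qed
    have "(\<integral>\<^sup>+ t. h A (x(v := t)) \<partial>lborel) = ?R x"
      if A: "A = B \<or> A = insert v B" and x: "x \<in> space (lb ({..<d} - {v}))" for A x
    proof -
      have "(\<lambda>t. g v (x(v := t))) \<in> borel_measurable lborel"
      proof -
        have "(\<lambda>t. (x(v := 0))(v := t)) \<in> lborel \<rightarrow>\<^sub>M Rd d"
          by (rule measurable_upd[OF v measurable_const[OF upd_space_lb[OF v x]]]) simp
        then show ?thesis using gm[of v] remove(1) measurable_compose[of _ lborel "Rd d" "g v" borel] by simp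
      qed
      then have "(\<integral>\<^sup>+ t. h A (x(v := t)) \<partial>lborel)
        = (\<integral>\<^sup>+ t. ennreal (if v \<in> A then g v (x(v := t)) else std_normal_density t) \<partial>lborel) * ?R x"
        unfolding split[OF A] by (intro nn_integral_multc) auto
      moreover have "(\<integral>\<^sup>+ t. ennreal (std_normal_density t) \<partial>lborel) = 1"
        using prob_space.emeasure_space_1[OF prob_space_normal_density[of 1 0]] by (simp add: emeasure_density)
      moreover have "(\<integral>\<^sup>+ t. ennreal (g v (x(v := t))) \<partial>lborel) = 1"
        using g remove(1) by (simp add: markov_kernels_def)
      ultimately show ?thesis by (cases "v \<in> A") simp_all
    qed
    then have "(\<integral>\<^sup>+ x. h B x \<partial>Rd d) = (\<integral>\<^sup>+ x. h (insert v B) x \<partial>Rd d)"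
      using v by (simp add: nn_integral_lb_remove[OF finite_lessThan v hm] cong: nn_integral_cong_simp)
    then show ?case using remove by simp
  qed simp
  from this[of "{}"] have "(\<integral>\<^sup>+ x. h {..<d} x \<partial>Rd d) = (\<integral>\<^sup>+ x. h {} x \<partial>Rd d)" by simp
  also have "\<dots> = (\<Prod>k<d. \<integral>\<^sup>+ t. ennreal (std_normal_density t) \<partial>lborel)"
    unfolding h_def by (subst lb.product_nn_integral_prod[symmetric]) auto
  also have "\<dots> = 1"
    using prob_space.emeasure_space_1[OF prob_space_normal_density[of 1 0]] by (simp add: emeasure_density)
  finally have "(\<integral>\<^sup>+ x. h {..<d} x \<partial>Rd d) = 1" .
  moreover have "h {..<d} x = ennreal (\<Prod>k<d. g k x)" for x
    unfolding h_def using g by (subst prod_ennreal[symmetric]) (auto simp: markov_kernels_def)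
  ultimately show ?thesis by simp
qed

text \<open>For a sink \<open>v\<close> of \<open>insert v B\<close> only \<open>g v\<close>
  involves \<open>x v\<close>, so integration over \<open>x v\<close> erases this factor on one side
  and marginalizes the Gaussian on the other.\<close>

lemma markov_marginal:
  assumes dag: "dag d E" and g: "markov_kernels d E g"
    and pd: "pd_on {..<d} S" and K: "precision {..<d} S K" and C: "0 < C"
    and f: "AE x in Rd d. C * exp (- bil {..<d} K x x / 2) = (\<Prod>k<d. g k x)"
    and B: "B \<subseteq> {..<d}" "\<forall>k\<in>B. parents E k \<subseteq> B"
  shows "\<exists>C' K'. 0 < C' \<and> precision B S K' \<and>
     (AE x in Rd d. (\<Prod>k\<in>B. g k x) = C' * exp (- bil B K' x x / 2))"
  using dag B
proof (induction rule: ancestral_induct)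
  case full
  have "AE x in Rd d. (\<Prod>k<d. g k x) = C * exp (- bil {..<d} K x x / 2)"
    using f by eventually_elim simp
  then show ?case using C K by blast
next
  case (remove v B)
  then obtain C' K' where C': "0 < C'" and K': "precision (insert v B) S K'" and
    AE1: "AE x in Rd d. (\<Prod>k\<in>insert v B. g k x) = C' * exp (- bil (insert v B) K' x x / 2)"
    by blast
  note vd = remove(1) and vB = remove(2)
  have finB: "finite B" using remove(3) finite_subset by blast
  have B': "insert v B \<subseteq> {..<d}" using remove(3) vd by auto
  have vpar: "v \<notin> parents E k" if "k \<in> B" for k using remove(4)[of k] that vB by auto
  obtain K0 \<beta> D where K0: "precision B S K0" and D: "0 < D" and
    quad: "\<And>x. bil (insert v B) K' x x = bil B K0 x x + (x v - (\<Sum>i\<in>B. \<beta> i * x i))\<^sup>2 / D"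
    by (rule precision_elim[OF finB vB pd_on_subset[OF pd _ B'] K'], simp, rule that)
  have "AE x in Rd d. AE t in lborel. (\<Prod>k\<in>insert v B. g k (x(v := t)))
      = C' * exp (- bil (insert v B) K' (x(v := t)) (x(v := t)) / 2)"
    using vd by (intro AE_lb_upd AE1) auto
  then have "AE x in Rd d. (\<Prod>k\<in>B. g k x) = C' * sqrt (2 * pi * D) * exp (- bil B K0 x x / 2)"
  proof (rule AE_mp[OF _ AE_I2[OF impI]])
    fix x assume x: "x \<in> space (Rd d)" and ae: "AE t in lborel. (\<Prod>k\<in>insert v B. g k (x(v := t)))
      = C' * exp (- bil (insert v B) K' (x(v := t)) (x(v := t)) / 2)"
    let ?m = "\<Sum>i\<in>B. \<beta> i * x i"
    have gB: "(\<Prod>k\<in>insert v B. g k (x(v := t))) = g v (x(v := t)) * (\<Prod>k\<in>B. g k x)" for t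
      using prod_kernel_upd[OF g remove(3) vB vpar, of x t] vB finB by simp
    have e1: "bil B K0 (x(v := t)) (x(v := t)) = bil B K0 x x" for t
      using vB by (intro bil_cong) auto
    have e2: "(\<Sum>i\<in>B. \<beta> i * (x(v := t)) i) = ?m" for t using vB by (intro sum.cong) auto
    have gm: "(\<lambda>t. g v (x(v := t))) \<in> borel_measurable lborel"
    proof -
      have "(\<lambda>t. x(v := t)) \<in> lborel \<rightarrow>\<^sub>M Rd d" using x vd by (intro measurable_upd) auto
      then show ?thesis using g vd measurable_compose[of _ lborel "Rd d" "g v" borel]
        by (auto simp: markov_kernels_def)
    qed
    have nn: "0 \<le> (\<Prod>k\<in>B. g k x)" using g remove(3) by (intro prod_nonneg) (auto simp: markov_kernels_def)
    have g0: "0 \<le> g v y" for y using g vd by (auto simp: markov_kernels_def)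
    \<comment> \<open>The factor 1, written as the integral of the kernel of \<open>v\<close>,
      brings the product over \<open>insert v B\<close> under the integral, where it may be
      exchanged for the Gaussian almost everywhere.\<close>
    have "ennreal (\<Prod>k\<in>B. g k x) = ennreal (\<Prod>k\<in>B. g k x) * (\<integral>\<^sup>+ t. ennreal (g v (x(v := t))) \<partial>lborel)"
      using g vd by (simp add: markov_kernels_def)
    also have "\<dots> = (\<integral>\<^sup>+ t. ennreal (\<Prod>k\<in>B. g k x) * ennreal (g v (x(v := t))) \<partial>lborel)"
      using gm by (intro nn_integral_cmult[symmetric]) auto
    also have "\<dots> = (\<integral>\<^sup>+ t. ennreal (C' * exp (- bil B K0 x x / 2)) *
         ennreal (exp (- ((t - ?m)\<^sup>2 / D) / 2 - 0 * (0 * t + 0)\<^sup>2)) \<partial>lborel)"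
    proof (rule nn_integral_cong_AE, use ae in eventually_elim)
      case (elim t)
      have "(\<Prod>k\<in>B. g k x) * g v (x(v := t)) = C' * exp (- bil B K0 x x / 2) * exp (- ((t - ?m)\<^sup>2 / D) / 2)"
        using elim unfolding gB quad e1 e2
        by (simp add: exp_add[symmetric] add_divide_distrib mult.commute)
      then show ?case using nn g0 C' by (simp add: ennreal_mult[symmetric])
    qed
    also have "\<dots> = ennreal (C' * exp (- bil B K0 x x / 2)) * ennreal (sqrt (2 * pi * D))"
      using nn_integral_gauss_coord[OF D, of 1 0 0 ?m 0] by (subst nn_integral_cmult) auto
    finally have "ennreal (\<Prod>k\<in>B. g k x) = ennreal (C' * sqrt (2 * pi * D) * exp (- bil B K0 x x / 2))"
      using C' D by (simp add: ennreal_mult[symmetric] mult_ac)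
    then show "(\<Prod>k\<in>B. g k x) = C' * sqrt (2 * pi * D) * exp (- bil B K0 x x / 2)"
      using nn C' D by (subst (asm) ennreal_inj) auto
  qed
  then show ?case using C' D K0 by (intro exI[of _ "C' * sqrt (2 * pi * D)"] exI[of _ K0]) auto
qed

lemma bil_mixed_difference:
  assumes "finite A" "k \<in> A" "j \<in> A" "k \<noteq> j"
  shows "bil A K (x(k := s, j := t)) (x(k := s, j := t)) + bil A K x x
     = bil A K (x(k := s)) (x(k := s)) + bil A K (x(j := t)) (x(j := t))
       + (s - x k) * (t - x j) * (K k j + K j k)"
proof -
  define p q where "p = s - x k" and "q = t - x j"
  have 1: "x(k := s) = (\<lambda>i. x i + p * of_bool (i = k))" by (auto simp: p_def)
  have 2: "x(j := t) = (\<lambda>i. x i + q * of_bool (i = j))" by (auto simp: q_def)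
  have 3: "x(k := s, j := t) = (\<lambda>i. (x i + p * of_bool (i = k)) + q * of_bool (i = j))"
    using assms(4) by (auto simp: p_def q_def)
  show ?thesis
    unfolding 3 unfolding 1 2 bil_add_left bil_add_right bil_scale_left bil_scale_right
      p_def[symmetric] q_def[symmetric]
    using assms by (simp add: bil_unit algebra_simps)
qed

text \<open>Column \<open>k\<close> of the inverse, taken as a vector \<open>x\<close>, satisfies
  \<open>bil A S x x = K k k\<close>, and an invertible matrix has no zero column.\<close>

lemma precision_diag_nonzero:
  assumes "finite A" "pd_on A S" "precision A S K" "k \<in> A"
  shows "K k k \<noteq> 0"
proof
  assume 0: "K k k = 0"
  define x where "x l = K l k" for l
  have e: "(\<Sum>l\<in>A. S i l * x l) = (if i = k then 1 else 0)" if "i \<in> A" for i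
    using assms(3,4) that by (simp add: precision_def x_def)
  have "bil A S x x = (\<Sum>i\<in>A. x i * (\<Sum>l\<in>A. S i l * x l))"
    by (simp add: bil_def sum_distrib_left mult.assoc)
  also have "\<dots> = (\<Sum>i\<in>A. if i = k then x i else 0)" by (intro sum.cong) (auto simp: e)
  also have "\<dots> = 0" using assms(1,4) 0 by (simp add: x_def)
  finally have "x l = 0" if "l \<in> A" for l using pd_on_pos[OF assms(2) that, of x] by fastforce
  then show False using e[OF assms(4)] by simp
qed

theorem local_markov_covariance:
  assumes dag: "dag d E" and f: "markov_density d E (\<lambda>x. C * exp (- bil {..<d} K x x / 2))"
    and pd: "pd_on {..<d} S" and K: "precision {..<d} S K" and C: "0 < C" and k: "k < d"
  shows "\<exists>b. \<forall>j<d. j \<noteq> k \<longrightarrow> (k, j) \<notin> E\<^sup>+ \<longrightarrow> S k j = (\<Sum>i\<in>parents E k. b i * S i j)"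
proof -
  obtain g where g: "markov_kernels d E g"
    and fg: "AE x in Rd d. C * exp (- bil {..<d} K x x / 2) = (\<Prod>k<d. g k x)"
    using f by (auto simp: markov_density_iff)
  define A where "A = {j. j < d \<and> (k, j) \<notin> E\<^sup>+}"
  have Ad: "A \<subseteq> {..<d}" by (auto simp: A_def)
  then have finA: "finite A" using finite_subset by blast
  have kA: "k \<in> A" using dag k by (auto simp: A_def dag_def acyclic_def)
  have anc: "parents E i \<subseteq> A" if "i \<in> A" for i
    using that dag_parents_subset[OF dag, of i] by (auto simp: A_def parents_def dest: trancl_into_trancl)
  have sink: "k \<notin> parents E i" if "i \<in> A" for i using that by (auto simp: A_def parents_def)
  obtain C' K' where C': "0 < C'" and K': "precision A S K'" and
    AE1: "AE x in Rd d. (\<Prod>k\<in>A. g k x) = C' * exp (- bil A K' x x / 2)"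
    using markov_marginal[OF dag g pd K C fg Ad] anc by blast
  have zero: "K' j k = 0" if j: "j \<in> A" "j \<noteq> k" "j \<notin> parents E k" for j
  proof -
    define P where "P x \<longleftrightarrow> (\<Prod>k\<in>A. g k x) = C' * exp (- bil A K' x x / 2)" for x
    have P: "AE x in Rd d. P x" using AE1 by (simp add: P_def)
    have jd: "j \<in> {..<d}" and kd: "k \<in> {..<d}" using j Ad k by auto
    note Pj = AE_lb_upd[OF finite_lessThan jd P]
    note Pk = AE_lb_upd[OF finite_lessThan kd P]
    note Pkj = AE_lb_upd[OF finite_lessThan kd Pj]
    \<comment> \<open>The factorization must hold at \<open>x\<close>, after changing
      \<open>k\<close>, after changing \<open>j\<close>, and after changing both; the nested
      quantifiers allow choosing \<open>x\<close>, then \<open>s\<close>, then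
      \<open>t\<close>.\<close>
    have "AE x in Rd d. P x \<and> (AE t in lborel. P (x(j := t))) \<and>
       (AE s in lborel. P (x(k := s)) \<and> (AE t in lborel. P (x(k := s, j := t))))"
      using P Pj Pk Pkj by eventually_elim auto
    then obtain x where x: "P x" "AE t in lborel. P (x(j := t))"
       "AE s in lborel. P (x(k := s)) \<and> (AE t in lborel. P (x(k := s, j := t)))"
      using AE_lb_ex[OF finite_lessThan] by blast
    \<comment> \<open>The new coordinates must differ from the old ones, otherwise the mixed
      difference carries no information on \<open>K' k j\<close>.\<close>
    obtain s where s: "s \<noteq> x k" "P (x(k := s))" "AE t in lborel. P (x(k := s, j := t))"
      using AE_lborel_ex[OF x(3)] by blast
    have "AE t in lborel. P (x(j := t)) \<and> P (x(k := s, j := t))"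
      using x(2) s(3) by eventually_elim simp
    then obtain t where t: "t \<noteq> x j" "P (x(j := t))" "P (x(k := s, j := t))"
      using AE_lborel_ex[of _ "x j"] by blast
    define G where "G y = (\<Prod>i\<in>A - {k}. g i y)" for y
    have F: "(\<Prod>i\<in>A. g i y) = g k y * G y" for y
      unfolding G_def using finA kA by (rule prod.remove)
    have Gk: "G (y(k := r)) = G y" for y r
      unfolding G_def using Ad sink by (intro prod_kernel_upd[OF g]) auto
    have gj: "g k (y(j := r)) = g k y" for y r
      using kernel_upd[OF g k] j by auto
    have Gkj: "G (x(k := s, j := t)) = G (x(j := t))"
      using Gk[of "x(j := t)" s] j(2) by (simp add: fun_upd_twist)
    \<comment> \<open>\<open>g k\<close> ignores \<open>x j\<close> and the remaining product
      \<open>G\<close> ignores \<open>x k\<close>, so the two products over opposite corners of the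
      rectangle agree.\<close>
    have "(g k x * G x) * (g k (x(k := s, j := t)) * G (x(k := s, j := t)))
      = (g k (x(k := s)) * G (x(k := s))) * (g k (x(j := t)) * G (x(j := t)))"
      by (simp add: gj Gk Gkj)
    then have "C' * exp (- bil A K' x x / 2) * (C' * exp (- bil A K' (x(k := s, j := t)) (x(k := s, j := t)) / 2))
      = C' * exp (- bil A K' (x(k := s)) (x(k := s)) / 2) * (C' * exp (- bil A K' (x(j := t)) (x(j := t)) / 2))"
      using x(1) s(2) t(2,3) unfolding P_def F by simp
    then have "exp (- bil A K' x x / 2 + - bil A K' (x(k := s, j := t)) (x(k := s, j := t)) / 2)
      = exp (- bil A K' (x(k := s)) (x(k := s)) / 2 + - bil A K' (x(j := t)) (x(j := t)) / 2)"
      using C' by (simp only: exp_add) simp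
    then have "bil A K' (x(k := s, j := t)) (x(k := s, j := t)) + bil A K' x x
      = bil A K' (x(k := s)) (x(k := s)) + bil A K' (x(j := t)) (x(j := t))"
      by simp
    then have "(s - x k) * (t - x j) * (K' k j + K' j k) = 0"
      using bil_mixed_difference[OF finA kA j(1), of K' x s t] j(2) by auto
    moreover have "K' k j = K' j k" using K' kA j(1) by (auto simp: precision_def)
    ultimately show ?thesis using s(1) t(1) by simp
  qed
  have diag: "K' k k \<noteq> 0"
    by (rule precision_diag_nonzero[OF finA pd_on_subset[OF pd finite_lessThan Ad] K' kA])
  \<comment> \<open>The usual regression coefficients read off a precision matrix.\<close>
  define b where "b i = - K' i k / K' k k" for i
  have "S k j = (\<Sum>i\<in>parents E k. b i * S i j)" if j: "j < d" "j \<noteq> k" "(k, j) \<notin> E\<^sup>+" for j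
  proof -
    have jA: "j \<in> A" using j by (simp add: A_def)
    have sym: "S i l = S l i" if "i \<in> A" "l \<in> A" for i l using pd_on_sym[OF pd] that Ad by auto
    have "0 = (\<Sum>l\<in>A. S j l * K' l k)" using K' jA kA j(2) by (simp add: precision_def)
    also have "\<dots> = (\<Sum>l\<in>insert k (parents E k). S j l * K' l k)"
      using finA kA anc[OF kA] zero by (intro sum.mono_neutral_right) auto
    also have "\<dots> = S j k * K' k k + (\<Sum>l\<in>parents E k. S j l * K' l k)"
      using dag_not_parent_self[OF dag, of k] finite_subset[OF anc[OF kA] finA] by simp
    finally have "S j k = (\<Sum>l\<in>parents E k. - (S j l * K' l k)) / K' k k"
      using diag by (simp add: field_simps sum_negf)
    also have "\<dots> = (\<Sum>i\<in>parents E k. b i * S i j)"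
      unfolding sum_divide_distrib b_def using anc[OF kA] jA by (intro sum.cong) (auto simp: sym)
    finally show ?thesis using sym[OF kA jA] by simp
  qed
  then show ?thesis by blast
qed

section \<open>Vanishing partial correlations in polytrees\<close>

text \<open>The interface between densities and graphs: every later statement about correlations in
  \<open>T\<close> or in an equivalent DAG is derived from these identities.\<close>

definition local_cov :: "nat \<Rightarrow> (nat \<times> nat) set \<Rightarrow> (nat \<Rightarrow> nat \<Rightarrow> real) \<Rightarrow> bool" where
  "local_cov d E S \<longleftrightarrow> (\<forall>k<d. \<exists>b. \<forall>j<d. j \<noteq> k \<longrightarrow> (k, j) \<notin> E\<^sup>+ \<longrightarrow>
     S k j = (\<Sum>i\<in>parents E k. b i * S i j))"

lemma local_covE:
  assumes "local_cov d E S" "k < d"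
  obtains b where "\<And>j. j < d \<Longrightarrow> j \<noteq> k \<Longrightarrow> (k, j) \<notin> E\<^sup>+ \<Longrightarrow> S k j = (\<Sum>i\<in>parents E k. b i * S i j)"
  using assms unfolding local_cov_def by blast

lemma dag_irrefl: "dag d E \<Longrightarrow> (k, k) \<notin> E\<^sup>+"
  by (auto simp: dag_def acyclic_def)

lemma dag_bound: "dag d E \<Longrightarrow> (a, b) \<in> E \<Longrightarrow> a < d \<and> b < d"
  by (auto simp: dag_def)

lemma dag_asym: "dag d E \<Longrightarrow> (a, b) \<in> E \<Longrightarrow> (b, a) \<notin> E\<^sup>*"
  using dag_irrefl by (metis rtrancl_into_trancl2)

text \<open>Induction on \<open>b\<close>: its parents inherit the hypothesis, and \<open>a\<close>
  is a nondescendant of \<open>b\<close>, as otherwise \<open>b\<close> itself would be a common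
  ancestor. The regression of \<open>b\<close> on its parents then has only zero terms.\<close>

lemma cov_zero_if_no_common_ancestor:
  assumes dag: "dag d E" and lc: "local_cov d E S" and "a < d" "b < d"
    and "\<And>u. (u, a) \<in> E\<^sup>* \<Longrightarrow> (u, b) \<notin> E\<^sup>*"
  shows "S b a = 0"
  using assms(4,5)
proof (induction b rule: wf_induct_rule[OF dag_wf[OF dag]])
  case (1 b)
  obtain c where c: "\<And>j. j < d \<Longrightarrow> j \<noteq> b \<Longrightarrow> (b, j) \<notin> E\<^sup>+ \<Longrightarrow> S b j = (\<Sum>i\<in>parents E b. c i * S i j)"
    using local_covE[OF lc 1(2)] by blast
  have "a \<noteq> b" "(b, a) \<notin> E\<^sup>+" using 1(3)[of b] trancl_into_rtrancl[of b a E] by auto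
  then have "S b a = (\<Sum>i\<in>parents E b. c i * S i a)" using c assms(3) by blast
  also have "\<dots> = 0"
  proof (intro sum.neutral ballI)
    fix i assume "i \<in> parents E b"
    then have i: "(i, b) \<in> E" by (simp add: parents_def)
    have "S i a = 0"
      using 1(3) i dag_bound[OF dag i] by (intro 1(1)) (auto dest: rtrancl_into_rtrancl)
    then show "c i * S i a = 0" by simp
  qed
  finally show ?case .
qed

section \<open>Deleting a vertex of a tree\<close>

definition avoiding :: "(nat \<times> nat) set \<Rightarrow> nat \<Rightarrow> (nat \<times> nat) set" where
  "avoiding U b = {(x, y) \<in> U. x \<noteq> b \<and> y \<noteq> b}"

lemma rtrancl_distinct_path:
  assumes "(x, y) \<in> R\<^sup>*"
  shows "\<exists>p. p \<noteq> [] \<and> distinct p \<and> hd p = x \<and> last p = y \<and> successively (\<lambda>a b. (a, b) \<in> R) p"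
  using assms
proof (induction rule: rtrancl_induct)
  case base
  then show ?case by (intro exI[of _ "[x]"]) auto
next
  case (step y z)
  then obtain p where p: "p \<noteq> []" "distinct p" "hd p = x" "last p = y"
    "successively (\<lambda>a b. (a, b) \<in> R) p" by blast
  show ?case
  proof (cases "z \<in> set p")
    case True
    then obtain p1 p2 where "p = p1 @ z # p2" by (meson split_list)
    then show ?thesis using p
      by (intro exI[of _ "p1 @ [z]"]) (auto simp: successively_append_iff hd_append split: if_splits)
  next
    case False
    then show ?thesis using p step(2)
      by (intro exI[of _ "p @ [z]"]) (auto simp: successively_append_iff)
  qed
qed

text \<open>A path between the two neighbours that avoids \<open>b\<close> would close up to a cycle
  through \<open>b\<close>. This is how the tree structure enters the covariance arguments.\<close>

lemma neighbours_separated: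
  assumes acyc: "\<not> has_undirected_cycle U" and sym: "sym U"
    and i: "(b, i) \<in> U" and i': "(b, i') \<in> U" and ne: "i \<noteq> i'"
  shows "(i, i') \<notin> (avoiding U b)\<^sup>*"
proof
  assume conn: "(i, i') \<in> (avoiding U b)\<^sup>*"
  obtain p where p: "p \<noteq> []" "distinct p" "hd p = i" "last p = i'"
    "successively (\<lambda>a b'. (a, b') \<in> avoiding U b) p"
    using rtrancl_distinct_path[OF conn] by (elim exE conjE) (rule that)
  have edge: "(p ! m, p ! Suc m) \<in> avoiding U b" if "Suc m < length p" for m
    using p(5) that by (simp add: successively_conv_nth)
  have len: "2 \<le> length p" using p(1,3,4) ne by (cases p; cases "tl p") auto
  have b: "b \<notin> set p"
  proof
    assume "b \<in> set p"
    then obtain m where m: "m < length p" "p ! m = b" by (auto simp: in_set_conv_nth)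
    show False
    proof (cases m)
      case 0
      then show False using edge[of 0] len m(2) by (auto simp: avoiding_def)
    next
      case (Suc m')
      then show False using edge[of m'] m by (auto simp: avoiding_def)
    qed
  qed
  have "has_undirected_cycle U"
    unfolding has_undirected_cycle_def
  proof (intro exI[of _ "b # p"] conjI allI impI)
    fix m assume m: "m < length (b # p)"
    consider "m = 0" | m' where "m = Suc m'" "Suc m' < length p" | "m = length p"
      using m by (cases m) (auto simp: less_Suc_eq)
    then show "((b # p) ! m, (b # p) ! ((m + 1) mod length (b # p))) \<in> U"
    proof cases
      case 1
      then show ?thesis using i p(1,3) by (simp add: hd_conv_nth)
    next
      case 2
      then show ?thesis using edge[of m'] by (simp add: avoiding_def)
    next
      case 3
      then have "(b # p) ! m = i'" using p(1,4) by (simp add: last_conv_nth)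
      moreover have "(m + 1) mod length (b # p) = 0" using 3 by simp
      ultimately show ?thesis using i' sym by (simp add: sym_def)
    qed
  qed (use p(2) b len in auto)
  with acyc show False ..
qed

lemma sym_skel: "sym (skel E)"
  by (auto simp: skel_def sym_def)

lemma sym_avoiding: "sym U \<Longrightarrow> sym (avoiding U b)"
  by (auto simp: avoiding_def sym_def)

lemma ancestor_avoiding:
  assumes "(u, i) \<in> E\<^sup>*" "(b, i) \<notin> E\<^sup>*"
  shows "(i, u) \<in> (avoiding (skel E) b)\<^sup>*"
  using assms(1)
proof (induction rule: converse_rtrancl_induct)
  case (step u w)
  have "w \<noteq> b" "u \<noteq> b" using step assms(2) by (auto dest: converse_rtrancl_into_rtrancl)
  then have "(w, u) \<in> avoiding (skel E) b" using step(1) by (auto simp: avoiding_def skel_def)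
  then show ?case using step(3) by (rule rtrancl_into_rtrancl[rotated])
qed simp

lemma descendant_avoiding:
  assumes "(j, k) \<in> E\<^sup>*" "(j, b) \<notin> E\<^sup>*"
  shows "(j, k) \<in> (avoiding (skel E) b)\<^sup>*"
  using assms(1)
proof (induction rule: rtrancl_induct)
  case (step u w)
  have "w \<noteq> b" "u \<noteq> b" using step assms(2) by (auto dest: rtrancl_into_rtrancl)
  then have "(u, w) \<in> avoiding (skel E) b" using step(2) by (auto simp: avoiding_def skel_def)
  then show ?case using step(3) by (rule rtrancl_into_rtrancl[rotated])
qed simp

text \<open>A directed path ending at a nondescendant of \<open>b\<close> never visits
  \<open>b\<close>, so a common ancestor connects \<open>i\<close> and \<open>k\<close> around
  \<open>b\<close>. Together with \<open>neighbours_separated\<close> this rules out common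
  ancestors.\<close>

lemma common_ancestor_avoiding:
  assumes "(u, i) \<in> E\<^sup>*" "(b, i) \<notin> E\<^sup>*" "(u, k) \<in> E\<^sup>*" "(b, k) \<notin> E\<^sup>*"
  shows "(i, k) \<in> (avoiding (skel E) b)\<^sup>*"
proof -
  have "(k, u) \<in> (avoiding (skel E) b)\<^sup>*" by (rule ancestor_avoiding) fact+
  then have "(u, k) \<in> (avoiding (skel E) b)\<^sup>*"
    using sym_rtrancl[OF sym_avoiding[OF sym_skel]] by (meson symD)
  with ancestor_avoiding[OF assms(1,2)] show ?thesis by (rule rtrancl_trans)
qed

lemma skel_parent: "(i, b) \<in> E \<Longrightarrow> (b, i) \<in> skel E"
  by (auto simp: skel_def)

lemma sum_single:
  fixes f :: "'a \<Rightarrow> real"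
  assumes "finite A" "i \<in> A" "\<And>j. j \<in> A \<Longrightarrow> j \<noteq> i \<Longrightarrow> f j = 0"
  shows "sum f A = f i"
  using assms by (subst sum.remove[of _ i]) auto

lemma finite_parents: "dag d E \<Longrightarrow> finite (parents E k)"
  by (rule finite_subset[OF dag_parents_subset finite_lessThan])

text \<open>After deletion of \<open>b\<close>, the component of \<open>a\<close> contains at most
  one parent \<open>i\<close> of \<open>b\<close> sharing an ancestor with \<open>a\<close>. The
  other parents are uncorrelated with both \<open>a\<close> and \<open>i\<close>, so the regression
  of \<open>b\<close> reduces to the term of \<open>i\<close> in \<open>S b a\<close> and in
  \<open>S b i\<close> alike; eliminating the coefficient gives the identity with
  \<open>l = i\<close>.\<close>

lemma nonadjacent_partial_zero_aux:
  assumes dag: "dag d E" and acyc: "\<not> has_undirected_cycle (skel E)" and lc: "local_cov d E S"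
    and ab: "a < d" "b < d" "a \<noteq> b" "(a, b) \<notin> skel E" "(b, a) \<notin> E\<^sup>+"
  shows "S b a = 0 \<or> (\<exists>l<d. l \<noteq> a \<and> l \<noteq> b \<and> S b a * S l l = S b l * S l a)"
proof -
  obtain c where c: "\<And>j. j < d \<Longrightarrow> j \<noteq> b \<Longrightarrow> (b, j) \<notin> E\<^sup>+ \<Longrightarrow> S b j = (\<Sum>i\<in>parents E b. c i * S i j)"
    using local_covE[OF lc ab(2)] by blast
  have Sba: "S b a = (\<Sum>i\<in>parents E b. c i * S i a)" using c ab by blast
  have ba: "(b, a) \<notin> E\<^sup>*" using ab by (auto simp: rtrancl_eq_or_trancl)
  show ?thesis
  proof (cases "\<exists>i\<in>parents E b. S i a \<noteq> 0")
    case False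
    then show ?thesis using Sba by simp
  next
    case True
    then obtain i where i: "(i, b) \<in> E" "S i a \<noteq> 0" by (auto simp: parents_def)
    note idb = dag_bound[OF dag i(1)]
    have nbi: "(b, k) \<notin> E\<^sup>*" if "(k, b) \<in> E" for k using dag_asym[OF dag that] .
    obtain u where u: "(u, a) \<in> E\<^sup>*" "(u, i) \<in> E\<^sup>*"
      using cov_zero_if_no_common_ancestor[OF dag lc ab(1), of i] i idb by blast
    have ia: "(i, a) \<in> (avoiding (skel E) b)\<^sup>*"
      by (rule common_ancestor_avoiding[OF u(2) nbi[OF i(1)] u(1) ba])
    have other: "S k a = 0" "S k i = 0" if k: "(k, b) \<in> E" "k \<noteq> i" for k
    proof -
      note kd = dag_bound[OF dag k(1)]
      have sep: "(i, k) \<notin> (avoiding (skel E) b)\<^sup>*"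
        using neighbours_separated[OF acyc sym_skel skel_parent[OF i(1)] skel_parent[OF k(1)]] k(2) by blast
      have "(u', k) \<notin> E\<^sup>*" if "(u', a) \<in> E\<^sup>*" for u'
        using sep rtrancl_trans[OF ia common_ancestor_avoiding[OF that ba _ nbi[OF k(1)]]] by blast
      then show "S k a = 0"
        using kd ab(1) by (intro cov_zero_if_no_common_ancestor[OF dag lc]) auto
      have "(u', k) \<notin> E\<^sup>*" if "(u', i) \<in> E\<^sup>*" for u'
        using sep common_ancestor_avoiding[OF that nbi[OF i(1)] _ nbi[OF k(1)]] by blast
      then show "S k i = 0"
        using kd idb by (intro cov_zero_if_no_common_ancestor[OF dag lc]) auto
    qed
    have fin: "finite (parents E b)" and ip: "i \<in> parents E b"
      using finite_parents[OF dag] i by (auto simp: parents_def)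
    have "S b a = c i * S i a"
      unfolding Sba using other by (intro sum_single[OF fin ip]) (auto simp: parents_def)
    moreover have "S b i = c i * S i i"
    proof -
      have "i \<noteq> b" "(b, i) \<notin> E\<^sup>+" using nbi[OF i(1)] by (auto simp: rtrancl_eq_or_trancl)
      then have "S b i = (\<Sum>k\<in>parents E b. c k * S k i)" using c idb by blast
      also have "\<dots> = c i * S i i"
        using other by (intro sum_single[OF fin ip]) (auto simp: parents_def)
      finally show ?thesis .
    qed
    moreover have "i \<noteq> a" "i \<noteq> b" using ab(4) i nbi[OF i(1)] by (auto simp: skel_def)
    ultimately show ?thesis using idb by auto
  qed
qed

lemma nonadjacent_partial_zero:
  assumes dag: "dag d E" and acyc: "\<not> has_undirected_cycle (skel E)" and lc: "local_cov d E S"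
    and sym: "\<And>i j. i < d \<Longrightarrow> j < d \<Longrightarrow> S i j = S j i"
    and ab: "a < d" "b < d" "a \<noteq> b" "(a, b) \<notin> skel E"
  shows "S a b = 0 \<or> (\<exists>l<d. l \<noteq> a \<and> l \<noteq> b \<and> S a b * S l l = S a l * S l b)"
proof (cases "(a, b) \<in> E\<^sup>+")
  case False
  then show ?thesis using nonadjacent_partial_zero_aux[OF dag acyc lc ab(2,1)] ab sym_skel[of E]
    by (auto simp: sym_def)
next
  case True
  then have "(b, a) \<notin> E\<^sup>+" using dag_irrefl[OF dag] by (meson trancl_trans)
  then show ?thesis using nonadjacent_partial_zero_aux[OF dag acyc lc ab] sym ab
    by (metis mult.commute)
qed

text \<open>Regression of the child \<open>j\<close> on its parents. Deleting \<open>j\<close>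
  leaves \<open>l\<close> and its neighbour \<open>k\<close> in one component and every other parent
  of \<open>j\<close> outside it, so only the term of \<open>l\<close> survives in
  \<open>S j k\<close> and in \<open>S j l\<close>.\<close>

lemma noncollider_partial_zero_aux:
  assumes dag: "dag d E" and acyc: "\<not> has_undirected_cycle (skel E)" and lc: "local_cov d E S"
    and ne: "j \<noteq> k" and l: "(l, j) \<in> E" "(l, k) \<in> skel E"
  shows "S j k * S l l = S j l * S l k"
proof -
  have ljd: "l < d" "j < d" using dag_bound[OF dag l(1)] by auto
  have kd: "k < d" using l(2) dag_bound[OF dag] by (auto simp: skel_def)
  have lk: "l \<noteq> k" using l(2) dag_irrefl[OF dag, of k] by (auto simp: skel_def)
  have jl: "(j, l) \<notin> E\<^sup>*" by (rule dag_asym[OF dag l(1)])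
  have sep: "(j, k) \<notin> (avoiding (skel E) l)\<^sup>*"
    using l ne by (intro neighbours_separated[OF acyc sym_skel]) (auto simp: skel_def)
  then have jk: "(j, k) \<notin> E\<^sup>*" using descendant_avoiding[OF _ jl] by blast
  obtain c where c: "\<And>i. i < d \<Longrightarrow> i \<noteq> j \<Longrightarrow> (j, i) \<notin> E\<^sup>+ \<Longrightarrow> S j i = (\<Sum>m\<in>parents E j. c m * S m i)"
    using local_covE[OF lc ljd(2)] by blast
  have kl: "(k, l) \<in> avoiding (skel E) j"
    using l ne sym_skel[of E] jl by (auto simp: avoiding_def sym_def)
  have other: "S m k = 0" "S m l = 0" if m: "(m, j) \<in> E" "m \<noteq> l" for m
  proof -
    note md = dag_bound[OF dag m(1)]
    have jm: "(j, m) \<notin> E\<^sup>*" by (rule dag_asym[OF dag m(1)])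
    have sep: "(m, l) \<notin> (avoiding (skel E) j)\<^sup>*"
      using neighbours_separated[OF acyc sym_skel skel_parent[OF m(1)] skel_parent[OF l(1)] m(2)] .
    have "(u, k) \<notin> E\<^sup>*" if "(u, m) \<in> E\<^sup>*" for u
      using sep common_ancestor_avoiding[OF that jm _ jk] kl by (meson rtrancl_into_rtrancl)
    then show "S m k = 0"
      using md kd by (intro cov_zero_if_no_common_ancestor[OF dag lc]) auto
    have "(u, l) \<notin> E\<^sup>*" if "(u, m) \<in> E\<^sup>*" for u
      using sep common_ancestor_avoiding[OF that jm _ jl] by blast
    then show "S m l = 0"
      using md ljd by (intro cov_zero_if_no_common_ancestor[OF dag lc]) auto
  qed
  have fin: "finite (parents E j)" and lp: "l \<in> parents E j"
    using finite_parents[OF dag] l by (auto simp: parents_def)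
  have "S j k = (\<Sum>m\<in>parents E j. c m * S m k)"
    using c kd ne jk by (auto simp: rtrancl_eq_or_trancl)
  also have "\<dots> = c l * S l k"
    using other by (intro sum_single[OF fin lp]) (auto simp: parents_def)
  finally have 1: "S j k = c l * S l k" .
  have "S j l = (\<Sum>m\<in>parents E j. c m * S m l)"
    using c ljd jl by (auto simp: rtrancl_eq_or_trancl)
  also have "\<dots> = c l * S l l"
    using other by (intro sum_single[OF fin lp]) (auto simp: parents_def)
  finally show ?thesis using 1 by simp
qed

lemma noncollider_partial_zero:
  assumes dag: "dag d E" and acyc: "\<not> has_undirected_cycle (skel E)" and lc: "local_cov d E S"
    and sym: "\<And>i j. i < d \<Longrightarrow> j < d \<Longrightarrow> S i j = S j i"
    and ne: "j \<noteq> k" and l: "(j, l) \<in> skel E" "(k, l) \<in> skel E" "\<not> ((j, l) \<in> E \<and> (k, l) \<in> E)"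
  shows "S j k * S l l = S j l * S l k"
proof -
  have b: "j < d" "k < d" "l < d" using l dag_bound[OF dag] by (auto simp: skel_def)
  have s: "(l, k) \<in> skel E" "(l, j) \<in> skel E" using l by (auto simp: skel_def)
  consider "(l, j) \<in> E" | "(l, k) \<in> E" using l by (auto simp: skel_def)
  then show ?thesis
  proof cases
    case 1
    then show ?thesis using noncollider_partial_zero_aux[OF dag acyc lc ne] s by blast
  next
    case 2
    then have "S k j * S l l = S k l * S l j"
      using noncollider_partial_zero_aux[OF dag acyc lc, of k j l] ne s by blast
    then show ?thesis using sym b by (metis mult.commute)
  qed
qed

section \<open>Markov equivalence\<close>

text \<open>The law of independent standard normal variables, except that variable \<open>l\<close>
  is the sum of the \<open>w i * x i\<close> and a standard normal noise. Its covariances are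
  explicit, which makes it a test distribution for Markov equivalence.\<close>

lemma single_equation_model:
  assumes dag: "dag d E" and l: "l < d" and w: "\<And>i. w i \<noteq> 0 \<Longrightarrow> i \<in> parents E l"
  obtains S K C where "0 < C" "pd_on {..<d} S" "precision {..<d} S K"
    "markov_density d E (\<lambda>x. C * exp (- bil {..<d} K x x / 2))"
    "\<And>i j. S i j = (if i = l \<and> j = l then 1 + (\<Sum>i\<in>{..<d} - {l}. (w i)\<^sup>2)
       else if i = l then w j else if j = l then w i else of_bool (i = j))"
proof -
  define A where "A = {..<d} - {l}"
  have A: "finite A" "l \<notin> A" "{..<d} = insert l A" using l by (auto simp: A_def)
  define S :: "nat \<Rightarrow> nat \<Rightarrow> real" where "S i j = (if i = l \<and> j = l then 1 + (\<Sum>i\<in>A. (w i)\<^sup>2)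
       else if i = l then w j else if j = l then w i else of_bool (i = j))" for i j
  have quadA: "bil A K x x = (\<Sum>i\<in>A. (x i)\<^sup>2)"
    if "\<And>i j. i \<in> A \<Longrightarrow> j \<in> A \<Longrightarrow> K i j = of_bool (i = j)" for K x
  proof -
    have "bil A K x x = (\<Sum>i\<in>A. \<Sum>j\<in>A. if j = i then x i * x i else 0)"
      unfolding bil_def using that by (intro sum.cong) auto
    then show ?thesis using A(1) by (simp add: power2_eq_square)
  qed
  have "S i j = of_bool (i = j)" if "i \<in> A" "j \<in> A" for i j
    using that A(2) by (auto simp: S_def)
  then have SA: "bil A S x x = (\<Sum>i\<in>A. (x i)\<^sup>2)" for x by (rule quadA)
  have Sl: "(\<Sum>j\<in>A. S l j * x j) = (\<Sum>j\<in>A. w j * x j)" "(\<Sum>j\<in>A. x j * S j l) = (\<Sum>j\<in>A. w j * x j)" for x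
    using A(2) by (auto intro!: sum.cong simp: S_def)
  have var: "bil (insert l A) S x x = (\<Sum>i\<in>A. (x i + w i * x l)\<^sup>2) + (x l)\<^sup>2" for x
    unfolding bil_insert[OF A(1,2)] SA Sl
    by (simp add: S_def power2_sum sum.distrib algebra_simps sum_distrib_left power_mult_distrib power2_eq_square)
  have pd: "pd_on (insert l A) S"
    unfolding pd_on_def
  proof (intro conjI ballI allI impI)
    fix x :: "nat \<Rightarrow> real" assume "\<exists>i\<in>insert l A. x i \<noteq> 0"
    then obtain i where i: "i \<in> insert l A" "x i \<noteq> 0" by blast
    show "0 < bil (insert l A) S x x"
    proof (cases "x l = 0")
      case True
      then have "i \<in> A" using i by auto
      then have "0 < (\<Sum>i\<in>A. (x i + w i * x l)\<^sup>2)" using A(1) i True by (intro sum_pos2[of _ i]) auto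
      then show ?thesis unfolding var by (simp add: add_pos_nonneg)
    next
      case False
      then show ?thesis unfolding var by (simp add: add_nonneg_pos sum_nonneg)
    qed
  qed (auto simp: S_def)
  have idp: "precision A S (\<lambda>i j. of_bool (i = j))"
  proof -
    have "(\<Sum>k\<in>A. S i k * of_bool (k = j)) = (if i = j then 1 else 0)" if "i \<in> A" "j \<in> A" for i j
    proof -
      have "(\<Sum>k\<in>A. S i k * of_bool (k = j)) = (\<Sum>k\<in>A. if k = j then S i k else 0)"
        by (intro sum.cong) auto
      also have "\<dots> = S i j" using A(1) that by simp
      finally show ?thesis using that A(2) by (auto simp: S_def)
    qed
    then show ?thesis by (auto simp: precision_def)
  qed
  obtain K \<beta> D where K: "precision (insert l A) S K" and
    quad: "\<And>x. bil (insert l A) K x x = bil A (\<lambda>i j. of_bool (i = j)) x x + (x l - (\<Sum>i\<in>A. \<beta> i * x i))\<^sup>2 / D"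
    and \<beta>: "\<And>i. \<beta> i = (\<Sum>j\<in>A. of_bool (i = j) * S j l)" and D: "D = S l l - (\<Sum>i\<in>A. \<beta> i * S i l)"
    by (rule precision_insert[OF A(1,2) pd idp]) (rule that)
  have \<beta>w: "\<beta> i = w i" if "i \<in> A" for i
  proof -
    have "\<beta> i = (\<Sum>j\<in>A. if j = i then S j l else 0)" unfolding \<beta> by (intro sum.cong) auto
    then show ?thesis using A(1,2) that by (auto simp: S_def)
  qed
  have "(\<Sum>i\<in>A. \<beta> i * S i l) = (\<Sum>i\<in>A. (w i)\<^sup>2)"
    using A(2) by (intro sum.cong) (auto simp: \<beta>w S_def power2_eq_square)
  then have D1: "D = 1" unfolding D by (simp add: S_def)
  have K2: "bil {..<d} K x x = (\<Sum>i\<in>A. (x i)\<^sup>2) + (x l - (\<Sum>i\<in>A. w i * x i))\<^sup>2" for x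
    unfolding A(3) quad D1 using quadA[of "\<lambda>i j. of_bool (i = j)" x] by (simp add: \<beta>w cong: sum.cong)
  define g where "g k x = normal_density (if k = l then \<Sum>i\<in>A. w i * x i else 0) 1 (x k)" for k x
  define C :: real where "C = (1 / sqrt (2 * pi)) ^ d"
  have "markov_kernels d E g"
    unfolding markov_kernels_def
  proof (intro allI impI conjI)
    fix k assume k: "k < d"
    show "g k \<in> borel_measurable (Rd d)"
      using k unfolding g_def normal_density_def A_def by (cases "k = l") (auto, measurable)
    show "0 \<le> g k x" for x by (simp add: g_def)
    show "g k x = g k y" if xy: "\<forall>i\<in>insert k (parents E k). x i = y i" for x y
    proof (cases "k = l")
      case True
      have "(\<Sum>i\<in>A. w i * x i) = (\<Sum>i\<in>A. w i * y i)"
        using xy w True by (intro sum.cong) auto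
      then show ?thesis using xy by (simp add: g_def)
    qed (use xy in \<open>simp add: g_def\<close>)
    show "(\<integral>\<^sup>+ t. ennreal (g k (x(k := t))) \<partial>lborel) = 1" for x
    proof -
      have "(\<Sum>i\<in>A. w i * (x(l := t)) i) = (\<Sum>i\<in>A. w i * x i)" for t
        using A(2) by (intro sum.cong) auto
      then have "g k (x(k := t)) = normal_density (if k = l then \<Sum>i\<in>A. w i * x i else 0) 1 t" for t
        by (simp add: g_def)
      then have "(\<integral>\<^sup>+ t. ennreal (g k (x(k := t))) \<partial>lborel)
        = emeasure (density lborel (normal_density (if k = l then \<Sum>i\<in>A. w i * x i else 0) 1)) UNIV"
        by (simp add: emeasure_density)
      also have "\<dots> = 1"
        using prob_space.emeasure_space_1[OF prob_space_normal_density[of 1]] by simp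
      finally show ?thesis .
    qed
  qed
  moreover have "C * exp (- bil {..<d} K x x / 2) = (\<Prod>k<d. g k x)" for x
  proof -
    have "(\<Prod>k<d. g k x) = (\<Prod>k<d. 1 / sqrt (2 * pi) *
        exp (- (x k - (if k = l then \<Sum>i\<in>A. w i * x i else 0))\<^sup>2 / 2))"
      by (simp add: g_def normal_density_def)
    also have "\<dots> = C * exp (\<Sum>k<d. - (x k - (if k = l then \<Sum>i\<in>A. w i * x i else 0))\<^sup>2 / 2)"
      unfolding prod.distrib C_def by (simp add: exp_sum)
    also have "(\<Sum>k<d. - (x k - (if k = l then \<Sum>i\<in>A. w i * x i else 0))\<^sup>2 / 2) = - bil {..<d} K x x / 2"
    proof -
      have "(\<Sum>k\<in>A. - (x k - (if k = l then \<Sum>i\<in>A. w i * x i else 0))\<^sup>2 / 2) = - (\<Sum>k\<in>A. (x k)\<^sup>2) / 2"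
        unfolding sum_negf[symmetric] sum_divide_distrib using A(2) by (intro sum.cong) auto
      then show ?thesis unfolding K2 unfolding A(3) using A(1,2) by (simp add: field_simps)
    qed
    finally show ?thesis by simp
  qed
  ultimately have "markov_density d E (\<lambda>x. C * exp (- bil {..<d} K x x / 2))"
    unfolding markov_density_iff by (intro exI[of _ g]) auto
  moreover have "0 < C" by (simp add: C_def)
  moreover have "pd_on {..<d} S" "precision {..<d} S K" using pd K by (simp_all only: A(3))
  ultimately show thesis
    by (intro that[of C S K]) (simp_all add: S_def A_def)
qed

lemma local_cov_of_markov:
  assumes "dag d E" "markov_density d E (\<lambda>x. C * exp (- bil {..<d} K x x / 2))"
    "pd_on {..<d} S" "precision {..<d} S K" "0 < C"
  shows "local_cov d E S"
  unfolding local_cov_def using local_markov_covariance[OF assms] by blast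

text \<open>A model built along \<open>E\<close> must also obey the covariance identities of the
  equivalent DAG \<open>E'\<close>; the contradictions below come from this tension.\<close>

lemma markov_equiv_model:
  assumes eq: "markov_equiv d E E'" and l: "l < d" and w: "\<And>i. w i \<noteq> 0 \<Longrightarrow> i \<in> parents E l"
  obtains S where "local_cov d E' S"
    "\<And>i j. S i j = (if i = l \<and> j = l then 1 + (\<Sum>i\<in>{..<d} - {l}. (w i)\<^sup>2)
       else if i = l then w j else if j = l then w i else of_bool (i = j))"
proof -
  have dag: "dag d E" "dag d E'" using eq by (auto simp: markov_equiv_def)
  obtain S K C where *: "0 < C" "pd_on {..<d} S" "precision {..<d} S K"
    "markov_density d E (\<lambda>x. C * exp (- bil {..<d} K x x / 2))"
    and S: "\<And>i j. S i j = (if i = l \<and> j = l then 1 + (\<Sum>i\<in>{..<d} - {l}. (w i)\<^sup>2)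
       else if i = l then w j else if j = l then w i else of_bool (i = j))"
    by (rule single_equation_model[where w=w, OF dag(1) l w]) (simp, rule that)
  have "markov_density d E' (\<lambda>x. C * exp (- bil {..<d} K x x / 2))"
    using *(4) eq by (simp add: markov_equiv_def)
  then have "local_cov d E' S" using local_cov_of_markov[OF dag(2)] * by blast
  then show thesis using S by (rule that)
qed

lemma markov_equiv_sym: "markov_equiv d E E' \<Longrightarrow> markov_equiv d E' E"
  by (auto simp: markov_equiv_def)

lemma markov_equiv_trans: "markov_equiv d E E' \<Longrightarrow> markov_equiv d E' E'' \<Longrightarrow> markov_equiv d E E''"
  by (auto simp: markov_equiv_def)

text \<open>In the model where \<open>b\<close> equals \<open>a\<close> plus noise, \<open>a\<close>
  and \<open>b\<close> have covariance 1 and all other vertices are uncorrelated with both. If they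
  were nonadjacent in \<open>E'\<close>, the one that is not an ancestor of the other would regress
  on parents uncorrelated with the other, and the covariance would be 0.\<close>

lemma markov_equiv_edge:
  assumes eq: "markov_equiv d E E'" and e: "(a, b) \<in> E"
  shows "(a, b) \<in> skel E'"
proof (rule ccontr)
  assume na: "(a, b) \<notin> skel E'"
  have dag: "dag d E" "dag d E'" using eq by (auto simp: markov_equiv_def)
  have ab: "a < d" "b < d" using dag_bound[OF dag(1) e] by auto
  have ne: "a \<noteq> b" using dag_irrefl[OF dag(1), of a] e by auto
  obtain S where lc: "local_cov d E' S" and
    S: "\<And>i j. S i j = (if i = b \<and> j = b then 1 + (\<Sum>i\<in>{..<d} - {b}. (of_bool (i = a))\<^sup>2)
       else if i = b then of_bool (j = a) else if j = b then of_bool (i = a) else of_bool (i = j))"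
    by (rule markov_equiv_model[where w="\<lambda>i. of_bool (i = a)", OF eq ab(2)])
      (use e in \<open>auto simp: parents_def\<close>)
  have par: "i \<noteq> a \<and> i \<noteq> b" if "i \<in> parents E' a \<or> i \<in> parents E' b" for i
    using that na dag_not_parent_self[OF dag(2)] by (auto simp: skel_def parents_def)
  have "(b, a) \<notin> E'\<^sup>+ \<or> (a, b) \<notin> E'\<^sup>+" using dag_irrefl[OF dag(2)] by (meson trancl_trans)
  then show False
  proof
    assume "(b, a) \<notin> E'\<^sup>+"
    then obtain c where "S b a = (\<Sum>i\<in>parents E' b. c i * S i a)"
      using lc ab ne unfolding local_cov_def by metis
    also have "\<dots> = 0" using par ne by (intro sum.neutral) (auto simp: S)
    finally show False using ne by (simp add: S)
  next
    assume "(a, b) \<notin> E'\<^sup>+"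
    then obtain c where "S a b = (\<Sum>i\<in>parents E' a. c i * S i b)"
      using lc ab ne unfolding local_cov_def by metis
    also have "\<dots> = 0" using par ne by (intro sum.neutral) (auto simp: S)
    finally show False using ne by (simp add: S)
  qed
qed

lemma markov_equiv_skel: "markov_equiv d E E' \<Longrightarrow> skel E = skel E'"
  using markov_equiv_edge[of d E E'] markov_equiv_edge[of d E' E] markov_equiv_sym[of d E E']
  unfolding skel_def by fast

text \<open>In the model where \<open>l\<close> equals \<open>j\<close> plus \<open>k\<close> plus
  noise, \<open>j\<close> and \<open>k\<close> are uncorrelated but both correlated with
  \<open>l\<close>. If \<open>l\<close> were a parent of \<open>j\<close> in \<open>E'\<close>, the
  regression of \<open>j\<close> would reduce to the term of \<open>l\<close>: its coefficient must
  vanish because of \<open>k\<close>, and must not vanish because of \<open>l\<close>.\<close>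

lemma markov_equiv_collider_aux:
  assumes eq: "markov_equiv d E E'" and e: "(j, l) \<in> E" "(k, l) \<in> E" "j \<noteq> k" "(j, k) \<notin> skel E"
    and lj: "(l, j) \<in> E'"
  shows False
proof -
  have dag: "dag d E" "dag d E'" using eq by (auto simp: markov_equiv_def)
  have b: "j < d" "k < d" "l < d" using dag_bound[OF dag(1)] e by auto
  have ne: "j \<noteq> l" "k \<noteq> l" using dag_irrefl[OF dag(1)] e by auto
  have sk: "skel E' = skel E" using markov_equiv_skel[OF eq] by simp
  define w :: "nat \<Rightarrow> real" where "w i = (if i = j \<or> i = k then 1 else 0)" for i
  obtain S where lc: "local_cov d E' S" and
    S: "\<And>i j. S i j = (if i = l \<and> j = l then 1 + (\<Sum>i\<in>{..<d} - {l}. (w i)\<^sup>2)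
       else if i = l then w j else if j = l then w i else of_bool (i = j))"
    by (rule markov_equiv_model[where w=w, OF eq b(3)])
      (use e in \<open>auto simp: parents_def w_def split: if_splits\<close>)
  have Sll: "S l l > 0" by (simp add: S add_pos_nonneg sum_nonneg)
  have key: False if m: "{m, n} = {j, k}" "m \<noteq> n" "(l, m) \<in> E'" "(m, n) \<notin> E'\<^sup>+" for m n
  proof -
    have mn: "m < d" "n < d" "m \<noteq> l" "n \<noteq> l" "S m n = 0" "S m l = 1" "S l n = 1" "(m, n) \<notin> skel E'"
      using m(1,2) b ne e(3,4) sym_skel[of E] unfolding sk
      by (auto simp: S w_def doubleton_eq_iff sym_def)
    have ml: "(m, l) \<notin> E'\<^sup>+" using dag_asym[OF dag(2) m(3)] by (auto simp: rtrancl_eq_or_trancl)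
    obtain c where c: "\<And>i. i < d \<Longrightarrow> i \<noteq> m \<Longrightarrow> (m, i) \<notin> E'\<^sup>+ \<Longrightarrow> S m i = (\<Sum>p\<in>parents E' m. c p * S p i)"
      using local_covE[OF lc mn(1)] by blast
    have fin: "finite (parents E' m)" and lp: "l \<in> parents E' m"
      using finite_parents[OF dag(2)] m(3) by (auto simp: parents_def)
    have par: "p \<noteq> m \<and> p \<noteq> n" if "p \<in> parents E' m" for p
      using that mn(8) dag_not_parent_self[OF dag(2)] by (auto simp: skel_def parents_def)
    have other: "S p n = 0 \<and> S p l = 0" if "p \<in> parents E' m" "p \<noteq> l" for p
      using par[OF that(1)] that(2) m(1) mn(4) by (auto simp: S w_def)
    have "S m n = (\<Sum>p\<in>parents E' m. c p * S p n)" using c mn m by blast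
    also have "\<dots> = c l * S l n" using other by (intro sum_single[OF fin lp]) auto
    finally have "c l = 0" using mn by simp
    moreover have "S m l = (\<Sum>p\<in>parents E' m. c p * S p l)" using c[of l] b mn ml by auto
    then have "S m l = c l * S l l" using other by (subst (asm) sum_single[OF fin lp]) auto
    ultimately show False using mn Sll by simp
  qed
  have acy: "(j, k) \<in> E'\<^sup>+ \<Longrightarrow> (k, j) \<notin> E'\<^sup>+" using dag_irrefl[OF dag(2)] by (meson trancl_trans)
  show False
  proof (cases "(j, k) \<in> E'\<^sup>+")
    case False
    then show False using key[of j k] e lj by auto
  next
    case True
    \<comment> \<open>The argument of \<open>key\<close> needs \<open>k\<close> to be a
      nondescendant of \<open>j\<close>. If it is a descendant, the edge between \<open>l\<close>
      and \<open>k\<close> also points away from \<open>l\<close>, and the roles of \<open>j\<close>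
      and \<open>k\<close> can be exchanged.\<close>
    then have "(l, k) \<in> E'\<^sup>+" using lj by (rule trancl_into_trancl2[rotated])
    moreover have "(k, l) \<in> skel E'" using e(2) unfolding sk by (auto simp: skel_def)
    ultimately have "(l, k) \<in> E'" using dag_asym[OF dag(2), of k l] by (auto simp: skel_def dest: trancl_into_rtrancl)
    then show False using key[of k j] e acy[OF True] by auto
  qed
qed

lemma markov_equiv_collider:
  assumes "markov_equiv d E E'" "(j, l) \<in> E" "(k, l) \<in> E" "j \<noteq> k" "(j, k) \<notin> skel E"
  shows "(j, l) \<in> E'"
  using markov_equiv_collider_aux[OF assms] markov_equiv_edge[OF assms(1,2)] by (auto simp: skel_def)

section \<open>Reversing an edge between a source and its single-parent child\<close>

definition reverse_edge :: "nat \<Rightarrow> nat \<Rightarrow> (nat \<times> nat) set \<Rightarrow> (nat \<times> nat) set" where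
  "reverse_edge r s E = insert (s, r) (E - {(r, s)})"

context
  fixes d E r s
  assumes dag: "dag d E" and rs: "(r, s) \<in> E" and pr: "parents E r = {}" and ps: "parents E s = {r}"
begin

lemma rs_bound: "r < d" "s < d" "r \<noteq> s"
  using dag_bound[OF dag rs] dag_irrefl[OF dag, of r] rs by auto

lemma parents_reverse_edge:
  "parents (reverse_edge r s E) k = (if k = r then {s} else if k = s then {} else parents E k)"
  using pr ps rs_bound(3) by (auto simp: parents_def reverse_edge_def)

lemma dag_reverse_edge: "dag d (reverse_edge r s E)"
proof -
  have "(r, s) \<notin> (E - {(r, s)})\<^sup>*"
  proof
    assume "(r, s) \<in> (E - {(r, s)})\<^sup>*"
    then obtain z where "(z, s) \<in> E - {(r, s)}" using rs_bound(3) by (meson rtranclE)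
    then show False using ps by (auto simp: parents_def)
  qed
  moreover have "acyclic (E - {(r, s)})" using dag acyclic_subset[of E] by (auto simp: dag_def)
  ultimately show ?thesis using dag rs_bound by (auto simp: dag_def reverse_edge_def acyclic_insert)
qed

lemma markov_density_reverse_edge:
  assumes "markov_density d E f"
  shows "markov_density d (reverse_edge r s E) f"
proof -
  obtain g where g: "markov_kernels d E g" and fg: "AE x in Rd d. f x = (\<Prod>k<d. g k x)"
    using assms by (auto simp: markov_density_iff)
  note r = rs_bound(1) and s = rs_bound(2) and ne = rs_bound(3)
  have r': "r \<in> {..<d}" and s': "s \<in> {..<d}" using r s by auto
  have gm[measurable]: "g r \<in> borel_measurable (Rd d)" "g s \<in> borel_measurable (Rd d)"
    and g0: "0 \<le> g r x" "0 \<le> g s x"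
    and gr1: "(\<integral>\<^sup>+ t. ennreal (g r (x(r := t))) \<partial>lborel) = 1"
    and gs1: "(\<integral>\<^sup>+ t. ennreal (g s (x(s := t))) \<partial>lborel) = 1" for x
    using g r s by (auto simp: markov_kernels_def)
  have grl: "g r x = g r y" if "x r = y r" for x y
    using g r pr that unfolding markov_kernels_def by (metis insertE empty_iff)
  have gsl: "g s x = g s y" if "x s = y s" "x r = y r" for x y
    using g s ps that unfolding markov_kernels_def by (metis insertE empty_iff)
  \<comment> \<open>The marginal density of \<open>s\<close>, a function of \<open>x s\<close>
    alone. It is kept in \<open>ennreal\<close> since it may be infinite on a null set.\<close>
  define M where "M x = (\<integral>\<^sup>+ u. ennreal (g r (x(r := u)) * g s (x(r := u))) \<partial>lborel)" for x
  have M_local: "M x = M y" if "x s = y s" for x y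
    unfolding M_def using that
    by (intro nn_integral_cong arg_cong[where f=ennreal] arg_cong2[where f="(*)"] grl gsl) auto
  have Mr: "M (x(r := t)) = M x" for x t using ne by (intro M_local) auto
  have Mm[measurable]: "M \<in> borel_measurable (Rd d)"
    unfolding M_def using r' by measurable
  \<comment> \<open>The kernel conditions range over all functions \<open>x\<close>, measurability
    only over points of the product space. As \<open>M\<close> and the two kernels depend on
    \<open>x s\<close> and \<open>x r\<close> only, such an \<open>x\<close> may be exchanged for
    its restriction.\<close>
  have restr: "\<exists>y \<in> space (Rd d). y s = x s \<and> y r = x r" for x :: "nat \<Rightarrow> real"
    using r s by (intro bexI[of _ "restrict x {..<d}"]) (auto simp: space_PiM)
  have M1: "(\<integral>\<^sup>+ t. M (x(s := t)) \<partial>lborel) = 1" for x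
  proof -
    obtain y where y: "y \<in> space (Rd d)" "y s = x s" "y r = x r" using restr by blast
    have m1: "(\<lambda>(t, u). y(s := t, r := u)) \<in> lborel \<Otimes>\<^sub>M lborel \<rightarrow>\<^sub>M Rd d"
      unfolding split_beta' using y(1) r' s' by (intro measurable_upd) auto
    have m2: "(\<lambda>(t, u). ennreal (g r (y(s := t, r := u)) * g s (y(s := t, r := u))))
       \<in> borel_measurable (lborel \<Otimes>\<^sub>M lborel)"
      using measurable_compose[OF m1, of "\<lambda>z. ennreal (g r z * g s z)" borel] by (simp add: split_beta')
    have "(\<integral>\<^sup>+ t. M (x(s := t)) \<partial>lborel) = (\<integral>\<^sup>+ t. M (y(s := t)) \<partial>lborel)"
      by (intro nn_integral_cong M_local) simp
    also have "\<dots> = (\<integral>\<^sup>+ t. (\<integral>\<^sup>+ u. ennreal (g r (y(s := t, r := u)) * g s (y(s := t, r := u))) \<partial>lborel) \<partial>lborel)"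
      by (simp add: M_def)
    also have "\<dots> = (\<integral>\<^sup>+ u. (\<integral>\<^sup>+ t. ennreal (g r (y(s := t, r := u)) * g s (y(s := t, r := u))) \<partial>lborel) \<partial>lborel)"
      using lborel_pair.Fubini'[OF m2] by simp
    also have "\<dots> = (\<integral>\<^sup>+ u. ennreal (g r (y(r := u))) \<partial>lborel)"
    proof (intro nn_integral_cong)
      fix u
      have m3: "(\<lambda>t. ennreal (g s (y(r := u, s := t)))) \<in> borel_measurable lborel"
      proof -
        have "(\<lambda>t. y(r := u, s := t)) \<in> lborel \<rightarrow>\<^sub>M Rd d"
          by (rule measurable_upd[OF s' measurable_const[OF upd_space_lb'[OF r' y(1)]]]) simp
        then show ?thesis using measurable_compose[OF _ gm(2)] by auto
      qed
      have "(\<integral>\<^sup>+ t. ennreal (g r (y(s := t, r := u)) * g s (y(s := t, r := u))) \<partial>lborel)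
        = (\<integral>\<^sup>+ t. ennreal (g r (y(r := u))) * ennreal (g s (y(r := u, s := t))) \<partial>lborel)"
        using ne grl[of "y(s := _, r := u)" "y(r := u)"]
        by (simp add: fun_upd_twist ennreal_mult g0)
      also have "\<dots> = ennreal (g r (y(r := u)))"
        using nn_integral_cmult[OF m3] gs1 by simp
      finally show "(\<integral>\<^sup>+ t. ennreal (g r (y(s := t, r := u)) * g s (y(s := t, r := u))) \<partial>lborel)
        = ennreal (g r (y(r := u)))" .
    qed
    finally show ?thesis using gr1 by simp
  qed
  have Msm: "(\<lambda>t. M (x(s := t))) \<in> borel_measurable lborel" for x
  proof -
    obtain y where y: "y \<in> space (Rd d)" using restr by blast
    have "(\<lambda>t. M (y(s := t))) \<in> borel_measurable lborel"
      using y s' by (intro measurable_compose[OF _ Mm] measurable_upd) auto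
    moreover have "(\<lambda>t. M (y(s := t))) = (\<lambda>t. M (x(s := t)))" by (intro ext M_local) simp
    ultimately show ?thesis by simp
  qed
  have Mfin: "AE t in lborel. M (x(s := t)) \<noteq> \<infinity>" for x
    using M1[of x] Msm[of x] by (intro nn_integral_PInf_AE) auto
  \<comment> \<open>Where \<open>M\<close> is 0 or infinite, some probability density in
    \<open>x r\<close> must replace the Bayes quotient; \<open>g r\<close> serves.\<close>
  define h where "h k x = (if k = s then enn2real (M x)
     else if k = r then (if 0 < M x \<and> M x < \<infinity> then g r x * g s x / enn2real (M x) else g r x)
     else g k x)" for k x
  have "markov_kernels d (reverse_edge r s E) h"
    unfolding markov_kernels_def
  proof (intro allI impI, goal_cases)
    case (1 k)
    consider "k = s" | "k = r" | "k \<noteq> s" "k \<noteq> r" by blast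
    then show ?case
    proof cases
      case 1
      have norm: "(\<integral>\<^sup>+ t. ennreal (enn2real (M (x(s := t)))) \<partial>lborel) = 1" for x
      proof -
        have "(\<integral>\<^sup>+ t. ennreal (enn2real (M (x(s := t)))) \<partial>lborel) = (\<integral>\<^sup>+ t. M (x(s := t)) \<partial>lborel)"
          by (intro nn_integral_cong_AE eventually_mono[OF Mfin[of x]]) (simp add: less_top)
        then show ?thesis using M1 by simp
      qed
      have hs: "h s = (\<lambda>x. enn2real (M x))" by (simp add: h_def[abs_def])
      have loc: "h s x = h s y" if "x s = y s" for x y
        unfolding hs using M_local[of x y, OF that] by simp
      have meas: "h s \<in> borel_measurable (Rd d)" unfolding hs by measurable
      have nonneg: "0 \<le> h s x" for x by (simp add: hs)
      have ins: "insert s (parents (reverse_edge r s E) s) = {s}"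
        using ne by (simp add: parents_reverse_edge)
      have norm': "(\<integral>\<^sup>+ t. ennreal (h s (x(s := t))) \<partial>lborel) = 1" for x
        unfolding hs by (rule norm)
      show ?thesis
        unfolding 1 ins by (intro conjI allI impI meas nonneg norm' loc) simp
    next
      case 2
      have hr: "h r = (\<lambda>x. if 0 < M x \<and> M x < \<infinity> then g r x * g s x / enn2real (M x) else g r x)"
        using ne by (auto simp: h_def)
      have norm: "(\<integral>\<^sup>+ t. ennreal (h r (x(r := t))) \<partial>lborel) = 1" for x
      proof (cases "0 < M x \<and> M x < \<infinity>")
        case True
        then obtain m where m: "M x = ennreal m" "0 < m" by (cases "M x") auto
        have "(\<lambda>t. ennreal (g r (x(r := t)) * g s (x(r := t)))) \<in> borel_measurable lborel"
        proof -
          obtain y where y: "y \<in> space (Rd d)" "y s = x s" "y r = x r" using restr by blast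
          have "(\<lambda>t. y(r := t)) \<in> lborel \<rightarrow>\<^sub>M Rd d" using y(1) r' by (intro measurable_upd) auto
          then have "(\<lambda>t. ennreal (g r (y(r := t)) * g s (y(r := t)))) \<in> borel_measurable lborel"
            by measurable
          moreover have "g r (y(r := t)) = g r (x(r := t))" for t by (rule grl) simp
          moreover have "g s (y(r := t)) = g s (x(r := t))" for t by (rule gsl) (use y in auto)
          ultimately show ?thesis by simp
        qed
        then have "(\<integral>\<^sup>+ t. ennreal (1 / m) * ennreal (g r (x(r := t)) * g s (x(r := t))) \<partial>lborel)
          = ennreal (1 / m) * M x"
          unfolding M_def by (rule nn_integral_cmult)
        also have "\<dots> = 1" using m by (simp add: ennreal_mult[symmetric])
        finally show ?thesis
          using m by (simp add: hr Mr ennreal_mult[symmetric] g0)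
      next
        case False
        then show ?thesis using gr1[of x] by (simp only: hr Mr if_False)
      qed
      have meas: "h r \<in> borel_measurable (Rd d)" unfolding hr by measurable
      have nonneg: "0 \<le> h r x" for x using g0 by (simp add: hr)
      have loc: "h r x = h r y" if "x r = y r" "x s = y s" for x y
        unfolding hr using grl[of x y, OF that(1)] gsl[of x y, OF that(2,1)] M_local[of x y, OF that(2)] by simp
      have ins: "insert r (parents (reverse_edge r s E) r) = {r, s}"
        by (simp add: parents_reverse_edge)
      show ?thesis
        unfolding 2 ins by (intro conjI allI impI meas nonneg norm loc) simp_all
    next
      case 3
      then have "h k = g k" "parents (reverse_edge r s E) k = parents E k"
        by (auto simp: h_def[abs_def] parents_reverse_edge)
      then show ?thesis using g 1 unfolding markov_kernels_def by metis
    qed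
  qed
  moreover have "AE x in Rd d. f x = (\<Prod>k<d. h k x)"
  proof -
    have A1: "AE x in Rd d. M x \<noteq> \<infinity>"
      using Mfin by (intro AE_lb_updI[OF finite_lessThan s']) auto
    \<comment> \<open>A vanishing \<open>M\<close> forces the joint density to vanish for almost
      every \<open>x r\<close>, so the substitute kernel does not alter the product there.\<close>
    have A2: "AE x in Rd d. M x = 0 \<longrightarrow> g r x * g s x = 0"
    proof (rule AE_lb_updI[OF finite_lessThan r'])
      fix x assume x: "x \<in> space (Rd d)"
      show "AE t in lborel. M (x(r := t)) = 0 \<longrightarrow> g r (x(r := t)) * g s (x(r := t)) = 0"
      proof (cases "M x = 0")
        case True
        have "(\<lambda>t. x(r := t)) \<in> lborel \<rightarrow>\<^sub>M Rd d" using x r' by (intro measurable_upd) auto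
        then have "(\<lambda>t. ennreal (g r (x(r := t)) * g s (x(r := t)))) \<in> borel_measurable lborel"
          by measurable
        then have "AE t in lborel. ennreal (g r (x(r := t)) * g s (x(r := t))) = 0"
          using True by (simp add: M_def nn_integral_0_iff_AE)
        then show ?thesis by eventually_elim (metis g0 mult_nonneg_nonneg ennreal_eq_0_iff order_antisym)
      qed (simp add: Mr)
    qed measurable
    show ?thesis
      using fg A1 A2
    proof eventually_elim
      case (elim x)
      have hh: "h r x * h s x = g r x * g s x"
      proof (cases "M x = 0")
        case False
        then obtain m where "M x = ennreal m" "0 < m" using elim(2) by (cases "M x") auto
        then show ?thesis using ne by (simp add: h_def)
      qed (use elim ne in \<open>simp add: h_def\<close>)
      have split: "(\<Prod>k<d. u k) = u r * u s * (\<Prod>k\<in>{..<d} - {r} - {s}. u k)" for u :: "nat \<Rightarrow> real"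
        using r s ne prod.remove[of "{..<d}" r u] prod.remove[of "{..<d} - {r}" s u] by simp
      have "(\<Prod>k\<in>{..<d} - {r} - {s}. h k x) = (\<Prod>k\<in>{..<d} - {r} - {s}. g k x)"
        by (intro prod.cong) (auto simp: h_def)
      then show ?case using elim(1) split[of "\<lambda>k. h k x"] split[of "\<lambda>k. g k x"] hh by simp
    qed
  qed
  ultimately show ?thesis unfolding markov_density_iff by blast
qed

end

lemma markov_equiv_reverse_edge:
  assumes "dag d E" "(r, s) \<in> E" "parents E r = {}" "parents E s = {r}"
  shows "markov_equiv d E (reverse_edge r s E)"
proof -
  let ?E' = "reverse_edge r s E"
  note ne = rs_bound[OF assms]
  have "reverse_edge s r ?E' = E" using assms(2,3) ne by (auto simp: reverse_edge_def parents_def)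
  moreover have "dag d ?E'" by (rule dag_reverse_edge[OF assms])
  moreover have "(s, r) \<in> ?E'" by (simp add: reverse_edge_def)
  moreover have "parents ?E' s = {}" "parents ?E' r = {s}"
    using ne by (simp_all add: parents_reverse_edge[OF assms])
  ultimately show ?thesis
    using assms(1) markov_density_reverse_edge[OF assms] markov_density_reverse_edge[of d ?E' s r]
    by (auto simp: markov_equiv_def)
qed

section \<open>Orientation rules on polytrees\<close>

text \<open>Each step deletes a pair. Termination is needed because \<open>orient_results\<close>
  collects the outcomes of all orders and could otherwise be empty.\<close>

lemma meek_step_normal_form:
  "finite G \<Longrightarrow> \<exists>G'. meek_step\<^sup>*\<^sup>* G G' \<and> \<not> (\<exists>G''. meek_step G' G'')"
proof (induction "card G" arbitrary: G rule: less_induct)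
  case less
  show ?case
  proof (cases "\<exists>G''. meek_step G G''")
    case True
    then obtain G1 where G1: "meek_step G G1" by blast
    then have "finite G1" "card G1 < card G"
      using less(2) by (auto simp: meek_step_def meek_rule_def und_def intro!: psubset_card_mono)
    then obtain G' where "meek_step\<^sup>*\<^sup>* G1 G'" "\<not> (\<exists>G''. meek_step G' G'')"
      using less(1) by blast
    then show ?thesis using G1 by (meson converse_rtranclp_into_rtranclp)
  qed auto
qed

text \<open>Separates combinatorics from statistics: all that \<open>Orient\<close> needs from the
  tests is that the separating sets recognize colliders.\<close>

locale polytree_orientation =
  fixes d :: nat and T :: "(nat \<times> nat) set" and S :: "nat \<Rightarrow> nat \<Rightarrow> nat option set"
  assumes polytree: "polytree d T"
    and sepset: "\<And>j k l. j \<noteq> k \<Longrightarrow> (j, k) \<notin> skel T \<Longrightarrow> (j, l) \<in> skel T \<Longrightarrow> (k, l) \<in> skel T \<Longrightarrow>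
      Some l \<notin> S j k \<longleftrightarrow> (j, l) \<in> T \<and> (k, l) \<in> T"
begin

lemma dag: "dag d T" and forest: "\<not> has_undirected_cycle (skel T)"
  using polytree by (auto simp: polytree_def is_tree_def)

lemma skel_sym: "(a, b) \<in> skel T \<longleftrightarrow> (b, a) \<in> skel T"
  by (auto simp: skel_def)

lemma skel_irrefl: "(a, a) \<notin> skel T"
  using dag_irrefl[OF dag, of a] by (auto simp: skel_def)

lemma adj_skel: "adj (skel T) a b \<longleftrightarrow> (a, b) \<in> skel T"
  by (auto simp: adj_def skel_def)

lemma no_triangle:
  assumes "(a, b) \<in> skel T" "(b, c) \<in> skel T" "(a, c) \<in> skel T"
  shows False
proof -
  have "a \<noteq> b" "b \<noteq> c" "a \<noteq> c" using assms skel_irrefl by auto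
  then have "(a, c) \<in> avoiding (skel T) b" using assms(3) by (simp add: avoiding_def)
  moreover have "(a, c) \<notin> (avoiding (skel T) b)\<^sup>*"
    using assms skel_sym \<open>a \<noteq> c\<close> by (intro neighbours_separated[OF forest sym_skel]) auto
  ultimately show False by blast
qed

definition oriented_colliders :: "(nat \<times> nat) set" where
  "oriented_colliders = skel T - {(l, j). \<exists>k. j \<noteq> k \<and> (j, l) \<in> T \<and> (k, l) \<in> T}"

text \<open>Two parents of the same vertex of a polytree are never adjacent, so its v-structures are
  simply the pairs of distinct edges into a common vertex.\<close>

lemma orient_v_eq: "orient_v (skel T) S = oriented_colliders"
proof -
  have "(\<exists>k. j \<noteq> k \<and> (j, k) \<notin> skel T \<and> (j, l) \<in> skel T \<and> (k, l) \<in> skel T \<and> Some l \<notin> S j k)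
     \<longleftrightarrow> (\<exists>k. j \<noteq> k \<and> (j, l) \<in> T \<and> (k, l) \<in> T)" for l j
  proof
    assume "\<exists>k. j \<noteq> k \<and> (j, l) \<in> T \<and> (k, l) \<in> T"
    then obtain k where k: "j \<noteq> k" "(j, l) \<in> T" "(k, l) \<in> T" by blast
    then have "(j, l) \<in> skel T" "(l, k) \<in> skel T" "(k, l) \<in> skel T" by (auto simp: skel_def)
    moreover from this have "(j, k) \<notin> skel T" using no_triangle by blast
    ultimately show "\<exists>k. j \<noteq> k \<and> (j, k) \<notin> skel T \<and> (j, l) \<in> skel T \<and> (k, l) \<in> skel T \<and> Some l \<notin> S j k"
      using k sepset by blast
  qed (use sepset in blast)
  then show ?thesis by (simp add: orient_v_def oriented_colliders_def adj_skel)
qed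

lemma equiv_subset_oriented_colliders:
  assumes "markov_equiv d T E"
  shows "E \<subseteq> oriented_colliders"
proof
  fix e assume e: "e \<in> E"
  obtain l j where lj: "e = (l, j)" by (cases e)
  have dagE: "dag d E" using assms by (simp add: markov_equiv_def)
  have sk: "skel E = skel T" using markov_equiv_skel[OF assms] by simp
  have "False" if k: "j \<noteq> k" "(j, l) \<in> T" "(k, l) \<in> T" for k
  proof -
    have "(j, k) \<notin> skel T" using no_triangle[of j l k] k by (auto simp: skel_def)
    then have "(j, l) \<in> E" using markov_equiv_collider[OF assms k(2,3,1)] by blast
    then show False using dag_asym[OF dagE] e lj by blast
  qed
  then show "e \<in> oriented_colliders" using e sk by (auto simp: oriented_colliders_def lj skel_def)
qed

text \<open>The invariant of the Meek phase: no orientation occurring in some equivalent DAG has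
  been deleted.\<close>

definition sound :: "(nat \<times> nat) set \<Rightarrow> bool" where
  "sound G \<longleftrightarrow> G \<subseteq> oriented_colliders \<and> (\<forall>E. markov_equiv d T E \<longrightarrow> E \<subseteq> G)"

lemma equiv_refl: "markov_equiv d T T"
  using dag by (simp add: markov_equiv_def)

lemma sound_bounds:
  assumes "sound G" shows "T \<subseteq> G" "G \<subseteq> skel T" "adj G a b \<longleftrightarrow> (a, b) \<in> skel T"
proof -
  show *: "T \<subseteq> G" "G \<subseteq> skel T"
    using assms equiv_refl by (auto simp: sound_def oriented_colliders_def)
  then show "adj G a b \<longleftrightarrow> (a, b) \<in> skel T"
    by (auto simp: adj_def skel_def)
qed

text \<open>The rules R2, R3 and R4 need a triangle, so only R1 is ever applicable.\<close>

lemma meek_rule_R1: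
  assumes "sound G" "meek_rule G a b"
  obtains j where "dir G j a" "(j, b) \<notin> skel T" "j \<noteq> b"
proof -
  have U: "(x, y) \<in> skel T" if "dir G x y \<or> und G x y" for x y
    using that sound_bounds(2)[OF assms(1)] by (auto simp: dir_def und_def)
  have "und G a b" using assms(2) by (simp add: meek_rule_def)
  then have ab: "(a, b) \<in> skel T" using U by blast
  have "\<exists>j. dir G j a \<and> \<not> adj G j b \<and> j \<noteq> b"
    using assms(2) unfolding meek_rule_def
  proof (elim conjE disjE exE)
    fix l assume "dir G a l" "dir G l b"
    then show ?thesis using no_triangle[of a l b] U ab by blast
  next
    fix l i assume "und G a l" "dir G l b"
    then show ?thesis using no_triangle[of a l b] U ab by blast
  next
    fix l i assume "und G a l" "dir G l i" "adj G a i"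
    then show ?thesis using no_triangle[of a l i] U sound_bounds(3)[OF assms(1)] by blast
  qed blast
  then show thesis using that sound_bounds(3)[OF assms(1)] by blast
qed

text \<open>An equivalent DAG containing the deleted pair \<open>(b, a)\<close> would have a
  collider at \<open>a\<close> with parents \<open>b\<close> and \<open>j\<close>. Then
  \<open>T\<close> has it too, and the collider step would already have removed
  \<open>(a, b)\<close>.\<close>

lemma sound_meek_step:
  assumes "sound G" "meek_step G G'"
  shows "sound G'"
proof -
  obtain a b where r: "meek_rule G a b" and G': "G' = G - {(b, a)}"
    using assms(2) by (auto simp: meek_step_def)
  obtain j where j: "dir G j a" "(j, b) \<notin> skel T" "j \<noteq> b"
    using meek_rule_R1[OF assms(1) r] .
  have "(b, a) \<notin> E" if E: "markov_equiv d T E" for E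
  proof
    assume ba: "(b, a) \<in> E"
    have sub: "E \<subseteq> G" using E assms(1) by (simp add: sound_def)
    have sk: "skel E = skel T" using markov_equiv_skel[OF E] by simp
    have "(j, a) \<in> skel E" using j(1) sound_bounds(2)[OF assms(1)] sk by (auto simp: dir_def)
    then have ja: "(j, a) \<in> E" using sub j(1) by (auto simp: skel_def dir_def)
    have "(j, b) \<notin> skel E" "(b, j) \<notin> skel E" using j(2) skel_sym unfolding sk by auto
    then have "(b, a) \<in> T" "(j, a) \<in> T"
      using markov_equiv_collider[OF markov_equiv_sym[OF E]] ba ja j(3) by blast+
    then have "(a, b) \<notin> oriented_colliders" using j(3) by (auto simp: oriented_colliders_def)
    moreover have "(a, b) \<in> G" using r by (simp add: meek_rule_def und_def)
    ultimately show False using assms(1) by (auto simp: sound_def)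
  qed
  then show ?thesis using assms(1) by (auto simp: sound_def G')
qed

lemma sound_oriented_colliders: "sound oriented_colliders"
  by (simp add: sound_def equiv_subset_oriented_colliders)

text \<open>An undirected edge of a closed graph lies on a path of single-parent vertices starting at a
  source of \<open>T\<close>; reversing this path edge by edge keeps the Markov equivalence class.\<close>

lemma reroot:
  assumes G: "sound G" and closed: "\<not> (\<exists>G'. meek_step G G')"
  shows "(a, b) \<in> T \<Longrightarrow> (b, a) \<in> G \<Longrightarrow> \<exists>E. markov_equiv d T E \<and> parents E a = {} \<and>
     (\<forall>w. (w, a) \<notin> T\<^sup>* \<longrightarrow> parents E w = parents T w)"
proof (induction a arbitrary: b rule: wf_induct_rule[OF dag_wf[OF dag]])
  case (1 a)
  show ?case
  proof (cases "parents T a = {}")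
    case True
    then show ?thesis using equiv_refl by blast
  next
    case False
    then obtain u where u: "(u, a) \<in> T" by (auto simp: parents_def)
    have Gu: "(u, a) \<in> G" using u sound_bounds(1)[OF G] by blast
    have und_ab: "und G a b" using 1(2,3) sound_bounds(1)[OF G] by (auto simp: und_def)
    have ub: "u \<noteq> b" using 1(2) u dag_asym[OF dag] by blast
    have "(u, b) \<notin> skel T" using no_triangle[of u a b] u 1(2) by (auto simp: skel_def)
    then have "\<not> adj G u b" using sound_bounds(3)[OF G] by blast
    \<comment> \<open>Otherwise the edge from \<open>u\<close> to \<open>a\<close> would be directed
      and R1 would apply to \<open>a\<close> and \<open>b\<close>.\<close>
    then have au: "(a, u) \<in> G"
      using closed und_ab ub Gu unfolding meek_step_def meek_rule_def dir_def by blast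
    \<comment> \<open>The pair \<open>(a, u)\<close> survived the collider step, so \<open>a\<close>
      has no second parent.\<close>
    have pa: "parents T a = {u}"
      using u au G by (auto simp: parents_def sound_def oriented_colliders_def)
    obtain E where E: "markov_equiv d T E" "parents E u = {}"
      "\<And>w. (w, u) \<notin> T\<^sup>* \<Longrightarrow> parents E w = parents T w"
      using 1(1)[OF u u au] by blast
    have dagE: "dag d E" using E(1) by (simp add: markov_equiv_def)
    \<comment> \<open>Only ancestors of \<open>u\<close> have been touched so far, so the parents of
      \<open>a\<close> are still those in \<open>T\<close>, and the edge from \<open>u\<close> to
      \<open>a\<close> meets the conditions for reversal.\<close>
    have pEa: "parents E a = {u}" using E(3)[of a] dag_asym[OF dag u] pa by simp
    then have ua: "(u, a) \<in> E" by (auto simp: parents_def)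
    note par = parents_reverse_edge[OF dagE ua E(2) pEa]
    have "markov_equiv d T (reverse_edge u a E)"
      using markov_equiv_trans[OF E(1) markov_equiv_reverse_edge[OF dagE ua E(2) pEa]] .
    moreover have "parents (reverse_edge u a E) a = {}"
      using par[of a] rs_bound(3)[OF dagE ua E(2) pEa] by simp
    moreover have "parents (reverse_edge u a E) w = parents T w" if w: "(w, a) \<notin> T\<^sup>*" for w
    proof -
      have "(w, u) \<notin> T\<^sup>*" using w u by (meson rtrancl_into_rtrancl)
      moreover have "w \<noteq> a" "w \<noteq> u" using w u by auto
      ultimately show ?thesis using par[of w] E(3) by simp
    qed
    ultimately show ?thesis by blast
  qed
qed

lemma undirected_reversible:
  assumes G: "sound G" and closed: "\<not> (\<exists>G'. meek_step G G')" and ab: "(a, b) \<in> T" "(b, a) \<in> G"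
  shows "\<exists>E. markov_equiv d T E \<and> (a, b) \<notin> E"
proof -
  obtain E where E: "markov_equiv d T E" "parents E a = {}"
      "\<And>w. (w, a) \<notin> T\<^sup>* \<Longrightarrow> parents E w = parents T w"
    using reroot[OF G closed ab] by blast
  have dagE: "dag d E" using E(1) by (simp add: markov_equiv_def)
  have "parents T b = {a}"
    using ab G by (auto simp: parents_def sound_def oriented_colliders_def)
  then have pb: "parents E b = {a}" using E(3)[of b] dag_asym[OF dag ab(1)] by simp
  then have e: "(a, b) \<in> E" by (auto simp: parents_def)
  have "markov_equiv d T (reverse_edge a b E)"
    using markov_equiv_trans[OF E(1) markov_equiv_reverse_edge[OF dagE e E(2) pb]] .
  moreover have "(a, b) \<notin> reverse_edge a b E"
    using rs_bound(3)[OF dagE e E(2) pb] by (auto simp: reverse_edge_def)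
  ultimately show ?thesis by blast
qed

text \<open>Soundness keeps every pair of the CPDAG in \<open>G\<close>. Closedness gives the
  converse: an edge that kept both directions is reversed in some equivalent DAG.\<close>

lemma closed_eq_cpdag:
  assumes G: "sound G" and closed: "\<not> (\<exists>G'. meek_step G G')"
  shows "G = cpdag d T"
proof (intro equalityI subrelI)
  fix a b assume ab: "(a, b) \<in> G"
  then have sk: "(a, b) \<in> skel T" using sound_bounds(2)[OF G] by blast
  have "\<exists>E. markov_equiv d T E \<and> (b, a) \<notin> E"
  proof (cases "(b, a) \<in> T")
    case True
    then show ?thesis using undirected_reversible[OF G closed] ab by blast
  next
    case False
    then show ?thesis using equiv_refl by blast
  qed
  then show "(a, b) \<in> cpdag d T" using sk by (auto simp: cpdag_def)
next
  fix a b assume "(a, b) \<in> cpdag d T"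
  then obtain E where sk: "(a, b) \<in> skel T" and E: "markov_equiv d T E" "(b, a) \<notin> E"
    by (auto simp: cpdag_def)
  have "(a, b) \<in> skel E" using sk markov_equiv_skel[OF E(1)] by simp
  then have "(a, b) \<in> E" using E(2) by (auto simp: skel_def)
  then show "(a, b) \<in> G" using E(1) G by (auto simp: sound_def)
qed

theorem orient_results_eq: "orient_results (skel T) S = {cpdag d T}"
proof -
  have snd: "sound G" if "meek_step\<^sup>*\<^sup>* oriented_colliders G" for G
    using that by (induction rule: rtranclp_induct)
      (auto simp: sound_oriented_colliders intro: sound_meek_step)
  have "T \<subseteq> {..<d} \<times> {..<d}" using dag by (simp add: dag_def)
  then have "oriented_colliders \<subseteq> {..<d} \<times> {..<d}" by (auto simp: oriented_colliders_def skel_def)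
  then have "finite oriented_colliders" using finite_subset by blast
  from meek_step_normal_form[OF this] show ?thesis
    using snd closed_eq_cpdag unfolding orient_results_def orient_v_eq by blast
qed

end

section \<open>Concentration of sample covariances\<close>

text \<open>Total mass 1, obtained from the kernels, forces \<open>c\<close> to be positive;
  compared with the Gaussian integral at \<open>s = 0\<close> it also gives
  \<open>c * Z = 1\<close>.\<close>

lemma gauss_law:
  assumes dag: "dag d T" and pd: "pos_def d S" and m: "markov_density d T (gauss_dens d S)"
  obtains c where "0 < c" "\<And>x. gauss_dens d S x = c * exp (- bil {..<d} (minv d S) x x / 2)"
    "\<And>s a. 0 < 1 + 2 * s * bil {..<d} S a a \<Longrightarrow>
      (\<integral>\<^sup>+ x. ennreal (exp (- s * (\<Sum>i<d. a i * x i)\<^sup>2)) \<partial>gauss d S)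
        = ennreal (1 / sqrt (1 + 2 * s * bil {..<d} S a a))"
proof -
  define c where "c = 1 / sqrt ((2 * pi) ^ d * mdet d S)"
  have c: "gauss_dens d S x = c * exp (- bil {..<d} (minv d S) x x / 2)" for x
    by (simp add: gauss_dens_def c_def bil_def)
  have pd': "pd_on {..<d} S" using pd by (simp add: pos_def_iff_pd_on)
  obtain g where g: "markov_kernels d T g" and fg: "AE x in Rd d. gauss_dens d S x = (\<Prod>k<d. g k x)"
    using m by (auto simp: markov_density_iff)
  have one: "(\<integral>\<^sup>+ x. ennreal (gauss_dens d S x) \<partial>Rd d) = 1"
  proof -
    have "(\<integral>\<^sup>+ x. ennreal (gauss_dens d S x) \<partial>Rd d) = (\<integral>\<^sup>+ x. ennreal (\<Prod>k<d. g k x) \<partial>Rd d)"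
      using fg by (intro nn_integral_cong_AE) (auto elim!: eventually_mono)
    then show ?thesis using nn_integral_markov_kernels[OF dag g] by simp
  qed
  have c0: "0 < c"
  proof (rule ccontr)
    assume "\<not> 0 < c"
    then have "ennreal (gauss_dens d S x) = 0" for x by (simp add: c ennreal_eq_0_iff mult_nonpos_nonneg)
    then show False using one by simp
  qed
  obtain Z where Z: "0 < Z" and ZI: "\<And>s a. 0 < 1 + 2 * s * bil {..<d} S a a \<Longrightarrow>
     (\<integral>\<^sup>+ x. ennreal (exp (- bil {..<d} (minv d S) x x / 2 - s * (\<Sum>i<d. a i * x i)\<^sup>2)) \<partial>Rd d)
       = ennreal (Z / sqrt (1 + 2 * s * bil {..<d} S a a))"
    using gaussian_nn_integral[OF finite_lessThan pd' precision_minv[OF pd]] by blast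
  have dm: "(\<lambda>x. ennreal (gauss_dens d S x)) \<in> borel_measurable (Rd d)"
    unfolding c by measurable
  have I: "(\<integral>\<^sup>+ x. ennreal (exp (- s * (\<Sum>i<d. a i * x i)\<^sup>2)) \<partial>gauss d S)
        = ennreal (c * Z / sqrt (1 + 2 * s * bil {..<d} S a a))"
    if "0 < 1 + 2 * s * bil {..<d} S a a" for s a
  proof -
    have "(\<integral>\<^sup>+ x. ennreal (exp (- s * (\<Sum>i<d. a i * x i)\<^sup>2)) \<partial>gauss d S)
      = (\<integral>\<^sup>+ x. ennreal (gauss_dens d S x) * ennreal (exp (- s * (\<Sum>i<d. a i * x i)\<^sup>2)) \<partial>Rd d)"
      unfolding gauss_def by (rule nn_integral_density[OF dm]) measurable
    also have "\<dots> = (\<integral>\<^sup>+ x. ennreal c * ennreal (exp (- bil {..<d} (minv d S) x x / 2 - s * (\<Sum>i<d. a i * x i)\<^sup>2)) \<partial>Rd d)"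
      unfolding c
      by (simp only: diff_conv_add_uminus minus_mult_left exp_add ennreal_mult''[OF exp_ge_zero] mult.assoc)
    also have "\<dots> = ennreal c * ennreal (Z / sqrt (1 + 2 * s * bil {..<d} S a a))"
      unfolding ZI[OF that, symmetric] by (rule nn_integral_cmult) measurable
    finally show ?thesis using c0 Z that by (simp add: ennreal_mult[symmetric])
  qed
  have "c * Z = 1"
  proof -
    have "ennreal (c * Z) = (\<integral>\<^sup>+ x. 1 \<partial>gauss d S)" using I[of 0 "\<lambda>_. 0"] by simp
    also have "\<dots> = (\<integral>\<^sup>+ x. ennreal (gauss_dens d S x) * 1 \<partial>Rd d)"
      unfolding gauss_def using dm by (intro nn_integral_density) auto
    finally show ?thesis using one c0 Z by simp
  qed
  then show thesis using that[OF c0 c] I by auto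
qed

text \<open>Put u = \<eta> v / 64. The terms linear in u cancel, the gain is \<eta>^2 / 128, and the
  second-order loss is at most u^2 \<le> \<eta>^2 / 256 because v \<le> 4. The bound \<eta> \<le> 4
  keeps u \<le> 1/4, within the range of the quadratic estimate of ln (1 - u).\<close>

lemma chernoff_exponent:
  assumes "0 < \<eta>" "\<eta> \<le> 4" "0 \<le> v" "v \<le> (4::real)"
  shows "exp (- (\<eta> / 128) * (v + \<eta>)) * (1 / sqrt (1 + 2 * (- (\<eta> / 128)) * v)) \<le> exp (- \<eta>\<^sup>2 / 256)"
    and "exp ((\<eta> / 128) * (v - \<eta>)) * (1 / sqrt (1 + 2 * (\<eta> / 128) * v)) \<le> exp (- \<eta>\<^sup>2 / 256)"
proof -
  define u where "u = 2 * (\<eta> / 128) * v"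
  have "\<eta> * v \<le> 4 * 4" using assms by (intro mult_mono) auto
  then have u: "0 \<le> u" "u \<le> 1 / 4" using assms by (auto simp: u_def)
  have "u * u \<le> (\<eta> / 16) * (\<eta> / 16)"
    using assms u(1) by (intro mult_mono) (auto simp: u_def)
  then have uu: "u\<^sup>2 \<le> \<eta>\<^sup>2 / 256" by (simp add: power2_eq_square)
  have sq: "1 / sqrt w = exp (- ln w / 2)" if "0 < w" for w :: real
    using that by (simp add: ln_sqrt[symmetric] exp_minus inverse_eq_divide)
  have "- (\<eta> / 128) * (v + \<eta>) - ln (1 - u) / 2 \<le> - \<eta>\<^sup>2 / 256"
  proof -
    have "- u - 2 * u\<^sup>2 \<le> ln (1 - u)" using u by (intro ln_one_minus_pos_lower_bound) auto
    moreover have "(\<eta> / 128) * (v + \<eta>) = u / 2 + \<eta>\<^sup>2 / 128"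
      by (simp add: u_def algebra_simps power2_eq_square)
    ultimately show ?thesis using uu by linarith
  qed
  then show "exp (- (\<eta> / 128) * (v + \<eta>)) * (1 / sqrt (1 + 2 * (- (\<eta> / 128)) * v)) \<le> exp (- \<eta>\<^sup>2 / 256)"
    using u sq[of "1 - u"] by (simp add: u_def exp_add[symmetric])
  have "(\<eta> / 128) * (v - \<eta>) - ln (1 + u) / 2 \<le> - \<eta>\<^sup>2 / 256"
  proof -
    have "u - u\<^sup>2 \<le> ln (1 + u)" using u by (intro ln_one_plus_pos_lower_bound) auto
    moreover have "(\<eta> / 128) * (v - \<eta>) = u / 2 - \<eta>\<^sup>2 / 128"
      by (simp add: u_def right_diff_distrib power2_eq_square)
    moreover have "0 \<le> u\<^sup>2" by simp
    ultimately show ?thesis using uu by linarith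
  qed
  then show "exp ((\<eta> / 128) * (v - \<eta>)) * (1 / sqrt (1 + 2 * (\<eta> / 128) * v)) \<le> exp (- \<eta>\<^sup>2 / 256)"
    using u sq[of "1 + u"] by (simp add: u_def exp_add[symmetric])
qed

lemma bil_samp_cov:
  "bil A (samp_cov n X) a b = (\<Sum>i<n. (\<Sum>k\<in>A. a k * X i k) * (\<Sum>k\<in>A. b k * X i k)) / real n"
proof -
  have "bil A (samp_cov n X) a b = (\<Sum>j\<in>A. \<Sum>k\<in>A. \<Sum>i<n. (a j * X i j) * (b k * X i k)) / real n"
    unfolding bil_def samp_cov_def sum_divide_distrib
    by (intro sum.cong refl) (simp add: sum_distrib_left sum_distrib_right sum_divide_distrib mult_ac)
  also have "(\<Sum>j\<in>A. \<Sum>k\<in>A. \<Sum>i<n. (a j * X i j) * (b k * X i k))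
     = (\<Sum>j\<in>A. \<Sum>i<n. \<Sum>k\<in>A. (a j * X i j) * (b k * X i k))"
    by (intro sum.cong refl sum.swap)
  also have "\<dots> = (\<Sum>i<n. \<Sum>j\<in>A. \<Sum>k\<in>A. (a j * X i j) * (b k * X i k))"
    by (rule sum.swap)
  finally show ?thesis by (simp add: sum_product)
qed

text \<open>The Laplace transform of squared linear forms is the distributional input; its case
  \<open>s = 0\<close> also says that the total mass is 1.\<close>

locale gaussian_sample =
  fixes d :: nat and S :: "nat \<Rightarrow> nat \<Rightarrow> real" and n :: nat
  assumes pd: "pd_on {..<d} S" and n: "0 < n"
    and law: "\<And>s a. 0 < 1 + 2 * s * bil {..<d} S a a \<Longrightarrow>
      (\<integral>\<^sup>+ x. ennreal (exp (- s * (\<Sum>i<d. a i * x i)\<^sup>2)) \<partial>gauss d S)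
        = ennreal (1 / sqrt (1 + 2 * s * bil {..<d} S a a))"
begin

abbreviation M where "M \<equiv> iid n (gauss d S)"

abbreviation B where "B \<equiv> bil {..<d} S"

abbreviation B_hat where "B_hat X \<equiv> bil {..<d} (samp_cov n X)"

lemma prob_space_gauss: "prob_space (gauss d S)"
proof
  show "emeasure (gauss d S) (space (gauss d S)) = 1"
    using law[of 0 "\<lambda>_. 0"] by simp
qed

sublocale G: prob_space "gauss d S" by (rule prob_space_gauss)

sublocale Gs: product_prob_space "\<lambda>_::nat. gauss d S" "{..<n}" ..

sublocale prob_space M unfolding iid_def by (rule Gs.prob_space_axioms)

lemma sets_gauss: "sets (gauss d S) = sets (Rd d)"
  by (simp add: gauss_def)

lemma measurable_sample [measurable]:
  assumes "i < n" "k < d"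
  shows "(\<lambda>X. X i k) \<in> borel_measurable M"
proof -
  have "(\<lambda>X. X i) \<in> M \<rightarrow>\<^sub>M gauss d S" unfolding iid_def using assms(1) by simp
  moreover have "(\<lambda>x. x k) \<in> gauss d S \<rightarrow>\<^sub>M borel"
    using assms(2) by (subst measurable_cong_sets[OF sets_gauss refl]) simp
  ultimately show ?thesis by (rule measurable_compose)
qed

lemma measurable_form [measurable]:
  "i < n \<Longrightarrow> (\<lambda>X. \<Sum>k<d. a k * X i k) \<in> borel_measurable M"
  by (intro borel_measurable_sum borel_measurable_times) auto

lemma measurable_B_hat [measurable]: "(\<lambda>X. B_hat X a b) \<in> borel_measurable M"
  unfolding bil_samp_cov by (intro borel_measurable_divide borel_measurable_sum borel_measurable_times) auto

text \<open>Markov's inequality for an exponential moment, which factors over the independent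
  samples. The sign of \<open>s\<close> selects the tail.\<close>

lemma chernoff:
  assumes "0 < 1 + 2 * s * B a a"
  shows "prob {X \<in> space M. t \<le> - s * B_hat X a a}
    \<le> (exp (- t) * (1 / sqrt (1 + 2 * s * B a a))) ^ n"
proof -
  define Q where "Q X = (\<Sum>i<n. (\<Sum>k<d. a k * X i k)\<^sup>2)" for X
  have Bh: "B_hat X a a = Q X / real n" for X
    by (simp add: bil_samp_cov Q_def power2_eq_square)
  have Qm[measurable]: "Q \<in> borel_measurable M"
    unfolding Q_def by (intro borel_measurable_sum borel_measurable_power) auto
  have "{X \<in> space M. t \<le> - s * B_hat X a a}
      \<subseteq> {X \<in> space M. 1 \<le> ennreal (exp (- (real n * t))) * ennreal (exp (- s * Q X))}"
  proof safe
    fix X assume "t \<le> - s * B_hat X a a"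
    then have "0 \<le> - (real n * t) + - s * Q X" using n by (simp add: Bh field_simps)
    then have "1 \<le> exp (- (real n * t) + - s * Q X)" by simp
    then show "1 \<le> ennreal (exp (- (real n * t))) * ennreal (exp (- s * Q X))"
      by (simp add: ennreal_mult[symmetric] exp_add[symmetric])
  qed
  then have "emeasure M {X \<in> space M. t \<le> - s * B_hat X a a}
      \<le> emeasure M {X \<in> space M. 1 \<le> ennreal (exp (- (real n * t))) * ennreal (exp (- s * Q X))}"
    by (intro emeasure_mono) measurable
  also have "\<dots> \<le> ennreal (exp (- (real n * t))) * (\<integral>\<^sup>+ X. ennreal (exp (- s * Q X)) \<partial>M)"
  proof -
    have "(\<lambda>X. ennreal (exp (- s * Q X)) * indicator (space M) X) \<in> borel_measurable M" by measurable
    from nn_integral_Markov_inequality[OF this sets.top, of "ennreal (exp (- (real n * t)))"]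
    show ?thesis by (simp cong: nn_integral_cong_simp)
  qed
  also have "(\<integral>\<^sup>+ X. ennreal (exp (- s * Q X)) \<partial>M)
     = (\<integral>\<^sup>+ X. (\<Prod>i<n. ennreal (exp (- s * (\<Sum>k<d. a k * X i k)\<^sup>2))) \<partial>M)"
    by (intro nn_integral_cong) (simp add: Q_def prod_ennreal exp_sum[symmetric] sum_distrib_left sum_negf)
  also have "\<dots> = (\<Prod>i<n. (\<integral>\<^sup>+ x. ennreal (exp (- s * (\<Sum>k<d. a k * x k)\<^sup>2)) \<partial>gauss d S))"
    unfolding iid_def
    by (intro Gs.product_nn_integral_prod finite_lessThan, subst measurable_cong_sets[OF sets_gauss refl]) measurable
  also have "\<dots> = ennreal ((1 / sqrt (1 + 2 * s * B a a)) ^ n)"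
    unfolding law[OF assms] using assms by (simp add: ennreal_power)
  also have "ennreal (exp (- (real n * t))) * ennreal ((1 / sqrt (1 + 2 * s * B a a)) ^ n)
     = ennreal ((exp (- t) * (1 / sqrt (1 + 2 * s * B a a))) ^ n)"
    using assms exp_of_nat_mult[of n "- t"]
    by (simp add: ennreal_mult[symmetric] power_mult_distrib power_divide)
  finally show ?thesis
    using assms by (simp add: emeasure_eq_measure)
qed

lemma variance_deviation:
  assumes v: "B a a \<le> 4" and \<eta>: "0 < \<eta>" "\<eta> \<le> 4"
  shows "prob {X \<in> space M. \<eta> \<le> \<bar>B_hat X a a - B a a\<bar>} \<le> 2 * exp (- \<eta>\<^sup>2 / 256) ^ n"
proof -
  have v0: "0 \<le> B a a" by (rule bil_nonneg[OF pd])
  have "\<eta> * B a a \<le> 4 * 4" using v v0 \<eta> by (intro mult_mono) auto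
  then have p1: "0 < 1 + 2 * (- (\<eta> / 128)) * B a a" by simp
  have p2: "0 < 1 + 2 * (\<eta> / 128) * B a a" using v0 \<eta> by (simp add: add_pos_nonneg)
  have "prob {X \<in> space M. (\<eta> / 128) * (B a a + \<eta>) \<le> - (- (\<eta> / 128)) * B_hat X a a}
      \<le> (exp (- ((\<eta> / 128) * (B a a + \<eta>))) * (1 / sqrt (1 + 2 * (- (\<eta> / 128)) * B a a))) ^ n"
    by (rule chernoff[OF p1])
  also have "\<dots> \<le> exp (- \<eta>\<^sup>2 / 256) ^ n"
    using chernoff_exponent(1)[OF \<eta> v0 v] p1 by (intro power_mono) auto
  finally have 1: "prob {X \<in> space M. (\<eta> / 128) * (B a a + \<eta>) \<le> - (- (\<eta> / 128)) * B_hat X a a}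
    \<le> exp (- \<eta>\<^sup>2 / 256) ^ n" .
  have "prob {X \<in> space M. - ((\<eta> / 128) * (B a a - \<eta>)) \<le> - (\<eta> / 128) * B_hat X a a}
      \<le> (exp (- (- ((\<eta> / 128) * (B a a - \<eta>)))) * (1 / sqrt (1 + 2 * (\<eta> / 128) * B a a))) ^ n"
    by (rule chernoff[OF p2])
  also have "\<dots> \<le> exp (- \<eta>\<^sup>2 / 256) ^ n"
    using chernoff_exponent(2)[OF \<eta> v0 v] p2 by (intro power_mono) auto
  finally have 2: "prob {X \<in> space M. - ((\<eta> / 128) * (B a a - \<eta>)) \<le> - (\<eta> / 128) * B_hat X a a}
    \<le> exp (- \<eta>\<^sup>2 / 256) ^ n" .
  have "{X \<in> space M. \<eta> \<le> \<bar>B_hat X a a - B a a\<bar>}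
     \<subseteq> {X \<in> space M. (\<eta> / 128) * (B a a + \<eta>) \<le> - (- (\<eta> / 128)) * B_hat X a a} \<union>
        {X \<in> space M. - ((\<eta> / 128) * (B a a - \<eta>)) \<le> - (\<eta> / 128) * B_hat X a a}" (is "_ \<subseteq> ?U \<union> ?L")
    using \<eta> by (auto simp: abs_real_def split: if_splits)
  then have "prob {X \<in> space M. \<eta> \<le> \<bar>B_hat X a a - B a a\<bar>} \<le> prob (?U \<union> ?L)"
    by (intro finite_measure_mono) measurable
  also have "\<dots> \<le> prob ?U + prob ?L"
    by (intro measure_Un_le) measurable
  finally show ?thesis using 1 2 by linarith
qed

lemma covariance_deviation:
  assumes a: "B a a = 1" and b: "B b b = 1" and \<epsilon>: "0 < \<epsilon>" "\<epsilon> \<le> 2"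
  shows "prob {X \<in> space M. \<epsilon> \<le> \<bar>B_hat X a b - B a b\<bar>} \<le> 4 * exp (- \<epsilon>\<^sup>2 / 64) ^ n"
proof -
  define p m where "p i = a i + b i" and "m i = a i - b i" for i
  have comm: "B b a = B a b" using pd by (intro bil_commute) (auto dest: pd_on_sym)
  have comm': "B_hat X b a = B_hat X a b" for X
    by (intro bil_commute) (simp add: samp_cov_def mult.commute)
  have Bp: "B p p = 2 + 2 * B a b" and Bm: "B m m = 2 - 2 * B a b"
    unfolding p_def m_def bil_add_left bil_add_right bil_diff_left bil_diff_right using a b comm by simp_all
  \<comment> \<open>Both variances are nonnegative and sum to 4, which is the origin of the bound 4
    in \<open>variance_deviation\<close>.\<close>
  have le: "B p p \<le> 4" "B m m \<le> 4" using bil_nonneg[OF pd, of p] bil_nonneg[OF pd, of m] Bp Bm by auto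
  have pol: "4 * (B_hat X a b - B a b) = (B_hat X p p - B p p) - (B_hat X m m - B m m)" for X
    unfolding Bp Bm
    unfolding p_def m_def bil_add_left bil_add_right bil_diff_left bil_diff_right comm' by simp
  \<comment> \<open>Polarization carries a factor 4, so a covariance error \<epsilon> forces an
    error of at least 2 \<epsilon> in one of the two variances.\<close>
  have e: "0 < 2 * \<epsilon>" "2 * \<epsilon> \<le> 4" using \<epsilon> by auto
  have "{X \<in> space M. \<epsilon> \<le> \<bar>B_hat X a b - B a b\<bar>}
     \<subseteq> {X \<in> space M. 2 * \<epsilon> \<le> \<bar>B_hat X p p - B p p\<bar>} \<union> {X \<in> space M. 2 * \<epsilon> \<le> \<bar>B_hat X m m - B m m\<bar>}"
    (is "_ \<subseteq> ?U \<union> ?L")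
  proof safe
    fix X assume *: "\<epsilon> \<le> \<bar>B_hat X a b - B a b\<bar>" "\<not> 2 * \<epsilon> \<le> \<bar>B_hat X m m - B m m\<bar>"
    have "\<bar>4 * (B_hat X a b - B a b)\<bar> \<le> \<bar>B_hat X p p - B p p\<bar> + \<bar>B_hat X m m - B m m\<bar>"
      unfolding pol by (rule abs_triangle_ineq4)
    then have "4 * \<bar>B_hat X a b - B a b\<bar> \<le> \<bar>B_hat X p p - B p p\<bar> + \<bar>B_hat X m m - B m m\<bar>"
      unfolding abs_mult by simp
    moreover have "2 * \<epsilon> \<le> u" if "4 * w \<le> u + v" "\<epsilon> \<le> w" "\<not> 2 * \<epsilon> \<le> v" for u v w :: real
      using that by linarith
    ultimately show "2 * \<epsilon> \<le> \<bar>B_hat X p p - B p p\<bar>" using * by blast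
  qed
  then have "prob {X \<in> space M. \<epsilon> \<le> \<bar>B_hat X a b - B a b\<bar>} \<le> prob (?U \<union> ?L)"
    by (intro finite_measure_mono) measurable
  also have "\<dots> \<le> prob ?U + prob ?L"
    by (intro measure_Un_le) measurable
  also have "\<dots> \<le> 2 * exp (- (2 * \<epsilon>)\<^sup>2 / 256) ^ n + 2 * exp (- (2 * \<epsilon>)\<^sup>2 / 256) ^ n"
    by (intro add_mono variance_deviation le e)
  also have "(2 * \<epsilon>)\<^sup>2 / 256 = \<epsilon>\<^sup>2 / 64" by (simp add: power2_eq_square)
  then have "- (2 * \<epsilon>)\<^sup>2 / 256 = - \<epsilon>\<^sup>2 / 64" by simp
  finally show ?thesis by simp
qed

end

section \<open>Correctness of the tests\<close>

text \<open>Nothing is required when the modulus of \<rho> lies strictly between 0 and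
  \<open>c\<close>: the graph yields exact zeros and faithfulness yields the lower bound
  \<open>c\<close>, and the algorithm is correct whatever the remaining tests decide.\<close>

definition test_ok :: "real \<Rightarrow> real \<Rightarrow> real \<Rightarrow> bool" where
  "test_ok c \<rho> r \<longleftrightarrow> (\<rho> = 0 \<longrightarrow> \<bar>r\<bar> < c / 2) \<and> (c \<le> \<bar>\<rho>\<bar> \<longrightarrow> c / 2 \<le> \<bar>r\<bar>)"

text \<open>Covariance errors are below c/20 and the correction terms of the residual formula at
  most c/380, where 1/20 + 1/380 = 1/19; hence 19 and 18/19. The threshold c/2 is met with room: the
  quotient is at most c/18 in the null case and at least 360 c / 399 in the other.\<close>

lemma test_ok_quotient:
  assumes c: "0 < c" and N: "\<bar>N - \<rho>\<bar> \<le> c / 19"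
    and D: "18 / 19 \<le> D1" "D1 \<le> 21 / 20" "18 / 19 \<le> D2" "D2 \<le> 21 / 20"
  shows "test_ok c \<rho> (N / sqrt (D1 * D2))"
proof -
  have "(18 / 19) * (18 / 19) \<le> D1 * D2" "D1 * D2 \<le> (21 / 20) * (21 / 20)"
    using D by (intro mult_mono; linarith)+
  then have "18 / 19 \<le> sqrt (D1 * D2)" "sqrt (D1 * D2) \<le> 21 / 20"
    unfolding power2_eq_square[symmetric] by (blast intro: real_le_rsqrt, intro real_le_lsqrt) simp_all
  then obtain R where R: "R = sqrt (D1 * D2)" "18 / 19 \<le> R" "R \<le> 21 / 20" by blast
  have "\<bar>N\<bar> / R < c / 2" if "\<rho> = 0"
  proof -
    have "\<bar>N\<bar> / R \<le> (c / 19) / (18 / 19)"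
      using N that R(2) by (intro frac_le) auto
    also have "\<dots> < c / 2" using c by simp
    finally show ?thesis .
  qed
  moreover have "c / 2 \<le> \<bar>N\<bar> / R" if "c \<le> \<bar>\<rho>\<bar>"
  proof -
    have "\<bar>\<rho>\<bar> \<le> \<bar>N\<bar> + \<bar>N - \<rho>\<bar>" by linarith
    then have "18 * c / 19 \<le> \<bar>N\<bar>" using N that by linarith
    then have "(18 * c / 19) / (21 / 20) \<le> \<bar>N\<bar> / R"
      using R(2,3) by (intro frac_le) auto
    moreover have "c / 2 \<le> (18 * c / 19) / (21 / 20)" using c by simp
    ultimately show ?thesis by linarith
  qed
  moreover have eq: "\<bar>N / R\<bar> = \<bar>N\<bar> / R" using R(2) by simp
  ultimately show ?thesis unfolding test_ok_def R(1)[symmetric] eq by blast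
qed

lemma test_ok_residual:
  assumes "0 < c" "c < 1" "\<bar>uv - \<rho>\<bar> < c / 20" "\<bar>uu - 1\<bar> < c / 20" "\<bar>vv - 1\<bar> < c / 20"
    and "\<bar>e\<bar> \<le> c / 20 / 19" "0 \<le> e1" "\<bar>e1\<bar> \<le> c / 20 / 19" "0 \<le> e2" "\<bar>e2\<bar> \<le> c / 20 / 19"
  shows "test_ok c \<rho> ((uv - e) / sqrt ((uu - e1) * (vv - e2)))"
  using assms by (intro test_ok_quotient) linarith+

lemma small_quotient:
  fixes x y z :: real
  assumes "\<bar>x\<bar> \<le> \<epsilon>" "\<bar>y\<bar> \<le> \<epsilon>" "\<bar>z - 1\<bar> \<le> \<epsilon>" "\<epsilon> \<le> 1 / 20"
  shows "\<bar>x * y / z\<bar> \<le> \<epsilon> / 19"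
proof -
  have z: "19 / 20 \<le> z" using assms(3,4) by linarith
  have "\<bar>x\<bar> * \<bar>y\<bar> \<le> \<epsilon> * (1 / 20)" using assms by (intro mult_mono) auto
  then have "\<bar>x\<bar> * \<bar>y\<bar> / z \<le> (\<epsilon> * (1 / 20)) / (19 / 20)" using z assms(1) by (intro frac_le) auto
  then show ?thesis using z by (simp add: abs_mult)
qed

abbreviation unit_vec :: "nat \<Rightarrow> nat \<Rightarrow> real" where
  "unit_vec j \<equiv> \<lambda>k. of_bool (k = j)"

abbreviation resid :: "real \<Rightarrow> real \<Rightarrow> nat \<Rightarrow> nat \<Rightarrow> nat \<Rightarrow> real" where
  "resid \<alpha> \<gamma> j l \<equiv> \<lambda>k. \<alpha> * (unit_vec j k - \<gamma> * unit_vec l k)"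

lemma bil_resid:
  assumes "j < d" "k < d" "l < d"
  shows "bil {..<d} A (resid \<alpha> \<gamma> j l) (resid \<beta> \<delta> k l)
    = \<alpha> * \<beta> * (A j k - \<delta> * A j l - \<gamma> * A l k + \<gamma> * \<delta> * A l l)"
  unfolding bil_scale_left bil_scale_right bil_diff_left bil_diff_right
  using assms by (simp add: bil_unit algebra_simps)

lemma bil_resid_unit:
  assumes "j < d" "l < d"
  shows "bil {..<d} A (resid \<alpha> \<gamma> j l) (\<lambda>k. \<tau> * unit_vec l k) = \<alpha> * \<tau> * (A j l - \<gamma> * A l l)"
  unfolding bil_scale_left bil_scale_right bil_diff_left bil_diff_right
  using assms by (simp add: bil_unit algebra_simps)

lemma bil_unit_scaled:
  assumes "j < d" "k < d"
  shows "bil {..<d} A (\<lambda>i. \<alpha> * unit_vec j i) (\<lambda>i. \<beta> * unit_vec k i) = \<alpha> * \<beta> * A j k"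
  unfolding bil_scale_left bil_scale_right using assms by (simp add: bil_unit)

text \<open>This invariance reduces every test to regression residuals of unit variance, so that the tail
  bounds do not depend on the conditioning of the covariance matrix.\<close>

lemma pcorr_resid:
  fixes A :: "nat \<Rightarrow> nat \<Rightarrow> real" and \<alpha> \<beta> \<gamma> \<delta> \<tau> :: real
  assumes jkl: "j < d" "k < d" "l < d" and sym: "A l j = A j l" "A l k = A k l" and nz: "A l l \<noteq> 0"
    and pos: "0 < \<alpha>" "0 < \<beta>" "0 < \<tau>"
  defines "u \<equiv> resid \<alpha> \<gamma> j l" and "v \<equiv> resid \<beta> \<delta> k l" and "z \<equiv> \<lambda>k. \<tau> * unit_vec l k"
    and "b \<equiv> bil {..<d} A"
  shows "pcorr A j k (Some l) = (b u v - b u z * b v z / b z z) /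
    sqrt ((b u u - b u z * b u z / b z z) * (b v v - b v z * b v z / b z z))"
proof -
  have N: "b u v - b u z * b v z / b z z = \<alpha> * \<beta> * (A j k - A j l * A l k / A l l)"
    unfolding b_def u_def v_def z_def bil_resid[OF jkl] bil_resid_unit[OF jkl(1,3)] bil_resid_unit[OF jkl(2,3)]
      bil_unit_scaled[OF jkl(3,3)]
    using nz pos by (simp add: sym field_simps)
  have D1: "b u u - b u z * b u z / b z z = \<alpha>\<^sup>2 * (A j j - A j l * A l j / A l l)"
    unfolding b_def u_def z_def bil_resid[OF jkl(1,1,3)] bil_resid_unit[OF jkl(1,3)] bil_unit_scaled[OF jkl(3,3)]
    using nz pos by (simp add: sym field_simps power2_eq_square)
  have D2: "b v v - b v z * b v z / b z z = \<beta>\<^sup>2 * (A k k - A k l * A l k / A l l)"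
    unfolding b_def v_def z_def bil_resid[OF jkl(2,2,3)] bil_resid_unit[OF jkl(2,3)] bil_unit_scaled[OF jkl(3,3)]
    using nz pos by (simp add: sym field_simps power2_eq_square)
  have "sqrt ((\<alpha>\<^sup>2 * P) * (\<beta>\<^sup>2 * Q)) = \<alpha> * \<beta> * sqrt (P * Q)" for P Q
    using pos by (simp add: real_sqrt_mult mult_ac)
  then show ?thesis
    unfolding N D1 D2 using pos by (simp add: pcorr_def)
qed

context gaussian_sample
begin

definition deviates :: "real \<Rightarrow> (nat \<Rightarrow> real) \<Rightarrow> (nat \<Rightarrow> real) \<Rightarrow> (nat \<Rightarrow> nat \<Rightarrow> real) set" where
  "deviates c a b = {X \<in> space M. c / 20 \<le> \<bar>B_hat X a b - B a b\<bar>}"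

lemma deviates_sets [measurable]: "deviates c a b \<in> sets M"
  unfolding deviates_def by measurable

text \<open>The denominator is 25600 = 64 * 20^2, from the tolerance c/20.\<close>

lemma prob_deviates:
  assumes "B a a = 1" "B b b = 1" "0 < c" "c < 1"
  shows "prob (deviates c a b) \<le> 4 * exp (- c\<^sup>2 / 25600) ^ n"
  using covariance_deviation[OF assms(1,2), of "c / 20"] assms(3,4)
  by (simp add: deviates_def power_divide)

lemma S_sym: "i < d \<Longrightarrow> j < d \<Longrightarrow> S i j = S j i"
  using pd pd_on_sym by auto

lemma S_diag_pos: "i < d \<Longrightarrow> 0 < S i i"
  using pd_on_pos[OF pd, of i "unit_vec i"] by (simp add: bil_unit)

lemma test_failure:
  assumes c: "0 < c" "c < 1" and jk: "j < d" "k < d" "j \<noteq> k" and s: "s \<in> cond_sets d j k"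
  shows "prob {X \<in> space M. \<not> test_ok c (pcorr S j k s) (pcorr (samp_cov n X) j k s)}
    \<le> 24 * exp (- c\<^sup>2 / 25600) ^ n"
proof -
  let ?q = "exp (- c\<^sup>2 / 25600) ^ n"
  have dev: "prob (deviates c a b) \<le> 4 * ?q" if "B a a = 1" "B b b = 1" for a b
    using prob_deviates[OF that c] .
  have sub: "prob (U \<union> V) \<le> x + y"
    if "U \<in> sets M" "V \<in> sets M" "prob U \<le> x" "prob V \<le> y" for U V x y
    using measure_Un_le[OF that(1,2)] that(3,4) by linarith
  show ?thesis
  proof (cases s)
    case None
    define u v where "u i = (1 / sqrt (S j j)) * unit_vec j i" and "v i = (1 / sqrt (S k k)) * unit_vec k i" for i
    have b: "bil {..<d} A u v = A j k / (sqrt (S j j) * sqrt (S k k))"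
      "bil {..<d} A u u = A j j / S j j" "bil {..<d} A v v = A k k / S k k" for A
      unfolding u_def v_def bil_unit_scaled[OF jk(1,2)] bil_unit_scaled[OF jk(1,1)] bil_unit_scaled[OF jk(2,2)]
      using S_diag_pos[OF jk(1)] S_diag_pos[OF jk(2)] by simp_all
    have unit: "B u u = 1" "B v v = 1" using S_diag_pos[OF jk(1)] S_diag_pos[OF jk(2)] by (simp_all add: b)
    have rho: "pcorr S j k s = B u v" by (simp add: None pcorr_def b real_sqrt_mult)
    have r: "pcorr A j k s = bil {..<d} A u v / sqrt (bil {..<d} A u u * bil {..<d} A v v)" for A
      using S_diag_pos[OF jk(1)] S_diag_pos[OF jk(2)]
      by (simp add: None pcorr_def b real_sqrt_mult real_sqrt_divide)
    have "{X \<in> space M. \<not> test_ok c (pcorr S j k s) (pcorr (samp_cov n X) j k s)}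
       \<subseteq> deviates c u v \<union> (deviates c u u \<union> deviates c v v)"
    proof (rule subsetI, rule ccontr)
      fix X assume X: "X \<in> {X \<in> space M. \<not> test_ok c (pcorr S j k s) (pcorr (samp_cov n X) j k s)}"
        and "X \<notin> deviates c u v \<union> (deviates c u u \<union> deviates c v v)"
      then have "\<bar>B_hat X u v - B u v\<bar> < c / 20" "\<bar>B_hat X u u - 1\<bar> < c / 20" "\<bar>B_hat X v v - 1\<bar> < c / 20"
        using unit by (auto simp: deviates_def)
      then have "test_ok c (B u v) (B_hat X u v / sqrt (B_hat X u u * B_hat X v v))"
        using c by (intro test_ok_quotient) linarith+
      then show False using X unfolding rho unfolding r by simp
    qed
    then have "prob {X \<in> space M. \<not> test_ok c (pcorr S j k s) (pcorr (samp_cov n X) j k s)}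
       \<le> prob (deviates c u v \<union> (deviates c u u \<union> deviates c v v))"
      by (intro finite_measure_mono) measurable
    also have "\<dots> \<le> 4 * ?q + (4 * ?q + 4 * ?q)"
      by (intro sub dev unit) measurable
    also have "\<dots> \<le> 24 * ?q" by simp
    finally show ?thesis .
  next
    case (Some l)
    have l: "l < d" "l \<noteq> j" "l \<noteq> k" using s Some by (auto simp: cond_sets_def)
    have Sll: "0 < S l l" using S_diag_pos[OF l(1)] .
    have resid_pos: "0 < S i i - S i l * S l i / S l l" if "i < d" "i \<noteq> l" for i
    proof -
      have "0 < B (resid 1 (S i l / S l l) i l) (resid 1 (S i l / S l l) i l)"
        using that by (intro pd_on_pos[OF pd, of i]) auto
      then show ?thesis
        unfolding bil_resid[OF that(1,1) l(1)] using Sll S_sym[OF that(1) l(1)] by (simp add: field_simps)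
    qed
    \<comment> \<open>Scales and coefficients are taken from the population, so the forms are
      deterministic and the deviation bounds apply. The sample partial correlation may still be
      expressed through them, by \<open>pcorr_resid\<close>.\<close>
    define \<alpha> \<beta> \<tau> where "\<alpha> = 1 / sqrt (S j j - S j l * S l j / S l l)"
      and "\<beta> = 1 / sqrt (S k k - S k l * S l k / S l l)" and "\<tau> = 1 / sqrt (S l l)"
    have pos: "0 < \<alpha>" "0 < \<beta>" "0 < \<tau>"
      using resid_pos[of j] resid_pos[of k] jk l Sll by (auto simp: \<alpha>_def \<beta>_def \<tau>_def)
    define u v z where "u = resid \<alpha> (S j l / S l l) j l" and "v = resid \<beta> (S k l / S l l) k l"
      and "z = (\<lambda>i. \<tau> * unit_vec l i)"
    have symS: "S l j = S j l" "S l k = S k l" using S_sym jk l by auto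
    note expand = u_def v_def z_def bil_resid[OF jk(1,2) l(1)] bil_resid[OF jk(1,1) l(1)]
      bil_resid[OF jk(2,2) l(1)] bil_resid_unit[OF jk(1) l(1)] bil_resid_unit[OF jk(2) l(1)]
      bil_unit_scaled[OF l(1,1)]
    have unit: "B u u = 1" "B v v = 1" "B z z = 1" "B u z = 0" "B v z = 0"
    proof -
      have sq: "\<alpha> * \<alpha> = 1 / (S j j - S j l * S l j / S l l)" "\<beta> * \<beta> = 1 / (S k k - S k l * S l k / S l l)"
        "\<tau> * \<tau> = 1 / S l l"
        using resid_pos[of j] resid_pos[of k] jk l Sll by (auto simp: \<alpha>_def \<beta>_def \<tau>_def)
      have e: "S i i - S i l / S l l * S i l - S i l / S l l * S l i + S i l / S l l * (S i l / S l l) * S l l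
        = S i i - S i l * S l i / S l l" if "i = j \<or> i = k" for i
        using Sll symS that by (auto simp: field_simps)
      show "B u u = 1" unfolding expand sq e[of j, simplified] using resid_pos[of j] jk l by simp
      show "B v v = 1" unfolding expand sq e[of k, simplified] using resid_pos[of k] jk l by simp
      show "B z z = 1" unfolding expand sq using Sll by simp
      show "B u z = 0" "B v z = 0" unfolding expand using Sll by auto
    qed
    have r: "pcorr A j k s = (bil {..<d} A u v - bil {..<d} A u z * bil {..<d} A v z / bil {..<d} A z z) /
      sqrt ((bil {..<d} A u u - bil {..<d} A u z * bil {..<d} A u z / bil {..<d} A z z) *
        (bil {..<d} A v v - bil {..<d} A v z * bil {..<d} A v z / bil {..<d} A z z))"
      if "A l j = A j l" "A l k = A k l" "A l l \<noteq> 0" for A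
      unfolding Some u_def v_def z_def by (rule pcorr_resid[OF jk(1,2) l(1) that pos])
    \<comment> \<open>The population residuals have unit variance and are uncorrelated with
      \<open>z\<close>, so the corrections vanish.\<close>
    have rho: "pcorr S j k s = B u v" using r[OF symS] Sll by (simp add: unit)
    \<comment> \<open>Six covariances, each failing with probability at most \<open>4 * ?q\<close>:
      this is the factor 24.\<close>
    let ?Bad = "deviates c u v \<union> (deviates c u u \<union> (deviates c v v \<union> (deviates c z z \<union>
      (deviates c u z \<union> deviates c v z))))"
    have "{X \<in> space M. \<not> test_ok c (pcorr S j k s) (pcorr (samp_cov n X) j k s)} \<subseteq> ?Bad"
    proof (rule subsetI, rule ccontr)
      fix X assume X: "X \<in> {X \<in> space M. \<not> test_ok c (pcorr S j k s) (pcorr (samp_cov n X) j k s)}"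
        and "X \<notin> ?Bad"
      then have h: "\<bar>B_hat X u v - B u v\<bar> < c / 20" "\<bar>B_hat X u u - 1\<bar> < c / 20" "\<bar>B_hat X v v - 1\<bar> < c / 20"
        "\<bar>B_hat X z z - 1\<bar> < c / 20" "\<bar>B_hat X u z\<bar> < c / 20" "\<bar>B_hat X v z\<bar> < c / 20"
        using unit by (auto simp: deviates_def)
      have small: "\<bar>B_hat X a z * B_hat X b z / B_hat X z z\<bar> \<le> (c / 20) / 19"
        if "a = u \<or> a = v" "b = u \<or> b = v" for a b
        using h that c by (intro small_quotient) auto
      have nonneg: "0 \<le> B_hat X a z * B_hat X a z / B_hat X z z" for a
        using h(4) c by (intro divide_nonneg_nonneg zero_le_square) linarith
      have "test_ok c (B u v) ((B_hat X u v - B_hat X u z * B_hat X v z / B_hat X z z) /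
        sqrt ((B_hat X u u - B_hat X u z * B_hat X u z / B_hat X z z) *
          (B_hat X v v - B_hat X v z * B_hat X v z / B_hat X z z)))"
        by (intro test_ok_residual small nonneg c h) auto
      moreover have "samp_cov n X l l \<noteq> 0"
      proof
        assume "samp_cov n X l l = 0"
        then have "B_hat X z z = 0" unfolding expand by simp
        then show False using h(4) c by simp
      qed
      moreover have "samp_cov n X l j = samp_cov n X j l" "samp_cov n X l k = samp_cov n X k l"
        by (simp_all add: samp_cov_def mult.commute)
      ultimately show False using X rho r by simp
    qed
    then have "prob {X \<in> space M. \<not> test_ok c (pcorr S j k s) (pcorr (samp_cov n X) j k s)} \<le> prob ?Bad"
      by (intro finite_measure_mono) measurable
    also have "\<dots> \<le> 4 * ?q + (4 * ?q + (4 * ?q + (4 * ?q + (4 * ?q + 4 * ?q))))"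
    proof -
      have dev': "prob (deviates c a z) \<le> 4 * ?q" if "B a a = 1" for a
        using dev[OF that unit(3)] .
      show ?thesis by (intro sub dev dev' unit sets.Un deviates_sets)
    qed
    finally show ?thesis by simp
  qed
qed

lemma measurable_samp_cov [measurable]:
  "j < d \<Longrightarrow> k < d \<Longrightarrow> (\<lambda>X. samp_cov n X j k) \<in> borel_measurable M"
  unfolding samp_cov_def by (intro borel_measurable_times borel_measurable_sum borel_measurable_const) auto

lemma measurable_pcorr [measurable]:
  assumes "j < d" "k < d" "s \<in> cond_sets d j k"
  shows "(\<lambda>X. pcorr (samp_cov n X) j k s) \<in> borel_measurable M"
proof (cases s)
  case None
  then show ?thesis using assms unfolding pcorr_def
    by simp
next
  case (Some l)
  then have "l < d" using assms(3) by (auto simp: cond_sets_def)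
  with Some assms show ?thesis unfolding pcorr_def by simp
qed

end

section \<open>Reduction to finitely many test decisions\<close>

definition tests :: "nat \<Rightarrow> (nat \<times> nat \<times> nat option) set" where
  "tests d = {(j, k, s). j < d \<and> k < d \<and> j \<noteq> k \<and> s \<in> cond_sets d j k}"

lemma tests_subset: "tests d \<subseteq> {..<d} \<times> {..<d} \<times> insert None (Some ` {..<d})"
  by (auto simp: tests_def cond_sets_def)

lemma finite_tests: "finite (tests d)"
  by (rule finite_subset[OF tests_subset]) auto

lemma card_tests: "1 \<le> d \<Longrightarrow> card (tests d) \<le> 2 * d ^ 3"
proof -
  assume d: "1 \<le> d"
  have "card (tests d) \<le> card ({..<d} \<times> {..<d} \<times> insert None (Some ` {..<d}))"
    by (intro card_mono tests_subset) auto
  also have "\<dots> = d * (d * Suc d)"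
    by (simp add: card_cartesian_product card_image image_iff)
  also have "\<dots> \<le> d * (d * (2 * d))" using d by (intro mult_le_mono) auto
  finally show ?thesis by (simp add: power3_eq_cube mult_ac)
qed

definition edges_of :: "nat \<Rightarrow> (nat \<times> nat \<times> nat option) set \<Rightarrow> (nat \<times> nat) set" where
  "edges_of d R = {(j, k). j < d \<and> k < d \<and> j \<noteq> k \<and> (\<forall>s \<in> cond_sets d j k. (j, k, s) \<in> R)}"

definition sep_of :: "nat \<Rightarrow> (nat \<times> nat \<times> nat option) set \<Rightarrow> nat \<Rightarrow> nat \<Rightarrow> nat option set" where
  "sep_of d R j k = {s \<in> cond_sets d j k. (j, k, s) \<notin> R}"

definition rejected :: "nat \<Rightarrow> real \<Rightarrow> (nat \<Rightarrow> nat \<Rightarrow> real) \<Rightarrow> (nat \<times> nat \<times> nat option) set" where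
  "rejected d c A = {(j, k, s) \<in> tests d. ci_reject c A j k s}"

lemma pc_edges_rejected: "pc_edges d c A = edges_of d (rejected d c A)"
  by (auto simp: pc_edges_def edges_of_def rejected_def tests_def)

text \<open>The two separating-set functions can differ outside \<open>tests d\<close>, for instance
  at \<open>j = k\<close>, but \<open>orient_v\<close> consults only distinct vertices that have a
  common neighbour.\<close>

lemma orient_results_rejected:
  "orient_results (pc_edges d c A) (sepset d c A)
   = orient_results (edges_of d (rejected d c A)) (sep_of d (rejected d c A))"
proof -
  have "orient_v (pc_edges d c A) (sepset d c A) = orient_v (pc_edges d c A) (sep_of d (rejected d c A))"
  proof -
    have "(Some l \<in> sepset d c A j k) = (Some l \<in> sep_of d (rejected d c A) j k)"
      if "j \<noteq> k" "adj (pc_edges d c A) j l" "adj (pc_edges d c A) k l" for j k l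
      using that by (auto simp: sepset_def sep_of_def rejected_def tests_def adj_def pc_edges_def)
    then show ?thesis unfolding orient_v_def by blast
  qed
  then show ?thesis unfolding orient_results_def pc_edges_rejected[symmetric] by simp
qed

context gaussian_sample
begin

text \<open>The output depends on the data only through the finite set of rejected tests, so its
  events are finite unions of measurable pieces. This matters because \<open>measure\<close> assigns
  0 to nonmeasurable sets.\<close>

lemma measurable_rejected:
  "{X \<in> space M. \<Phi> (rejected d c (samp_cov n X))} \<in> sets M"
proof -
  have 1: "{X \<in> space M. ci_reject c (samp_cov n X) j k s} \<in> sets M" if "(j, k, s) \<in> tests d" for j k s
  proof -
    have [measurable]: "(\<lambda>X. pcorr (samp_cov n X) j k s) \<in> borel_measurable M"
      using that by (intro measurable_pcorr) (auto simp: tests_def)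
    show ?thesis unfolding ci_reject_def by measurable
  qed
  have 2: "{X \<in> space M. rejected d c (samp_cov n X) = R} \<in> sets M" if R: "R \<subseteq> tests d" for R
  proof -
    have "{X \<in> space M. rejected d c (samp_cov n X) = R} = {X \<in> space M. \<forall>t\<in>tests d.
        X \<in> {X \<in> space M. case t of (j, k, s) \<Rightarrow> ci_reject c (samp_cov n X) j k s} \<longleftrightarrow> t \<in> R}"
      using R unfolding rejected_def by auto
    also have "\<dots> \<in> sets M"
    proof (intro sets.sets_Collect_finite_All finite_tests)
      fix t assume t: "t \<in> tests d"
      have "{X \<in> space M. case t of (j, k, s) \<Rightarrow> ci_reject c (samp_cov n X) j k s} \<in> sets M"
        using 1 t by (cases t) auto
      then show "{X \<in> space M. (X \<in> {X \<in> space M. case t of (j, k, s) \<Rightarrow> ci_reject c (samp_cov n X) j k s})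
          \<longleftrightarrow> t \<in> R} \<in> sets M"
        by (cases "t \<in> R") (auto intro: sets.sets_Collect_neg)
    qed
    finally show ?thesis .
  qed
  have "{X \<in> space M. \<Phi> (rejected d c (samp_cov n X))}
     = (\<Union>R \<in> {R \<in> Pow (tests d). \<Phi> R}. {X \<in> space M. rejected d c (samp_cov n X) = R})"
    by (auto simp: rejected_def)
  also have "\<dots> \<in> sets M"
    using finite_tests 2 by (intro sets.finite_UN) auto
  finally show ?thesis .
qed

lemma all_tests_ok:
  assumes c: "0 < c" "c < 1" and E: "E \<in> sets M"
    and sub: "\<And>X. X \<in> space M \<Longrightarrow>
      (\<And>j k s. (j, k, s) \<in> tests d \<Longrightarrow> test_ok c (pcorr S j k s) (pcorr (samp_cov n X) j k s)) \<Longrightarrow> X \<in> E"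
  shows "1 - real (card (tests d)) * (24 * exp (- c\<^sup>2 / 25600) ^ n) \<le> prob E"
proof -
  define F where "F t = {X \<in> space M. case t of (j, k, s) \<Rightarrow>
     \<not> test_ok c (pcorr S j k s) (pcorr (samp_cov n X) j k s)}" for t
  have Fm: "F t \<in> sets M" if "t \<in> tests d" for t
  proof -
    obtain j k s where t: "t = (j, k, s)" by (cases t)
    have [measurable]: "(\<lambda>X. pcorr (samp_cov n X) j k s) \<in> borel_measurable M"
      using that by (intro measurable_pcorr) (auto simp: tests_def t)
    show ?thesis unfolding F_def t test_ok_def prod.case by measurable
  qed
  have Fp: "prob (F t) \<le> 24 * exp (- c\<^sup>2 / 25600) ^ n" if "t \<in> tests d" for t
    using that test_failure[OF c] by (auto simp: F_def tests_def)
  have "space M - E \<subseteq> (\<Union>t\<in>tests d. F t)"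
    using sub by (fastforce simp: F_def)
  then have "prob (space M - E) \<le> prob (\<Union>t\<in>tests d. F t)"
    using Fm finite_tests by (intro finite_measure_mono) auto
  also have "\<dots> \<le> (\<Sum>t\<in>tests d. prob (F t))"
    using Fm finite_tests by (intro measure_UNION_le) auto
  also have "\<dots> \<le> (\<Sum>t\<in>tests d. 24 * exp (- c\<^sup>2 / 25600) ^ n)"
    using Fp by (intro sum_mono)
  finally show ?thesis using prob_compl[OF E] by simp
qed

end

text \<open>The deterministic part. Nonedges are detected by a vanishing correlation or partial
  correlation, edges by the first faithfulness condition; at a common neighbour, noncolliders are
  detected by a vanishing partial correlation and colliders by the second condition.\<close>

lemma pc_tree_correct:
  assumes T: "polytree d T" and lc: "local_cov d T S" and pd: "pd_on {..<d} S" and c: "0 < c"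
    and faithful: "strong_tree_faithful d T S c"
    and ok: "\<And>j k s. (j, k, s) \<in> tests d \<Longrightarrow> test_ok c (pcorr S j k s) (pcorr A j k s)"
  shows "pc_edges d c A = skel T"
    and "orient_results (pc_edges d c A) (sepset d c A) = {cpdag d T}"
proof -
  have dag: "dag d T" and forest: "\<not> has_undirected_cycle (skel T)"
    using T by (auto simp: polytree_def is_tree_def)
  have sym: "S i j = S j i" if "i < d" "j < d" for i j using pd_on_sym[OF pd] that by auto
  have diag: "S i i \<noteq> 0" if "i < d" for i
    using pd_on_pos[OF pd, of i "unit_vec i"] that by (simp add: bil_unit)
  have bound: "j < d \<and> k < d \<and> j \<noteq> k" if "(j, k) \<in> skel T" for j k
    using that dag_bound[OF dag] dag_irrefl[OF dag] by (auto simp: skel_def)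
  have acc: "\<not> ci_reject c A j k s" if "(j, k, s) \<in> tests d" "pcorr S j k s = 0" for j k s
    using ok[OF that(1)] that(2) by (simp add: test_ok_def ci_reject_def)
  have rej: "ci_reject c A j k s" if "(j, k, s) \<in> tests d" "c \<le> \<bar>pcorr S j k s\<bar>" for j k s
    using ok[OF that(1)] that(2) by (simp add: test_ok_def ci_reject_def)
  have pc0: "pcorr S j k (Some l) = 0" if "S j k * S l l = S j l * S l k" "l < d" for j k l
    using that diag[of l] by (simp add: pcorr_def field_simps)
  show edges: "pc_edges d c A = skel T"
  proof (intro equalityI subrelI)
    fix j k assume jk: "(j, k) \<in> pc_edges d c A"
    then have b: "j < d" "k < d" "j \<noteq> k" and all: "\<And>s. s \<in> cond_sets d j k \<Longrightarrow> ci_reject c A j k s"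
      by (auto simp: pc_edges_def)
    show "(j, k) \<in> skel T"
    proof (rule ccontr)
      assume "(j, k) \<notin> skel T"
      then consider "S j k = 0" | l where "l < d" "l \<noteq> j" "l \<noteq> k" "S j k * S l l = S j l * S l k"
        using nonadjacent_partial_zero[OF dag forest lc sym b] by blast
      then show False
      proof cases
        case 1
        then have "pcorr S j k None = 0" by (simp add: pcorr_def)
        then show False using acc[of j k None] all[of None] b by (simp add: tests_def cond_sets_def)
      next
        case 2
        then show False using acc[of j k "Some l"] all[of "Some l"] b pc0 by (simp add: tests_def cond_sets_def)
      qed
    qed
  next
    fix j k assume jk: "(j, k) \<in> skel T"
    then have "c \<le> \<bar>pcorr S j k s\<bar>" if "s \<in> cond_sets d j k" for s
      using faithful that by (auto simp: strong_tree_faithful_def)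
    then show "(j, k) \<in> pc_edges d c A"
      using bound[OF jk] rej by (auto simp: pc_edges_def tests_def)
  qed
  interpret polytree_orientation d T "sepset d c A"
  proof
    fix j k l
    assume h: "j \<noteq> k" "(j, k) \<notin> skel T" "(j, l) \<in> skel T" "(k, l) \<in> skel T"
    have mem: "Some l \<in> cond_sets d j k" and t: "(j, k, Some l) \<in> tests d"
      using bound[OF h(3)] bound[OF h(4)] h(1) by (auto simp: cond_sets_def tests_def)
    have "Some l \<notin> sepset d c A j k \<longleftrightarrow> ci_reject c A j k (Some l)"
      using mem by (simp add: sepset_def)
    also have "\<dots> \<longleftrightarrow> (j, l) \<in> T \<and> (k, l) \<in> T"
    proof
      assume r: "ci_reject c A j k (Some l)"
      show "(j, l) \<in> T \<and> (k, l) \<in> T"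
      proof (rule ccontr)
        assume "\<not> ?thesis"
        then have "S j k * S l l = S j l * S l k"
          using noncollider_partial_zero[OF dag forest lc sym h(1,3,4)] by blast
        then show False using acc[OF t] pc0 bound[OF h(3)] r by blast
      qed
    next
      assume "(j, l) \<in> T \<and> (k, l) \<in> T"
      then have "c \<le> \<bar>pcorr S j k (Some l)\<bar>"
        using faithful h(1,2) unfolding strong_tree_faithful_def by blast
      then show "ci_reject c A j k (Some l)" by (rule rej[OF t])
    qed
    finally show "Some l \<notin> sepset d c A j k \<longleftrightarrow> (j, l) \<in> T \<and> (k, l) \<in> T" .
  qed (rule T)
  show "orient_results (pc_edges d c A) (sepset d c A) = {cpdag d T}"
    unfolding edges by (rule orient_results_eq)
qed

text \<open>230400 = 9 * 25600, so the exponential is at most \<delta> / d^9. The number of tests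
  takes d^3, and 2 * 24 = 48 is absorbed by d^6 \<ge> 64.\<close>

lemma sample_size_bound:
  assumes d: "2 \<le> d" and c: "0 < c" and \<delta>: "0 < \<delta>" "\<delta> < 1"
    and n: "230400 / c\<^sup>2 * (ln (real d) + ln (1 / \<delta>)) \<le> real n"
  shows "real (2 * d ^ 3) * (24 * exp (- c\<^sup>2 / 25600) ^ n) \<le> \<delta>"
proof -
  have "230400 * (ln (real d) + ln (1 / \<delta>)) \<le> real n * c\<^sup>2"
    using n c by (simp add: field_simps)
  moreover have "ln (1 / \<delta>) = - ln \<delta>" using \<delta> by (simp add: ln_div)
  moreover have "ln \<delta> < 0" using \<delta> by simp
  ultimately have "real n * (- c\<^sup>2 / 25600) \<le> ln \<delta> - 9 * ln (real d)" by simp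
  then have "exp (- c\<^sup>2 / 25600) ^ n \<le> exp (ln \<delta> - 9 * ln (real d))"
    unfolding exp_of_nat_mult[symmetric] by simp
  also have "\<dots> = \<delta> / real d ^ 9"
    using \<delta> d exp_of_nat_mult[of 9 "ln (real d)"] by (simp add: exp_diff)
  finally have "real (2 * d ^ 3) * (24 * exp (- c\<^sup>2 / 25600) ^ n) \<le> real (2 * d ^ 3) * (24 * (\<delta> / real d ^ 9))"
    by (intro mult_left_mono) auto
  also have "\<dots> = 48 / real d ^ 6 * \<delta>"
  proof -
    have "real d ^ 9 = real d ^ 3 * real d ^ 6" by (simp add: power_add[symmetric])
    then show ?thesis using d by (simp only: of_nat_mult of_nat_power of_nat_numeral) (simp add: field_simps)
  qed
  also have "\<dots> \<le> 1 * \<delta>"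
  proof (intro mult_right_mono)
    have "(2::real) ^ 6 \<le> real d ^ 6" using d by (intro power_mono) auto
    then have "48 \<le> real d ^ 6" by simp
    then show "48 / real d ^ 6 \<le> 1" using d by (subst divide_le_eq_1_pos) auto
  qed (use \<delta> in simp)
  finally show ?thesis by simp
qed

theorem theorem5:
  "\<exists>C > 0. \<forall>(d::nat) (T::(nat \<times> nat) set) (\<Sigma>::nat \<Rightarrow> nat \<Rightarrow> real) (c::real) (\<delta>::real) (n::nat).
     polytree d T \<longrightarrow> 0 < c \<longrightarrow> c < 1 \<longrightarrow> 0 < \<delta> \<longrightarrow> \<delta> < 1 \<longrightarrow>
     pos_def d \<Sigma> \<longrightarrow> markov_density d T (gauss_dens d \<Sigma>) \<longrightarrow>
     strong_tree_faithful d T \<Sigma> c \<longrightarrow>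
     real n \<ge> C / c\<^sup>2 * (ln (real d) + ln (1 / \<delta>)) \<longrightarrow>
       measure (iid n (gauss d \<Sigma>))
         {X \<in> space (iid n (gauss d \<Sigma>)). pc_edges d c (samp_cov n X) = skel T} \<ge> 1 - \<delta> \<and>
       measure (iid n (gauss d \<Sigma>))
         {X \<in> space (iid n (gauss d \<Sigma>)).
            orient_results (pc_edges d c (samp_cov n X)) (sepset d c (samp_cov n X)) = {cpdag d T}}
         \<ge> 1 - \<delta>"
proof (rule exI[of _ 230400], rule conjI, simp, intro allI impI)
  fix d T \<Sigma> c \<delta> n
  assume T: "polytree d T" and c: "0 < c" "c < 1" and \<delta>: "0 < \<delta>" "\<delta> < (1::real)"
    and pdef: "pos_def d \<Sigma>" and markov: "markov_density d T (gauss_dens d \<Sigma>)"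
    and faithful: "strong_tree_faithful d T \<Sigma> c"
    and size: "230400 / c\<^sup>2 * (ln (real d) + ln (1 / \<delta>)) \<le> real n"
  have dag: "dag d T" and d: "1 \<le> d" using T by (auto simp: polytree_def is_tree_def)
  have pd: "pd_on {..<d} \<Sigma>" using pdef by (simp add: pos_def_iff_pd_on)
  obtain C where C: "0 < C" and dens: "\<And>x. gauss_dens d \<Sigma> x = C * exp (- bil {..<d} (minv d \<Sigma>) x x / 2)"
    and law: "\<And>s a. 0 < 1 + 2 * s * bil {..<d} \<Sigma> a a \<Longrightarrow>
      (\<integral>\<^sup>+ x. ennreal (exp (- s * (\<Sum>i<d. a i * x i)\<^sup>2)) \<partial>gauss d \<Sigma>)
        = ennreal (1 / sqrt (1 + 2 * s * bil {..<d} \<Sigma> a a))"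
    by (rule gauss_law[OF dag pdef markov]) (rule that)
  have "markov_density d T (\<lambda>x. C * exp (- bil {..<d} (minv d \<Sigma>) x x / 2))"
    using markov unfolding dens[symmetric] .
  then have lc: "local_cov d T \<Sigma>"
    by (rule local_cov_of_markov[OF dag _ pd precision_minv[OF pdef] C])
  \<comment> \<open>Since 1 / \<delta> exceeds 1, the required sample size is positive, which
    excludes an empty sample.\<close>
  have "0 < ln (1 / \<delta>)" "0 \<le> ln (real d)" using \<delta> d by auto
  then have "0 < 230400 / c\<^sup>2 * (ln (real d) + ln (1 / \<delta>))" using c by simp
  then have n: "0 < n" using size by (cases n) auto
  interpret gaussian_sample d \<Sigma> n by unfold_locales (use pd n law in auto)
  \<comment> \<open>For a single vertex \<open>ln (real d) = 0\<close> leaves nothing to absorb the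
    factor 48, but then there are no tests.\<close>
  have fail: "real (card (tests d)) * (24 * exp (- c\<^sup>2 / 25600) ^ n) \<le> \<delta>"
  proof (cases "d = 1")
    case True
    then have "tests d = {}" by (auto simp: tests_def)
    then show ?thesis using \<delta> by simp
  next
    case False
    then have "real (card (tests d)) * (24 * exp (- c\<^sup>2 / 25600) ^ n)
      \<le> real (2 * d ^ 3) * (24 * exp (- c\<^sup>2 / 25600) ^ n)"
      using card_tests[OF d] by (intro mult_right_mono) (auto simp del: of_nat_mult of_nat_power)
    also have "\<dots> \<le> \<delta>" using sample_size_bound[OF _ c(1) \<delta> size] False d by simp
    finally show ?thesis .
  qed
  note correct = pc_tree_correct[OF T lc pd c(1) faithful]
  have "1 - real (card (tests d)) * (24 * exp (- c\<^sup>2 / 25600) ^ n)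
    \<le> prob {X \<in> space M. pc_edges d c (samp_cov n X) = skel T}"
    using correct(1) measurable_rejected[of "\<lambda>R. edges_of d R = skel T" c]
    by (intro all_tests_ok[OF c]) (auto simp: pc_edges_rejected[symmetric])
  then have 1: "1 - \<delta> \<le> prob {X \<in> space M. pc_edges d c (samp_cov n X) = skel T}"
    using fail by linarith
  have "1 - real (card (tests d)) * (24 * exp (- c\<^sup>2 / 25600) ^ n)
    \<le> prob {X \<in> space M. orient_results (pc_edges d c (samp_cov n X)) (sepset d c (samp_cov n X)) = {cpdag d T}}"
    using correct(2) measurable_rejected[of "\<lambda>R. orient_results (edges_of d R) (sep_of d R) = {cpdag d T}" c]
    by (intro all_tests_ok[OF c]) (auto simp: orient_results_rejected[symmetric])
  then have 2: "1 - \<delta> \<le> prob {X \<in> space M.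
      orient_results (pc_edges d c (samp_cov n X)) (sepset d c (samp_cov n X)) = {cpdag d T}}"
    using fail by linarith
  show "1 - \<delta> \<le> prob {X \<in> space M. pc_edges d c (samp_cov n X) = skel T} \<and>
    1 - \<delta> \<le> prob {X \<in> space M.
      orient_results (pc_edges d c (samp_cov n X)) (sepset d c (samp_cov n X)) = {cpdag d T}}"
    using 1 2 by blast
qed

end
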